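(* Let $s>-1/4$ and $u,v\in X_{s,b}$. Then there exists $c>0$ such that $$\left\|\left(\frac{|\xi|^2\,\widetilde{uv}(\tau,\xi)}{2i\gamma(\xi)}\right)^{\sim^{-1}}\right\|_{X_{s,-a}}\leq c\,\|u\|_{X_{s,b}}\,\|v\|_{X_{s,b}}$$ holds in each of the following cases: (i) $s\geq 0$, $b>1/2$ and $1/4<a<1/2$; (ii) $-1/4<s<0$, $b>1/2$ and $1/4<a<1/2$ such that $|s|<a/2$. Moreover, the constant $c>0$ depends only on $a,b,s$ (in particular not on $u,v$).
   Context: Write $\langle a\rangle = 1+|a|$ and $\gamma(\xi)=\sqrt{\xi^2+\xi^4}$ for $\xi\in\mathbb{R}$. The symbol $\widetilde{F}(\tau,\xi)$ denotes the time-space Fourier transform of $F(t,x)$ on $\mathbb{R}^2$ ($\tau$ dual to $t$, $\xi$ dual to $x$), and $\sim^{-1}$ its inverse. For $s,b\in\mathbb{R}$, $X_{s,b}$ is the completion of the Schwartz class $\mathcal{S}(\mathbb{R}^2)$ with respect to the norm $$\|F\|_{X_{s,b}}=\big\|\langle|\tau|-\gamma(\xi)\rangle^b\langle\xi\rangle^s\,\widetilde{F}(\tau,\xi)\big\|_{L^2_{\tau,\xi}}.$$ The product $uv$ is understood through its Fourier transform $\widetilde{uv}=\widetilde u * \widetilde v$ (convolution in $(\tau,\xi)$, up to the normalization constant of the Fourier transform). *)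

theory Defs
  imports "HOL-Analysis.Analysis"
begin

text \<open>
  Points of the plane are pairs \<^term>\<open>(t, x)\<close>, time first; on the Fourier side they are
  pairs \<^term>\<open>(\<tau>, \<xi>)\<close>.
\<close>

definition bracket :: "real \<Rightarrow> real" where
  "bracket a = 1 + \<bar>a\<bar>"

definition gam :: "real \<Rightarrow> real" where
  "gam \<xi> = sqrt (\<xi>\<^sup>2 + \<xi> ^ 4)"

definition partial_t :: "(real \<times> real \<Rightarrow> complex) \<Rightarrow> real \<times> real \<Rightarrow> complex" where
  "partial_t F = (\<lambda>(t, x). vector_derivative (\<lambda>r. F (r, x)) (at t))"

definition partial_x :: "(real \<times> real \<Rightarrow> complex) \<Rightarrow> real \<times> real \<Rightarrow> complex" where
  "partial_x F = (\<lambda>(t, x). vector_derivative (\<lambda>r. F (t, r)) (at x))"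

definition partials :: "nat \<Rightarrow> nat \<Rightarrow> (real \<times> real \<Rightarrow> complex) \<Rightarrow> real \<times> real \<Rightarrow> complex" where
  "partials m n F = (partial_t ^^ m) ((partial_x ^^ n) F)"

text \<open>
  The first conjunct says that F is infinitely differentiable: it is enough to require it of the
  iterated partial derivatives in this order, since they are then continuous and
  mixed derivatives commute.
\<close>

definition schwartz :: "(real \<times> real \<Rightarrow> complex) \<Rightarrow> bool" where
  "schwartz F \<longleftrightarrow>
     (\<forall>m n p. partials m n F differentiable (at p)) \<and>
     (\<forall>j k m n. bounded (range (\<lambda>(t, x). t ^ j * x ^ k * norm (partials m n F (t, x)))))"

definition fourier :: "(real \<times> real \<Rightarrow> complex) \<Rightarrow> real \<times> real \<Rightarrow> complex" where
  "fourier F = (\<lambda>(\<tau>, \<xi>). LINT (t, x)|lborel.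
     exp (- \<i> * complex_of_real (t * \<tau> + x * \<xi>)) * F (t, x))"

definition weight :: "real \<Rightarrow> real \<Rightarrow> real \<times> real \<Rightarrow> real" where
  "weight s b = (\<lambda>(\<tau>, \<xi>). bracket (\<bar>\<tau>\<bar> - gam \<xi>) powr b * bracket \<xi> powr s)"

definition weighted_L2 :: "real \<Rightarrow> real \<Rightarrow> (real \<times> real \<Rightarrow> complex) set" where
  "weighted_L2 s b = {G \<in> borel_measurable lborel.
     integrable lborel (\<lambda>p. (weight s b p * norm (G p))\<^sup>2)}"

text \<open>Meaningful for G in \<^term>\<open>weighted_L2 s b\<close> only.\<close>

definition weighted_L2_norm :: "real \<Rightarrow> real \<Rightarrow> (real \<times> real \<Rightarrow> complex) \<Rightarrow> real" where
  "weighted_L2_norm s b G = sqrt (LINT p|lborel. (weight s b p * norm (G p))\<^sup>2)"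

definition schwartz_norm :: "real \<Rightarrow> real \<Rightarrow> (real \<times> real \<Rightarrow> complex) \<Rightarrow> real" where
  "schwartz_norm s b F = weighted_L2_norm s b (fourier F)"

text \<open>
  The space \<^term>\<open>X s b\<close> below is the completion of the Schwartz class for \<^term>\<open>schwartz_norm s b\<close>,
  realised as Cauchy sequences modulo null sequences.
\<close>

definition X_Cauchy :: "real \<Rightarrow> real \<Rightarrow> (nat \<Rightarrow> real \<times> real \<Rightarrow> complex) set" where
  "X_Cauchy s b = {F. (\<forall>n. schwartz (F n)) \<and>
     (\<forall>e>0. \<exists>N. \<forall>m\<ge>N. \<forall>n\<ge>N. schwartz_norm s b (\<lambda>p. F m p - F n p) < e)}"

definition X_rel ::
  "real \<Rightarrow> real \<Rightarrow>
    ((nat \<Rightarrow> real \<times> real \<Rightarrow> complex) \<times> (nat \<Rightarrow> real \<times> real \<Rightarrow> complex)) set" where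
  "X_rel s b = {(F, G). F \<in> X_Cauchy s b \<and> G \<in> X_Cauchy s b \<and>
     (\<lambda>n. schwartz_norm s b (\<lambda>p. F n p - G n p)) \<longlonglongrightarrow> 0}"

definition X :: "real \<Rightarrow> real \<Rightarrow> (nat \<Rightarrow> real \<times> real \<Rightarrow> complex) set set" where
  "X s b = X_Cauchy s b // X_rel s b"

definition X_norm :: "real \<Rightarrow> real \<Rightarrow> (nat \<Rightarrow> real \<times> real \<Rightarrow> complex) set \<Rightarrow> real" where
  "X_norm s b u = (THE r. \<forall>F\<in>u. (\<lambda>n. schwartz_norm s b (F n)) \<longlonglongrightarrow> r)"

text \<open>
  The Fourier transform extends to the completion: W is the transform of u if the transforms of
  the Schwartz functions in any sequence representing u converge to W in the weighted
  L2 space. Such a W exists, because weighted L2 spaces are complete, and it is determined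
  up to a null set; conversely W determines u. Hence \<^term>\<open>has_X_fourier s b u W\<close> also expresses
  that u is the inverse Fourier transform of W.
\<close>

definition has_X_fourier ::
  "real \<Rightarrow> real \<Rightarrow> (nat \<Rightarrow> real \<times> real \<Rightarrow> complex) set \<Rightarrow> (real \<times> real \<Rightarrow> complex) \<Rightarrow> bool" where
  "has_X_fourier s b u W \<longleftrightarrow> u \<in> X s b \<and> W \<in> weighted_L2 s b \<and>
     (\<forall>F\<in>u. (\<lambda>n. weighted_L2_norm s b (\<lambda>p. fourier (F n) p - W p)) \<longlonglongrightarrow> 0)"

text \<open>A representative of the Fourier transform of u, which is a class of functions modulo null sets.\<close>

definition X_fourier ::
  "real \<Rightarrow> real \<Rightarrow> (nat \<Rightarrow> real \<times> real \<Rightarrow> complex) set \<Rightarrow> real \<times> real \<Rightarrow> complex" where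
  "X_fourier s b u = (SOME W. has_X_fourier s b u W)"

text \<open>
  The Fourier transform of a product, in terms of the Fourier transforms of the factors. The constant
  is the one for which this is the transform of the pointwise product when the
  factors are Schwartz functions, given the normalisation of \<^term>\<open>fourier\<close>.
  The integral is meaningful only where \<^term>\<open>conv_integrable U V p\<close> holds.
\<close>

definition conv_integrable ::
  "(real \<times> real \<Rightarrow> complex) \<Rightarrow> (real \<times> real \<Rightarrow> complex) \<Rightarrow> real \<times> real \<Rightarrow> bool" where
  "conv_integrable U V p \<longleftrightarrow> integrable lborel (\<lambda>q. U q * V (p - q))"

definition fourier_prod ::
  "(real \<times> real \<Rightarrow> complex) \<Rightarrow> (real \<times> real \<Rightarrow> complex) \<Rightarrow> real \<times> real \<Rightarrow> complex" where
  "fourier_prod U V p = (LINT q|lborel. U q * V (p - q)) / complex_of_real ((2 * pi)\<^sup>2)"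

end

theory Submission
  imports Defs "HOL-Probability.Probability"
begin

text \<open>
  Write \<open>\<langle>x\<rangle> = 1 + |x|\<close>, let \<open>p = (\<tau>, \<xi>)\<close> be the output variable of the convolution,
  \<open>q = (\<tau>\<^sub>1, \<xi>\<^sub>1)\<close> and \<open>p - q = (\<tau>\<^sub>2, \<xi>\<^sub>2)\<close> the input variables, and
  \<open>\<sigma>, \<sigma>\<^sub>1, \<sigma>\<^sub>2\<close> the values of \<open>\<langle>|\<tau>| - \<xi>\<^sup>2\<rangle>\<close> at these three points. Because
  \<open>|\<gamma>(\<xi>) - \<xi>\<^sup>2| \<le> 1/2\<close>, these are comparable with the modulations in the norm, and the multiplier
  \<open>\<xi>\<^sup>2 / 2\<gamma>(\<xi>)\<close> is bounded. After moving the weights onto the functions, the estimate says that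
  the integral operator with kernel

  \<open>\<langle>\<xi>\<rangle>\<^sup>s / (\<langle>\<xi>\<^sub>1\<rangle>\<^sup>s \<langle>\<xi>\<^sub>2\<rangle>\<^sup>s) \<cdot> \<sigma>\<^sup>-\<^sup>a \<sigma>\<^sub>1\<^sup>-\<^sup>b \<sigma>\<^sub>2\<^sup>-\<^sup>b\<close>

  acting on \<open>f(q) g(p - q)\<close> is bounded from \<open>L\<^sup>2 \<times> L\<^sup>2\<close> to \<open>L\<^sup>2\<close>. By duality and the Cauchy-Schwarz
  inequality it is enough to split the kernel into pieces whose squares have a bounded integral
  when one of the three points is fixed, the supremum being taken over that point. As
  \<open>R = \<langle>\<xi>\<^sub>1\<rangle>\<langle>\<xi>\<^sub>2\<rangle> / \<langle>\<xi>\<rangle> \<ge> 1\<close> and \<open>s \<ge> -a/2\<close>, the frequency weights contribute at most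
  \<open>R\<^bsup>a/2\<^esup>\<close>. There are three regions (\<open>kernel_core_le\<close>).

  If \<open>|\<xi>| < 1\<close>, then \<open>R \<le> \<langle>\<xi>\<^sub>1\<rangle>\<^sup>2\<close>; fix \<open>q\<close>. The integral over \<open>\<tau>\<close> leaves
  \<open>\<langle>\<tau>\<^sub>1 \<plusminus> (\<xi> - \<xi>\<^sub>1)\<^sup>2\<rangle>\<^bsup>-2a\<^esup>\<close>, whose integral over the bounded set of \<open>\<xi>\<close> is
  \<open>O(\<langle>\<xi>\<^sub>1\<rangle>\<^bsup>-2a\<^esup>)\<close> because \<open>2a < 1\<close>; this pays for \<open>R\<^sup>a\<close> exactly (\<open>nn_integral_parab_low\<close>).

  If \<open>|\<xi>| \<ge> 1\<close> and one of \<open>|\<xi>\<^sub>1|, |\<xi>\<^sub>2|\<close> is less than 1, then \<open>R \<le> 4\<close>; fix \<open>p\<close>.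

  If all three frequencies are at least 1 in modulus, the resonance identity
  (\<open>resonance\<close>) gives \<open>R \<le> 9 max(\<sigma>, \<sigma>\<^sub>1, \<sigma>\<^sub>2)\<^sup>2\<close>; so \<open>R\<^bsup>a/2\<^esup>\<close> is absorbed by the power \<open>a\<close> of the
  largest modulation, and since \<open>a \<le> b\<close> the powers can be exchanged so that the other two carry
  the power \<open>b\<close>. Fix the point with the largest modulation.

  In the last two regions the integral is that of \<open>nn_integral_parab_conv\<close>: as \<open>2b > 1\<close> the integral over
  the time frequency leaves \<open>\<langle>\<phi>\<rangle>\<^bsup>-2b\<^esup>\<close>, where \<open>\<phi>\<close> is a polynomial in the remaining frequency,
  either quadratic with leading coefficient 2 or affine with slope \<open>\<plusminus>2\<xi>\<close>, \<open>\<xi>\<close> being the frequency of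
  the fixed point; as \<open>|\<xi>| \<ge> 1\<close>, the integral is bounded.

  To speak about the completion one needs that the Fourier transform identifies it with the
  weighted \<open>L\<^sup>2\<close> space. Transforms of Schwartz functions lie in that space since they decay
  rapidly (\<open>fourier_in_weighted_L2\<close>), so every element of the completion has a transform by
  completeness (\<open>weighted_L2_complete\<close>). Conversely every element of the weighted space is a
  limit of such transforms (\<open>fourier_schwartz_dense\<close>): all Gaussians are
  transforms of Gaussians, powers of Gaussians are Gaussians, and
  \<open>1 - (1 - h\<^sup>n)\<^sup>N\<close> with \<open>N = n 2\<^sup>n\<close> is a combination of positive powers of \<open>h\<close> that tends to the indicator of
  \<open>h \<ge> 1/2\<close> for \<open>0 \<le> h \<le> 1\<close>. So indicators of boxes are limits, and then all
  of \<open>L\<^sup>2\<close>.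
\<close>

section \<open>Integrals of brackets over the line\<close>

lemma bracket_ge_1: "1 \<le> bracket x"
  and bracket_pos: "0 < bracket x"
  and bracket_nonneg: "0 \<le> bracket x"
  and bracket_minus: "bracket (- x) = bracket x"
  by (auto simp: bracket_def)

lemma bracket_add_le: "bracket (x + y) \<le> bracket x * bracket y"
proof -
  have "1 + \<bar>x + y\<bar> \<le> 1 + \<bar>x\<bar> + \<bar>y\<bar> + \<bar>x\<bar> * \<bar>y\<bar>"
    by (smt (verit) abs_triangle_ineq mult_nonneg_nonneg abs_ge_zero)
  then show ?thesis by (simp add: bracket_def algebra_simps)
qed

lemma bracket_diff_le: "bracket (x - y) \<le> bracket x * bracket y"
  using bracket_add_le[of x "-y"] by (simp add: bracket_minus)

lemma continuous_on_bracket [continuous_intros]: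
  "continuous_on A f \<Longrightarrow> continuous_on A (\<lambda>x. bracket (f x))"
  unfolding bracket_def by (intro continuous_intros)

lemma borel_measurable_bracket [measurable (raw)]:
  "f \<in> borel_measurable M \<Longrightarrow> (\<lambda>x. bracket (f x)) \<in> borel_measurable M"
  unfolding bracket_def by measurable

lemma continuous_on_gam [continuous_intros]:
  "continuous_on A f \<Longrightarrow> continuous_on A (\<lambda>x. gam (f x))"
  unfolding gam_def by (intro continuous_intros)

lemma borel_measurable_gam [measurable (raw)]:
  assumes [measurable]: "f \<in> borel_measurable M"
  shows "(\<lambda>x. gam (f x)) \<in> borel_measurable M"
  unfolding gam_def by measurable

lemma bracket_powr_antimono:
  "bracket x \<le> c * bracket y \<Longrightarrow> 0 < c \<Longrightarrow> 0 \<le> e \<Longrightarrow> bracket y powr (-e) \<le> c powr e * bracket x powr (-e)"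
proof -
  assume a: "bracket x \<le> c * bracket y" "0 < c" "0 \<le> e"
  have "bracket x powr e \<le> (c * bracket y) powr e"
    using a by (intro powr_mono2) (auto simp: bracket_nonneg)
  then have "bracket x powr e \<le> c powr e * bracket y powr e"
    using a by (simp add: powr_mult bracket_nonneg)
  then show ?thesis
    using bracket_pos[of x] bracket_pos[of y]
    by (simp add: powr_minus field_simps)
qed

lemma bracket_powr_le_1: "0 \<le> e \<Longrightarrow> bracket x powr (-e) \<le> 1"
  using bracket_ge_1[of x] by (simp add: powr_minus ge_one_powr_ge_zero inverse_le_1_iff)

definition bracket_mass :: "real \<Rightarrow> ennreal" where
  "bracket_mass B = (\<integral>\<^sup>+x. ennreal (bracket x powr (-B)) \<partial>lborel)"

lemma bracket_mass_finite:
  assumes "B > 1" shows "bracket_mass B < \<infinity>"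
proof -
  let ?g = "\<lambda>y::real. ennreal (y powr (-B)) * indicator {1..} y"
  have g: "(\<integral>\<^sup>+y. ?g y \<partial>lborel) < \<infinity>"
    using nn_integral_has_integral_lebesgue'[OF _ has_integral_powr_to_inf[of "-B" 1]] assms
    by simp
  have "bracket_mass B \<le> (\<integral>\<^sup>+x. ?g (1 + 1 * x) + ?g (1 + (-1) * x) \<partial>lborel)"
    unfolding bracket_mass_def
    by (intro nn_integral_mono) (auto simp: bracket_def abs_if indicator_def)
  also have "\<dots> = (\<integral>\<^sup>+x. ?g (1 + 1 * x) \<partial>lborel) + (\<integral>\<^sup>+x. ?g (1 + (-1) * x) \<partial>lborel)"
    by (intro nn_integral_add) auto
  also have "\<dots> = (\<integral>\<^sup>+y. ?g y \<partial>lborel) + (\<integral>\<^sup>+y. ?g y \<partial>lborel)"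
    using nn_integral_real_affine[of ?g 1 1] nn_integral_real_affine[of ?g "-1" 1]
    by simp
  also have "\<dots> < \<infinity>" using g by simp
  finally show ?thesis .
qed

lemma nn_integral_bracket_affine:
  assumes "\<bar>k\<bar> \<ge> 1"
  shows "(\<integral>\<^sup>+x. ennreal (bracket (c + k * x) powr (-B)) \<partial>lborel) \<le> bracket_mass B"
proof -
  let ?I = "\<integral>\<^sup>+x. ennreal (bracket (c + k * x) powr (-B)) \<partial>lborel"
  have "bracket_mass B = ennreal \<bar>k\<bar> * ?I"
    unfolding bracket_mass_def
    by (rule nn_integral_real_affine) (use assms in auto)
  moreover have "1 * ?I \<le> ennreal \<bar>k\<bar> * ?I"
    using assms by (intro mult_right_mono) auto
  ultimately show ?thesis by simp
qed

text \<open>The bracket of \<open>y - z\<close> is at most twice the larger one of those of \<open>y\<close> and \<open>z\<close>. If that is the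
  bracket of \<open>z\<close>, the whole factor with exponent \<open>\<beta>\<close> can be taken out. Otherwise a part \<open>\<beta>\<close> of the
  exponent \<open>B\<close> is spent on \<open>y - z\<close>, and the remaining \<open>B - \<beta>\<close> is handed over to the smaller
  bracket of \<open>z\<close>.\<close>

lemma bracket_powr_conv_le:
  assumes "0 \<le> \<beta>" "\<beta> \<le> B"
  shows "bracket y powr (-B) * bracket z powr (-\<beta>) \<le>
    2 powr \<beta> * bracket (y - z) powr (-\<beta>) * (bracket y powr (-B) + bracket z powr (-B))"
proof (cases "bracket (y - z) \<le> 2 * bracket z")
  case True
  have "bracket z powr (-\<beta>) \<le> 2 powr \<beta> * bracket (y - z) powr (-\<beta>)"
    using bracket_powr_antimono[OF True _ assms(1)] by simp
  then have "bracket y powr (-B) * bracket z powr (-\<beta>) \<le>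
      bracket y powr (-B) * (2 powr \<beta> * bracket (y - z) powr (-\<beta>))"
    by (intro mult_left_mono) auto
  also have "\<dots> \<le> 2 powr \<beta> * bracket (y - z) powr (-\<beta>) * (bracket y powr (-B) + bracket z powr (-B))"
    by (simp add: algebra_simps)
  finally show ?thesis .
next
  case False
  have le: "bracket (y - z) \<le> bracket y + bracket z" by (auto simp: bracket_def)
  with False have a: "bracket (y - z) \<le> 2 * bracket y" "bracket z \<le> 1 * bracket y" by linarith+
  have "bracket y powr (-B) = bracket y powr (-\<beta>) * bracket y powr (-(B-\<beta>))"
    by (simp flip: powr_add)
  also have "\<dots> \<le> (2 powr \<beta> * bracket (y - z) powr (-\<beta>)) * (1 powr (B-\<beta>) * bracket z powr (-(B-\<beta>)))"
    using bracket_powr_antimono[OF a(1), of \<beta>] bracket_powr_antimono[OF a(2), of "B - \<beta>"] assms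
    by (intro mult_mono) auto
  finally have "bracket y powr (-B) * bracket z powr (-\<beta>) \<le>
     (2 powr \<beta> * bracket (y - z) powr (-\<beta>)) * (1 powr (B-\<beta>) * bracket z powr (-(B-\<beta>))) * bracket z powr (-\<beta>)"
    by (intro mult_right_mono) auto
  also have "\<dots> = 2 powr \<beta> * bracket (y - z) powr (-\<beta>) * bracket z powr (-B)"
    by (simp add: mult.assoc flip: powr_add)
  also have "\<dots> \<le> 2 powr \<beta> * bracket (y - z) powr (-\<beta>) * (bracket y powr (-B) + bracket z powr (-B))"
    by (intro mult_left_mono) auto
  finally show ?thesis .
qed

text \<open>Convolution with a power \<open>B > 1\<close> preserves the decay \<open>\<beta> \<le> B\<close>.\<close>

lemma nn_integral_bracket_conv:
  assumes "0 \<le> \<beta>" "\<beta> \<le> B"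
  shows "(\<integral>\<^sup>+x. ennreal (bracket (x + c) powr (-B) * bracket (x + d) powr (-\<beta>)) \<partial>lborel) \<le>
    2 * ennreal (2 powr \<beta>) * bracket_mass B * ennreal (bracket (c - d) powr (-\<beta>))"
proof -
  let ?k = "2 powr \<beta> * bracket (c - d) powr (-\<beta>)"
  have "(\<integral>\<^sup>+x. ennreal (bracket (x + c) powr (-B) * bracket (x + d) powr (-\<beta>)) \<partial>lborel) \<le>
     (\<integral>\<^sup>+x. ennreal ?k * (ennreal (bracket (c + 1 * x) powr (-B)) + ennreal (bracket (d + 1 * x) powr (-B))) \<partial>lborel)"
  proof (rule nn_integral_mono)
    fix x :: real
    show "ennreal (bracket (x + c) powr (-B) * bracket (x + d) powr (-\<beta>)) \<le>
      ennreal ?k * (ennreal (bracket (c + 1 * x) powr (-B)) + ennreal (bracket (d + 1 * x) powr (-B)))"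
      using bracket_powr_conv_le[OF assms, of "x + c" "x + d"]
      by (simp flip: ennreal_plus ennreal_mult' add: ennreal_leI add.commute)
  qed
  also have "\<dots> = ennreal ?k * ((\<integral>\<^sup>+x. ennreal (bracket (c + 1 * x) powr (-B)) \<partial>lborel) + (\<integral>\<^sup>+x. ennreal (bracket (d + 1 * x) powr (-B)) \<partial>lborel))"
    by (subst nn_integral_cmult) (auto simp: nn_integral_add)
  also have "\<dots> \<le> ennreal ?k * (bracket_mass B + bracket_mass B)"
    by (intro mult_left_mono add_mono nn_integral_bracket_affine) auto
  also have "\<dots> = 2 * ennreal (2 powr \<beta>) * bracket_mass B * ennreal (bracket (c - d) powr (-\<beta>))"
    by (simp add: ennreal_mult' algebra_simps mult_2)
  finally show ?thesis .
qed

text \<open>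
  Uniform in c: for \<open>c = - 2 r\<^sup>2\<close> and \<open>y = x - m\<close> one has
  \<open>|c + 2 y\<^sup>2| = 2 ||y| - r| (|y| + r) \<ge> 2 (|y| - r)\<^sup>2\<close>, so the integrand is dominated by two
  translates of the one for \<open>c = 0\<close>.
\<close>

lemma nn_integral_bracket_quadratic:
  assumes "B \<ge> 0"
  shows "(\<integral>\<^sup>+x. ennreal (bracket (c + 2 * (x - m)\<^sup>2) powr (-B)) \<partial>lborel) \<le> 2 * ennreal (2 powr B) * bracket_mass B"
proof -
  define r where "r = sqrt (max 0 (- c / 2))"
  have pw: "bracket (c + 2 * (x - m)\<^sup>2) powr (-B) \<le>
     2 powr B * (bracket (-m - r + 1 * x) powr (-B) + bracket (-m + r + 1 * x) powr (-B))" for x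
  proof -
    define y where "y = x - m"
    have r0: "r \<ge> 0" by (simp add: r_def)
    have sq: "\<bar>z\<bar> \<le> 1 + 2 * z\<^sup>2" for z :: real
    proof -
      have "(\<bar>z\<bar> - 1)\<^sup>2 \<ge> 0" by simp
      then have "2 * \<bar>z\<bar> \<le> 1 + z\<^sup>2" by (simp add: power2_diff)
      then show ?thesis using zero_le_power2[of z] by linarith
    qed
    have key: "2 * (\<bar>y\<bar> - r)\<^sup>2 \<le> \<bar>c + 2 * y\<^sup>2\<bar>"
    proof (cases "c \<ge> 0")
      case True
      then have "r = 0" by (simp add: r_def)
      then show ?thesis using True by simp
    next
      case False
      then have c: "c = - 2 * r\<^sup>2" by (simp add: r_def)
      have "\<bar>c + 2 * y\<^sup>2\<bar> = 2 * \<bar>(\<bar>y\<bar> - r) * (\<bar>y\<bar> + r)\<bar>"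
        unfolding c by (simp add: algebra_simps power2_eq_square abs_if)
      also have "\<dots> = 2 * (\<bar>\<bar>y\<bar> - r\<bar> * (\<bar>y\<bar> + r))" using r0 by (simp add: abs_mult)
      also have "\<dots> \<ge> 2 * (\<bar>\<bar>y\<bar> - r\<bar> * \<bar>\<bar>y\<bar> - r\<bar>)"
        using r0 by (intro mult_left_mono) (auto simp: abs_if)
      finally show ?thesis by (simp add: power2_eq_square)
    qed
    have "bracket (\<bar>y\<bar> - r) \<le> 2 * bracket (c + 2 * y\<^sup>2)"
    proof -
      have "bracket (\<bar>y\<bar> - r) \<le> 2 + 1 * \<bar>c + 2 * y\<^sup>2\<bar>"
        using order_trans[OF sq add_left_mono[OF key]] by (simp add: bracket_def)
      also have "\<dots> \<le> 2 + 2 * \<bar>c + 2 * y\<^sup>2\<bar>"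
        by (intro add_left_mono mult_right_mono) auto
      finally show ?thesis by (simp add: bracket_def)
    qed
    from bracket_powr_antimono[OF this _ assms]
    have *: "bracket (c + 2 * y\<^sup>2) powr (-B) \<le> 2 powr B * bracket (\<bar>y\<bar> - r) powr (-B)" by simp
    have "bracket (\<bar>y\<bar> - r) powr (-B) \<le> bracket (y - r) powr (-B) + bracket (y + r) powr (-B)"
      using bracket_minus[of "y + r"] by (auto simp: abs_if)
    then have "2 powr B * bracket (\<bar>y\<bar> - r) powr (-B) \<le> 2 powr B * (bracket (y - r) powr (-B) + bracket (y + r) powr (-B))"
      by (intro mult_left_mono) auto
    with * show ?thesis by (simp add: y_def algebra_simps)
  qed
  have "(\<integral>\<^sup>+x. ennreal (bracket (c + 2 * (x - m)\<^sup>2) powr (-B)) \<partial>lborel) \<le>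
    (\<integral>\<^sup>+x. ennreal (2 powr B) * (ennreal (bracket (-m - r + 1 * x) powr (-B)) + ennreal (bracket (-m + r + 1 * x) powr (-B))) \<partial>lborel)"
    by (intro nn_integral_mono order_trans[OF ennreal_leI[OF pw]]) (simp add: ennreal_mult')
  also have "\<dots> = ennreal (2 powr B) * ((\<integral>\<^sup>+x. ennreal (bracket (-m - r + 1 * x) powr (-B)) \<partial>lborel) + (\<integral>\<^sup>+x. ennreal (bracket (-m + r + 1 * x) powr (-B)) \<partial>lborel))"
    by (subst nn_integral_cmult) (auto simp: nn_integral_add)
  also have "\<dots> \<le> ennreal (2 powr B) * (bracket_mass B + bracket_mass B)"
    by (intro mult_left_mono add_mono nn_integral_bracket_affine) auto
  finally show ?thesis by (simp add: mult_ac flip: mult_2)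
qed

section \<open>The distance to the parabolas\<close>

lemma nn_integral_plane:
  fixes f :: "real \<times> real \<Rightarrow> ennreal"
  assumes "f \<in> borel_measurable borel"
  shows "(\<integral>\<^sup>+p. f p \<partial>lborel) = (\<integral>\<^sup>+\<xi>. \<integral>\<^sup>+\<tau>. f (\<tau>, \<xi>) \<partial>lborel \<partial>lborel)"
proof -
  have "f \<in> borel_measurable (lborel \<Otimes>\<^sub>M lborel)" using assms by (simp add: lborel_prod)
  from lborel_pair.nn_integral_snd[OF this] show ?thesis by (simp add: lborel_prod)
qed

lemma snd_borel_measurable: "(snd :: real \<times> real \<Rightarrow> real) \<in> borel_measurable borel"
  by (intro borel_measurable_continuous_onI continuous_intros)

lemma bracket_le_double: "\<bar>x\<bar> \<le> \<bar>y\<bar> + 1 \<Longrightarrow> bracket x \<le> 2 * bracket y"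
proof -
  assume "\<bar>x\<bar> \<le> \<bar>y\<bar> + 1"
  also have "\<bar>y\<bar> + 1 \<le> 2 * \<bar>y\<bar> + 1" using mult_right_mono[of 1 2 "\<bar>y\<bar>"] by simp
  finally show ?thesis by (simp add: bracket_def)
qed

text \<open>The modulation with \<open>\<gamma>(\<xi>)\<close> replaced by \<open>\<xi>\<^sup>2\<close>, so that sums of modulations become polynomials.\<close>

definition parab :: "real \<times> real \<Rightarrow> real" where
  "parab = (\<lambda>(\<tau>, \<xi>). bracket (\<bar>\<tau>\<bar> - \<xi>\<^sup>2))"

lemma parab_ge_1: "1 \<le> parab p"
  by (auto simp: parab_def bracket_ge_1 split: prod.split)

lemma parab_pos: "0 < parab p"
  using parab_ge_1[of p] by linarith

lemma parab_minus: "parab (- p) = parab p"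
  by (cases p) (simp add: parab_def)

lemma continuous_on_parab: "continuous_on UNIV parab"
  unfolding parab_def split_beta by (intro continuous_intros)

lemma borel_measurable_parab [measurable]: "parab \<in> borel_measurable borel"
  by (rule borel_measurable_continuous_onI[OF continuous_on_parab])

lemma parab_le_bracket: "parab (\<tau>, \<xi>) \<le> 2 * bracket (\<bar>\<tau>\<bar> - gam \<xi>)"
proof -
  have "\<xi>\<^sup>2 \<le> gam \<xi>" unfolding gam_def by (rule real_le_rsqrt) simp
  moreover have "gam \<xi> \<le> \<xi>\<^sup>2 + 1/2" unfolding gam_def
    by (rule real_le_lsqrt) (auto simp: power2_eq_square power4_eq_xxxx algebra_simps)
  ultimately have "\<bar>\<bar>\<tau>\<bar> - \<xi>\<^sup>2\<bar> \<le> \<bar>\<bar>\<tau>\<bar> - gam \<xi>\<bar> + 1/2" by linarith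
  then have "\<bar>\<bar>\<tau>\<bar> - \<xi>\<^sup>2\<bar> \<le> \<bar>\<bar>\<tau>\<bar> - gam \<xi>\<bar> + 1" by linarith
  then show ?thesis by (simp add: parab_def bracket_le_double)
qed

lemma parab_powr_le:
  "0 \<le> B \<Longrightarrow> parab (\<tau>, \<xi>) powr (-B) \<le> bracket (\<tau> + \<xi>\<^sup>2) powr (-B) + bracket (\<tau> + - \<xi>\<^sup>2) powr (-B)"
  using bracket_minus[of "\<tau> + \<xi>\<^sup>2"] by (auto simp: parab_def abs_if)

text \<open>For fixed p = (\<tau>, \<xi>) the \<tau>-integration leaves the bracket of a function of the frequency
  of q alone. If the two signs agree it is a quadratic polynomial with leading coefficient 2; if they
  differ, the squares cancel and it is affine with slope \<open>\<plusminus>2\<xi>\<close>. Hence the restriction on \<open>\<xi>\<close>.\<close>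

lemma nn_integral_parab_conv:
  assumes B: "B > 1" and \<xi>: "\<bar>snd p\<bar> \<ge> 1"
  shows "(\<integral>\<^sup>+q. ennreal (parab q powr (-B) * parab (p - q) powr (-B)) \<partial>lborel)
     \<le> 4 * (2 * ennreal (2 powr B) * bracket_mass B)\<^sup>2"
proof -
  obtain \<tau> \<xi> where p: "p = (\<tau>, \<xi>)" by (cases p)
  let ?I = "\<lambda>e1 e2. \<integral>\<^sup>+x. ennreal (bracket (\<tau> + e1 * x\<^sup>2 + e2 * (\<xi> - x)\<^sup>2) powr (-B)) \<partial>lborel"
  have xi: "\<bar>\<xi>\<bar> \<ge> 1" using \<xi> p by simp
  let ?C = "2 * ennreal (2 powr B) * bracket_mass B"
  let ?f = "\<lambda>e1 e2 x t. ennreal (bracket (t + e1 * x\<^sup>2) powr (-B) * bracket (t + - (\<tau> + e2 * (\<xi> - x)\<^sup>2)) powr (-B))"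
  have tint: "(\<integral>\<^sup>+t. ?f e1 e2 x t \<partial>lborel) \<le> ?C * ennreal (bracket (\<tau> + e1 * x\<^sup>2 + e2 * (\<xi> - x)\<^sup>2) powr (-B))" for e1 e2 x
    using nn_integral_bracket_conv[of B B "e1 * x\<^sup>2" "- (\<tau> + e2 * (\<xi> - x)\<^sup>2)"] B
    by (simp add: algebra_simps)
  have C1: "bracket_mass B \<le> ?C"
  proof -
    have "1 * bracket_mass B \<le> (2 * ennreal (2 powr B)) * bracket_mass B"
      using ge_one_powr_ge_zero[of 2 B] B
      by (intro mult_right_mono) (simp_all flip: ennreal_numeral ennreal_1 ennreal_mult')
    then show ?thesis by simp
  qed
  have xint: "?I e1 e2 \<le> ?C"
    if e: "e1 \<in> {1, -1}" "e2 \<in> {1, -1::real}" for e1 e2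
  proof (cases "e1 = e2")
    case True
    have "bracket (\<tau> + e1 * x\<^sup>2 + e2 * (\<xi> - x)\<^sup>2) = bracket ((e1 * \<tau> + \<xi>\<^sup>2 / 2) + 2 * (x - \<xi> / 2)\<^sup>2)" for x
    proof -
      have "(e1 * \<tau> + \<xi>\<^sup>2 / 2) + 2 * (x - \<xi> / 2)\<^sup>2 = e1 * (\<tau> + e1 * x\<^sup>2 + e2 * (\<xi> - x)\<^sup>2)"
        using True e by (auto simp: power2_eq_square field_simps)
      moreover have "bracket (e1 * y) = bracket y" for y using e bracket_minus by auto
      ultimately show ?thesis by metis
    qed
    then show ?thesis
      using nn_integral_bracket_quadratic[of B "e1 * \<tau> + \<xi>\<^sup>2 / 2" "\<xi> / 2"] B by simp
  next
    case False
    have "\<tau> + e1 * x\<^sup>2 + e2 * (\<xi> - x)\<^sup>2 = (\<tau> + e2 * \<xi>\<^sup>2) + (e1 * 2 * \<xi>) * x" for x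
      using False e by (auto simp: power2_eq_square algebra_simps)
    moreover have "\<bar>e1 * 2 * \<xi>\<bar> \<ge> 1" using xi e by (auto simp: abs_mult)
    ultimately have "?I e1 e2 \<le> bracket_mass B"
      using nn_integral_bracket_affine[of "e1 * 2 * \<xi>" "\<tau> + e2 * \<xi>\<^sup>2" B] by presburger
    then show ?thesis using C1 by (rule order_trans)
  qed
  have tx: "(\<integral>\<^sup>+x. \<integral>\<^sup>+t. ?f e1 e2 x t \<partial>lborel \<partial>lborel) \<le> ?C\<^sup>2"
    if e: "e1 \<in> {1, -1}" "e2 \<in> {1, -1::real}" for e1 e2
  proof -
    have "(\<integral>\<^sup>+x. \<integral>\<^sup>+t. ?f e1 e2 x t \<partial>lborel \<partial>lborel) \<le>
      (\<integral>\<^sup>+x. ?C * ennreal (bracket (\<tau> + e1 * x\<^sup>2 + e2 * (\<xi> - x)\<^sup>2) powr (-B)) \<partial>lborel)"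
      by (intro nn_integral_mono tint)
    also have "\<dots> = ?C * ?I e1 e2"
      by (intro nn_integral_cmult) simp
    also have "\<dots> \<le> ?C * ?C" by (intro mult_left_mono xint e) simp
    finally show ?thesis by (simp add: power2_eq_square)
  qed
  have "(\<integral>\<^sup>+q. ennreal (parab q powr (-B) * parab (p - q) powr (-B)) \<partial>lborel) =
    (\<integral>\<^sup>+x. \<integral>\<^sup>+t. ennreal (parab (t, x) powr (-B) * parab (p - (t, x)) powr (-B)) \<partial>lborel \<partial>lborel)"
    by (rule nn_integral_plane) measurable
  also have "\<dots> \<le> (\<integral>\<^sup>+x. \<integral>\<^sup>+t. (?f 1 1 x t + ?f 1 (-1) x t) + (?f (-1) 1 x t + ?f (-1) (-1) x t) \<partial>lborel \<partial>lborel)"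
  proof (intro nn_integral_mono)
    fix x t :: real
    let ?b = "\<lambda>y. bracket y powr (-B)"
    have "parab (t, x) powr (-B) * parab (p - (t, x)) powr (-B) \<le>
      (?b (t + x\<^sup>2) + ?b (t + - x\<^sup>2)) * (?b ((\<tau> - t) + (\<xi> - x)\<^sup>2) + ?b ((\<tau> - t) + - (\<xi> - x)\<^sup>2))"
      using B parab_powr_le[of B t x] parab_powr_le[of B "\<tau> - t" "\<xi> - x"]
      unfolding p by (intro mult_mono) auto
    also have "?b ((\<tau> - t) + (\<xi> - x)\<^sup>2) = ?b (t + - (\<tau> + 1 * (\<xi> - x)\<^sup>2))"
      by (subst bracket_minus[symmetric]) (simp add: algebra_simps)
    also have "?b ((\<tau> - t) + - (\<xi> - x)\<^sup>2) = ?b (t + - (\<tau> + (-1) * (\<xi> - x)\<^sup>2))"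
      by (subst bracket_minus[symmetric]) (simp add: algebra_simps)
    finally have le: "parab (t, x) powr (-B) * parab (p - (t, x)) powr (-B) \<le>
      (?b (t + x\<^sup>2) + ?b (t + - x\<^sup>2)) * (?b (t + - (\<tau> + 1 * (\<xi> - x)\<^sup>2)) + ?b (t + - (\<tau> + (-1) * (\<xi> - x)\<^sup>2)))" .
    show "ennreal (parab (t, x) powr (-B) * parab (p - (t, x)) powr (-B)) \<le>
      (?f 1 1 x t + ?f 1 (-1) x t) + (?f (-1) 1 x t + ?f (-1) (-1) x t)"
      using ennreal_leI[OF le] by (simp add: algebra_simps flip: ennreal_plus)
  qed
  also have "\<dots> = ((\<integral>\<^sup>+x. \<integral>\<^sup>+t. ?f 1 1 x t \<partial>lborel \<partial>lborel) + (\<integral>\<^sup>+x. \<integral>\<^sup>+t. ?f 1 (-1) x t \<partial>lborel \<partial>lborel))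
     + ((\<integral>\<^sup>+x. \<integral>\<^sup>+t. ?f (-1) 1 x t \<partial>lborel \<partial>lborel) + (\<integral>\<^sup>+x. \<integral>\<^sup>+t. ?f (-1) (-1) x t \<partial>lborel \<partial>lborel))"
    by (simp add: nn_integral_add)
  also have "\<dots> \<le> (?C\<^sup>2 + ?C\<^sup>2) + (?C\<^sup>2 + ?C\<^sup>2)"
    by (intro add_mono tx) auto
  also have "\<dots> = 4 * ?C\<^sup>2"
  proof -
    have "(c + c) + (c + c) = 4 * c" for c :: ennreal
      using distrib_right[of 1 1 c] distrib_right[of 2 2 c] by simp
    then show ?thesis .
  qed
  finally show ?thesis .
qed

text \<open>Where \<open>|x - e| > 1\<close> the integrand is at most 1; the rest of the interval lies in the unit
  neighbourhood of \<open>e\<close>, the integral over which does not depend on \<open>e\<close>.\<close>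

lemma nn_integral_interval_powr:
  assumes "0 \<le> \<beta>" "\<beta> < 1"
  shows "\<exists>C<\<infinity>. \<forall>e::real. (\<integral>\<^sup>+x. ennreal (\<bar>x - e\<bar> powr (-\<beta>)) * indicator {-1..1} x \<partial>lborel) \<le> C"
proof -
  let ?I = "\<lambda>e::real. \<integral>\<^sup>+x. ennreal (\<bar>x - e\<bar> powr (-\<beta>)) * indicator {-1..1} x \<partial>lborel"
  let ?g = "\<lambda>y::real. ennreal (y powr (-\<beta>)) * indicator {0..1} y"
  let ?G = "\<integral>\<^sup>+y. ?g y \<partial>lborel"
  have g: "?G < \<infinity>"
    using nn_integral_has_integral_lebesgue'[OF _ has_integral_powr_from_0[of "-\<beta>" 1]] assms
    by simp
  have "?I e \<le> 2 + (?G + ?G)" for e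
  proof -
    have "?I e \<le>
      (\<integral>\<^sup>+x. indicator {-1..1} x + (?g (-e + 1 * x) + ?g (e + (-1) * x)) \<partial>lborel)"
    proof (rule nn_integral_mono)
      fix x
      have far: "\<bar>x - e\<bar> powr (-\<beta>) \<le> 1" if "\<bar>x - e\<bar> > 1"
        using that assms powr_mono2'[of "-\<beta>" 1 "\<bar>x - e\<bar>"] by simp
      show "ennreal (\<bar>x - e\<bar> powr (-\<beta>)) * indicator {-1..1} x \<le>
        indicator {-1..1} x + (?g (-e + 1 * x) + ?g (e + (-1) * x))"
      proof (cases "\<bar>x - e\<bar> > 1")
        case True
        then show ?thesis using far
          by (intro order_trans[OF _ add_increasing2[OF _ order_refl]])
             (auto simp: indicator_def)
      next
        case False
        then have "ennreal (\<bar>x - e\<bar> powr (-\<beta>)) \<le> ?g (-e + 1 * x) + ?g (e + (-1) * x)"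
          by (cases "x \<ge> e") (auto simp: indicator_def abs_if)
        then have "ennreal (\<bar>x - e\<bar> powr (-\<beta>)) * indicator {-1..1} x \<le> ?g (-e + 1 * x) + ?g (e + (-1) * x)"
          by (rule order_trans[rotated]) (auto simp: indicator_def)
        then show ?thesis by (rule order_trans) simp
      qed
    qed
    also have "\<dots> = 2 + ((\<integral>\<^sup>+x. ?g (-e + 1 * x) \<partial>lborel) + (\<integral>\<^sup>+x. ?g (e + (-1) * x) \<partial>lborel))"
      by (simp add: nn_integral_add)
    also have "\<dots> = 2 + (?G + ?G)"
      using nn_integral_real_affine[of ?g 1 "-e"] nn_integral_real_affine[of ?g "-1" e] by simp
    finally show ?thesis .
  qed
  moreover have "2 + (?G + ?G) < \<infinity>" using g by simp
  ultimately show ?thesis by blast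
qed

text \<open>For \<open>|z| > 4\<close> the difference \<open>x - z\<close> has constant sign on the interval and modulus at least
  \<open>\<langle>z\<rangle>/2\<close>. If \<open>c = - r\<^sup>2\<close>, then \<open>c + (x - z)\<^sup>2\<close> has the factors \<open>|x - z| + r\<close>, which is at least
  \<open>\<langle>z\<rangle>/2\<close>, and \<open>|x - z| - r\<close>, which up to sign is the distance of \<open>x\<close> to a fixed point \<open>e\<close>. If
  \<open>c \<ge> 0\<close>, the same lower bound holds with \<open>r = 0\<close>.\<close>

lemma nn_integral_interval_bracket:
  assumes "0 \<le> \<beta>" "\<beta> < 1"
  shows "\<exists>C<\<infinity>. \<forall>c z. (\<integral>\<^sup>+x. ennreal (bracket (c + (x - z)\<^sup>2) powr (-\<beta>)) * indicator {-1..1} x \<partial>lborel)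
     \<le> C * ennreal (bracket z powr (-\<beta>))"
proof -
  let ?I = "\<lambda>e::real. \<integral>\<^sup>+x. ennreal (\<bar>x - e\<bar> powr (-\<beta>)) * indicator {-1..1} x \<partial>lborel"
  let ?J = "\<lambda>c z. \<integral>\<^sup>+x. ennreal (bracket (c + (x - z)\<^sup>2) powr (-\<beta>)) * indicator {-1..1} x \<partial>lborel"
  obtain C where C: "C < \<infinity>"
    "\<And>e. ?I e \<le> C"
    using nn_integral_interval_powr[OF assms] by blast
  let ?D = "2 * ennreal (5 powr \<beta>) + ennreal (2 powr \<beta>) * C"
  have "?J c z
     \<le> ?D * ennreal (bracket z powr (-\<beta>))" for c z
  proof (cases "\<bar>z\<bar> \<le> 4")
    case True
    have "?J c z
      \<le> (\<integral>\<^sup>+x. indicator {-1..1::real} x \<partial>lborel)"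
      using bracket_powr_le_1[OF assms(1)]
      by (intro nn_integral_mono) (auto simp: indicator_def)
    also have "\<dots> = 2" by simp
    also have "\<dots> \<le> 2 * ennreal (5 powr \<beta> * bracket z powr (-\<beta>))"
    proof -
      have "bracket z \<le> 5 * bracket 0" using True by (simp add: bracket_def)
      from bracket_powr_antimono[OF this _ assms(1)]
      have "1 \<le> 5 powr \<beta> * bracket z powr (-\<beta>)" by (simp add: bracket_def)
      then have "2 * ennreal 1 \<le> 2 * ennreal (5 powr \<beta> * bracket z powr (-\<beta>))"
        by (intro mult_left_mono ennreal_leI) auto
      then show ?thesis by simp
    qed
    also have "\<dots> = (2 * ennreal (5 powr \<beta>)) * ennreal (bracket z powr (-\<beta>))"
      by (simp add: ennreal_mult' mult.assoc)
    also have "\<dots> \<le> ?D * ennreal (bracket z powr (-\<beta>))" by (intro mult_right_mono) auto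
    finally show ?thesis .
  next
    case False
    define r where "r = sqrt (max 0 (- c))"
    define e where "e = (if z > 0 then z - r else z + r)"
    have r0: "r \<ge> 0" by (simp add: r_def)
    have pw: "bracket (c + (x - z)\<^sup>2) powr (-\<beta>) \<le> 2 powr \<beta> * bracket z powr (-\<beta>) * \<bar>x - e\<bar> powr (-\<beta>)"
      if x: "x \<in> {-1..1}" "x \<noteq> e" for x
    proof -
      define y where "y = x - z"
      have "1 + \<bar>z\<bar> \<le> \<bar>y\<bar> + \<bar>y\<bar>" using x(1) False unfolding y_def atLeastAtMost_iff by linarith
      then have y: "bracket z / 2 \<le> \<bar>y\<bar>" by (simp add: bracket_def)
      have ye: "\<bar>x - e\<bar> = \<bar>\<bar>y\<bar> - r\<bar>"
      proof (cases "z > 0")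
        case True
        then have "\<bar>y\<bar> = z - x" using x(1) False by (auto simp: y_def)
        then show ?thesis using True by (simp add: e_def)
      next
        case z: False
        then have "\<bar>y\<bar> = x - z" using x(1) False by (auto simp: y_def)
        then show ?thesis using z by (simp add: e_def algebra_simps)
      qed
      have "\<bar>y\<bar> * \<bar>\<bar>y\<bar> - r\<bar> \<le> \<bar>c + y\<^sup>2\<bar>"
      proof (cases "c \<ge> 0")
        case True
        then have "r = 0" by (simp add: r_def)
        then show ?thesis using True by (simp add: power2_eq_square)
      next
        case False
        then have c: "c = - r\<^sup>2" by (simp add: r_def)
        have "\<bar>c + y\<^sup>2\<bar> = \<bar>(\<bar>y\<bar> + r) * (\<bar>y\<bar> - r)\<bar>"
          unfolding c by (simp add: algebra_simps power2_eq_square)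
        also have "\<dots> = (\<bar>y\<bar> + r) * \<bar>\<bar>y\<bar> - r\<bar>" using r0 by (simp add: abs_mult)
        finally show ?thesis using r0 by (simp add: mult_right_mono)
      qed
      moreover have "bracket z / 2 * \<bar>x - e\<bar> \<le> \<bar>y\<bar> * \<bar>\<bar>y\<bar> - r\<bar>"
        unfolding ye using y by (intro mult_right_mono) auto
      ultimately have "bracket z / 2 * \<bar>x - e\<bar> \<le> bracket (c + (x - z)\<^sup>2)"
        by (simp add: bracket_def y_def)
      then have "bracket (c + (x - z)\<^sup>2) powr (-\<beta>) \<le> (bracket z / 2 * \<bar>x - e\<bar>) powr (-\<beta>)"
        using assms x bracket_pos[of z] by (intro powr_mono2') auto
      also have "\<dots> = 2 powr \<beta> * bracket z powr (-\<beta>) * \<bar>x - e\<bar> powr (-\<beta>)"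
        using bracket_pos[of z] by (simp add: powr_mult powr_divide powr_minus field_simps)
      finally show ?thesis .
    qed
    have "AE x in lborel. x \<noteq> e" by (rule AE_lborel_singleton)
    then have "?J c z \<le>
      (\<integral>\<^sup>+x. ennreal (2 powr \<beta> * bracket z powr (-\<beta>)) * (ennreal (\<bar>x - e\<bar> powr (-\<beta>)) * indicator {-1..1} x) \<partial>lborel)"
      by (intro nn_integral_mono_AE, eventually_elim)
         (use pw in \<open>auto simp: indicator_def simp flip: ennreal_mult' intro!: ennreal_leI\<close>)
    also have "\<dots> = ennreal (2 powr \<beta> * bracket z powr (-\<beta>)) * ?I e"
      by (intro nn_integral_cmult) simp
    also have "\<dots> \<le> ennreal (2 powr \<beta> * bracket z powr (-\<beta>)) * C"
      by (intro mult_left_mono C(2)) simp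
    also have "\<dots> = (ennreal (2 powr \<beta>) * C) * ennreal (bracket z powr (-\<beta>))"
      by (simp add: ennreal_mult' mult_ac)
    also have "\<dots> \<le> ?D * ennreal (bracket z powr (-\<beta>))" by (intro mult_right_mono) auto
    finally show ?thesis .
  qed
  moreover have "?D < \<infinity>" using C(1) by (simp add: ennreal_mult_less_top)
  ultimately show ?thesis by blast
qed

text \<open>Here the frequency of \<open>p\<close> is bounded, so the modulation of \<open>p\<close> is comparable with the bracket of its
  time frequency. The integral over the latter leaves \<open>\<langle>t \<plusminus> (x - z)\<^sup>2\<rangle>\<^bsup>-\<beta>\<^esup>\<close> with \<open>q = (t, z)\<close>, and
  integrating in \<open>x\<close> gains the power of \<open>\<langle>z\<rangle>\<close> that compensates the growing factor.\<close>

lemma nn_integral_parab_low: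
  assumes \<beta>: "0 \<le> \<beta>" "\<beta> < 1" and B: "B > 1"
  shows "\<exists>C<\<infinity>. \<forall>q. (\<integral>\<^sup>+p. ennreal (bracket (snd q) powr \<beta> * (parab p powr (-\<beta>) * parab (p - q) powr (-B)))
      * indicator {-1..1} (snd p) \<partial>lborel) \<le> C"
proof -
  let ?J = "\<lambda>c z. \<integral>\<^sup>+x. ennreal (bracket (c + (x - z)\<^sup>2) powr (-\<beta>)) * indicator {-1..1} x \<partial>lborel"
  obtain C where C: "C < \<infinity>"
    "\<And>c z. ?J c z
     \<le> C * ennreal (bracket z powr (-\<beta>))"
    using nn_integral_interval_bracket[OF \<beta>] by blast
  let ?K = "2 * ennreal (2 powr \<beta>) * bracket_mass B"
  let ?D = "ennreal (2 powr \<beta>) * ?K * (C + C)"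
  have "(\<integral>\<^sup>+p. ennreal (bracket (snd q) powr \<beta> * (parab p powr (-\<beta>) * parab (p - q) powr (-B)))
      * indicator {-1..1} (snd p) \<partial>lborel) \<le> ?D" for q
  proof -
    obtain t z where q: "q = (t, z)" by (cases q)
    let ?k = "ennreal (bracket z powr \<beta> * 2 powr \<beta>)"
    let ?f = "\<lambda>e x \<tau>. ennreal (bracket (\<tau> + (- t + e * (x - z)\<^sup>2)) powr (-B) * bracket (\<tau> + 0) powr (-\<beta>))"
    have "(\<integral>\<^sup>+p. ennreal (bracket (snd q) powr \<beta> * (parab p powr (-\<beta>) * parab (p - q) powr (-B)))
      * indicator {-1..1} (snd p) \<partial>lborel) =
      (\<integral>\<^sup>+x. \<integral>\<^sup>+\<tau>. ennreal (bracket z powr \<beta> * (parab (\<tau>, x) powr (-\<beta>) * parab ((\<tau>, x) - q) powr (-B)))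
         * indicator {-1..1} x \<partial>lborel \<partial>lborel)"
    proof (rule trans[OF nn_integral_plane])
      show "(\<lambda>p. ennreal (bracket (snd q) powr \<beta> * (parab p powr (-\<beta>) * parab (p - q) powr (-B)))
        * indicator {-1..1} (snd p)) \<in> borel_measurable borel"
      proof -
        have [measurable]: "(\<lambda>p. parab (p - q)) \<in> borel_measurable borel"
          by (intro borel_measurable_continuous_onI continuous_on_compose2[OF continuous_on_parab] continuous_intros) auto
        have [measurable]: "(\<lambda>p::real \<times> real. indicator {-1..1} (snd p) :: ennreal) \<in> borel_measurable borel"
          by (rule measurable_compose[OF snd_borel_measurable]) simp
        show ?thesis by simp
      qed
    qed (simp add: q)
    also have "\<dots> \<le> (\<integral>\<^sup>+x. (\<integral>\<^sup>+\<tau>. ?k * (?f 1 x \<tau> + ?f (-1) x \<tau>) \<partial>lborel) * indicator {-1..1} x \<partial>lborel)"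
    proof (intro nn_integral_mono)
      fix x :: real
      show "(\<integral>\<^sup>+\<tau>. ennreal (bracket z powr \<beta> * (parab (\<tau>, x) powr (-\<beta>) * parab ((\<tau>, x) - q) powr (-B)))
         * indicator {-1..1} x \<partial>lborel) \<le> (\<integral>\<^sup>+\<tau>. ?k * (?f 1 x \<tau> + ?f (-1) x \<tau>) \<partial>lborel) * indicator {-1..1} x"
      proof (cases "x \<in> {-1..1}")
        case True
        have eqs: "\<tau> - t + (x - z)\<^sup>2 = \<tau> + (- t + 1 * (x - z)\<^sup>2)"
          "\<tau> - t + - (x - z)\<^sup>2 = \<tau> + (- t + (-1) * (x - z)\<^sup>2)" for \<tau> by simp_all
        have le: "bracket z powr \<beta> * (parab (\<tau>, x) powr (-\<beta>) * parab ((\<tau>, x) - q) powr (-B)) \<le>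
           bracket z powr \<beta> * ((2 powr \<beta> * bracket \<tau> powr (-\<beta>)) *
            (bracket (\<tau> - t + (x - z)\<^sup>2) powr (-B) + bracket (\<tau> - t + - (x - z)\<^sup>2) powr (-B)))" for \<tau>
        proof (intro mult_mono)
          have "x\<^sup>2 \<le> 1" using True by (auto simp: abs_square_le_1)
          then have "\<bar>\<tau>\<bar> \<le> \<bar>\<bar>\<tau>\<bar> - x\<^sup>2\<bar> + 1" by linarith
          then have "bracket \<tau> \<le> 2 * bracket (\<bar>\<tau>\<bar> - x\<^sup>2)" by (rule bracket_le_double)
          from bracket_powr_antimono[OF this _ \<beta>(1)]
          show "parab (\<tau>, x) powr (-\<beta>) \<le> 2 powr \<beta> * bracket \<tau> powr (-\<beta>)"
            by (simp add: parab_def)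
          show "parab ((\<tau>, x) - q) powr (-B) \<le>
            bracket (\<tau> - t + (x - z)\<^sup>2) powr (-B) + bracket (\<tau> - t + - (x - z)\<^sup>2) powr (-B)"
            using parab_powr_le[of B "\<tau> - t" "x - z"] B by (simp add: q)
        qed auto
        have "ennreal (bracket z powr \<beta> * (parab (\<tau>, x) powr (-\<beta>) * parab ((\<tau>, x) - q) powr (-B))) \<le>
           ?k * (?f 1 x \<tau> + ?f (-1) x \<tau>)" for \<tau>
          by (rule order_trans[OF ennreal_leI[OF le[unfolded eqs]]])
             (simp add: ennreal_mult ennreal_plus mult_ac distrib_left distrib_right)
        then show ?thesis using True by (auto intro!: nn_integral_mono)
      qed simp
    qed
    also have "\<dots> = (\<integral>\<^sup>+x. ?k * ((\<integral>\<^sup>+\<tau>. ?f 1 x \<tau> \<partial>lborel) + (\<integral>\<^sup>+\<tau>. ?f (-1) x \<tau> \<partial>lborel)) * indicator {-1..1} x \<partial>lborel)"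
      by (simp add: nn_integral_add nn_integral_cmult)
    also have "\<dots> \<le> (\<integral>\<^sup>+x. ?k * (?K * ennreal (bracket (-t + 1 * (x - z)\<^sup>2 - 0) powr (-\<beta>)) +
         ?K * ennreal (bracket (-t + (-1) * (x - z)\<^sup>2 - 0) powr (-\<beta>))) * indicator {-1..1} x \<partial>lborel)"
      by (intro nn_integral_mono mult_right_mono mult_left_mono add_mono nn_integral_bracket_conv)
         (use \<beta> B in auto)
    also have "\<dots> = (\<integral>\<^sup>+x. ?k * ?K * (ennreal (bracket (-t + (x - z)\<^sup>2) powr (-\<beta>)) * indicator {-1..1} x +
          ennreal (bracket (t + (x - z)\<^sup>2) powr (-\<beta>)) * indicator {-1..1} x) \<partial>lborel)"
    proof -
      have "bracket (-t + (-1) * (x - z)\<^sup>2 - 0) = bracket (t + (x - z)\<^sup>2)" for x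
        by (subst bracket_minus[symmetric]) simp
      then show ?thesis by (simp add: algebra_simps)
    qed
    also have "\<dots> = ?k * ?K * (?J (-t) z +
          ?J t z)"
      by (subst nn_integral_cmult) (auto simp: nn_integral_add)
    also have "\<dots> \<le> ?k * ?K * (C * ennreal (bracket z powr (-\<beta>)) + C * ennreal (bracket z powr (-\<beta>)))"
      by (intro mult_left_mono add_mono C(2)) auto
    also have "\<dots> = (ennreal (bracket z powr \<beta>) * ennreal (bracket z powr (-\<beta>))) * ?D"
      by (simp add: ennreal_mult' algebra_simps)
    also have "ennreal (bracket z powr \<beta>) * ennreal (bracket z powr (-\<beta>)) = 1"
      using bracket_pos[of z] by (simp flip: ennreal_mult' powr_add)
    finally show ?thesis by simp
  qed
  moreover have "?D < \<infinity>" using C(1) bracket_mass_finite[OF B] by (simp add: ennreal_mult_less_top)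
  ultimately show ?thesis by blast
qed

section \<open>Resonance and the kernel of the bilinear operator\<close>

text \<open>In the signed sum of the three modulations the moduli of the time frequencies cancel, and the squares
  leave only the mixed term.\<close>

lemma resonance_aux:
  fixes x1 x2 t0 t1 t2 :: real
  assumes "\<bar>t0\<bar> = \<bar>t1\<bar> + \<bar>t2\<bar>" "parab (t0, x1 + x2) \<le> m" "parab (t1, x1) \<le> m" "parab (t2, x2) \<le> m"
  shows "2 * \<bar>x1 * x2\<bar> \<le> 3 * m"
proof -
  have "2 * (x1 * x2) = (\<bar>t1\<bar> - x1\<^sup>2) + (\<bar>t2\<bar> - x2\<^sup>2) - (\<bar>t0\<bar> - (x1 + x2)\<^sup>2)"
    using assms(1) by (simp add: power2_sum)
  moreover have "\<bar>2 * (x1 * x2)\<bar> = 2 * \<bar>x1 * x2\<bar>" by (simp add: abs_mult)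
  moreover have "\<bar>u + v - w\<bar> \<le> \<bar>u\<bar> + \<bar>v\<bar> + \<bar>w\<bar>" for u v w :: real by linarith
  ultimately have "2 * \<bar>x1 * x2\<bar> \<le> \<bar>\<bar>t1\<bar> - x1\<^sup>2\<bar> + \<bar>\<bar>t2\<bar> - x2\<^sup>2\<bar> + \<bar>\<bar>t0\<bar> - (x1 + x2)\<^sup>2\<bar>"
    by metis
  also have "\<dots> \<le> m + m + m"
    using assms(2-4) unfolding parab_def bracket_def prod.case by (intro add_mono) linarith+
  finally show ?thesis by simp
qed

text \<open>One of the numbers \<open>|t1|, |t2|, |t1 + t2|\<close> is the sum of the other two. Which one it is
  decides which two of the three frequencies have a product controlled by the modulations.\<close>

lemma resonance:
  assumes "parab (t1 + t2, x1 + x2) \<le> m" "parab (t1, x1) \<le> m" "parab (t2, x2) \<le> m"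
  shows "2 * \<bar>x1 * x2\<bar> \<le> 3 * m \<or> 2 * \<bar>(x1 + x2) * x2\<bar> \<le> 3 * m \<or> 2 * \<bar>(x1 + x2) * x1\<bar> \<le> 3 * m"
proof -
  consider "\<bar>t1 + t2\<bar> = \<bar>t1\<bar> + \<bar>t2\<bar>" | "\<bar>t1\<bar> = \<bar>t1 + t2\<bar> + \<bar>t2\<bar>" | "\<bar>t2\<bar> = \<bar>t1 + t2\<bar> + \<bar>t1\<bar>"
    by linarith
  then show ?thesis
  proof cases
    case 1
    then show ?thesis using resonance_aux[OF 1 assms] by blast
  next
    case 2
    have "parab (t2, - x2) \<le> m" using assms(3) by (simp add: parab_def)
    with resonance_aux[of t1 "t1 + t2" t2 "x1 + x2" "- x2" m] show ?thesis using 2 assms by simp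
  next
    case 3
    have "parab (t1, - x1) \<le> m" using assms(2) by (simp add: parab_def)
    with resonance_aux[of t2 "t1 + t2" t1 "x1 + x2" "- x1" m] show ?thesis using 3 assms by simp
  qed
qed

lemma bracket_le_2: "\<bar>x\<bar> \<ge> 1 \<Longrightarrow> bracket x \<le> 2 * \<bar>x\<bar>"
  by (simp add: bracket_def)

lemma freq_ratio_le:
  "bracket x1 * bracket x2 \<le> bracket (x1 + x2) * (bracket x1)\<^sup>2"
  "bracket x1 * bracket x2 \<le> bracket (x1 + x2) * (bracket x2)\<^sup>2"
proof -
  have "bracket x2 \<le> bracket (x1 + x2) * bracket x1" using bracket_diff_le[of "x1 + x2" x1] by simp
  then have "bracket x1 * bracket x2 \<le> bracket x1 * (bracket (x1 + x2) * bracket x1)"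
    by (intro mult_left_mono bracket_nonneg)
  then show "bracket x1 * bracket x2 \<le> bracket (x1 + x2) * (bracket x1)\<^sup>2"
    by (simp add: power2_eq_square mult_ac)
  have "bracket x1 \<le> bracket (x1 + x2) * bracket x2" using bracket_diff_le[of "x1 + x2" x2] by simp
  then have "bracket x1 * bracket x2 \<le> (bracket (x1 + x2) * bracket x2) * bracket x2"
    by (intro mult_right_mono bracket_nonneg)
  then show "bracket x1 * bracket x2 \<le> bracket (x1 + x2) * (bracket x2)\<^sup>2"
    by (simp add: power2_eq_square mult_ac)
qed

text \<open>Its power \<open>-s\<close> is the quotient of the frequency weights of the output and the two inputs.\<close>

definition freq_ratio :: "real \<Rightarrow> real \<Rightarrow> real" where
  "freq_ratio x1 x2 = bracket x1 * bracket x2 / bracket (x1 + x2)"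

lemma freq_ratio_bounds:
  "1 \<le> freq_ratio x1 x2" "freq_ratio x1 x2 \<le> (bracket x1)\<^sup>2" "freq_ratio x1 x2 \<le> (bracket x2)\<^sup>2"
  "freq_ratio x1 x2 \<le> bracket x1 * bracket x2"
  using freq_ratio_le[of x1 x2] bracket_add_le[of x1 x2] bracket_pos[of "x1 + x2"]
    mult_right_mono[OF bracket_ge_1[of "x1 + x2"], of "bracket x1 * bracket x2"]
    bracket_nonneg[of x1] bracket_nonneg[of x2]
  by (simp_all add: freq_ratio_def field_simps)

text \<open>If the product controlled by the resonance is that of the input frequencies, it dominates the
  ratio. Otherwise its factors are \<open>x1 + x2\<close>, of modulus at least 1, and one input frequency
  \<open>y\<close>, so the modulations control \<open>y\<close>, and the ratio is at most \<open>\<langle>y\<rangle>\<^sup>2\<close>. The square in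
  this second case is the reason for the condition \<open>|s| < a/2\<close> for negative \<open>s\<close>.\<close>

lemma freq_ratio_le_modulation:
  assumes "parab (t1 + t2, x1 + x2) \<le> m" "parab (t1, x1) \<le> m" "parab (t2, x2) \<le> m"
    and x: "\<bar>x1 + x2\<bar> \<ge> 1" "\<bar>x1\<bar> \<ge> 1" "\<bar>x2\<bar> \<ge> 1"
  shows "freq_ratio x1 x2 \<le> 9 * m\<^sup>2"
proof -
  have m: "1 \<le> m" using assms(1) parab_ge_1 order_trans by blast
  have aux: "freq_ratio x1 x2 \<le> 9 * m\<^sup>2"
    if "2 * \<bar>(x1 + x2) * y\<bar> \<le> 3 * m" "freq_ratio x1 x2 \<le> (bracket y)\<^sup>2" "\<bar>y\<bar> \<ge> 1" for y
  proof -
    have "1 * \<bar>y\<bar> \<le> \<bar>x1 + x2\<bar> * \<bar>y\<bar>" using x by (intro mult_right_mono) auto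
    then have "bracket y \<le> 3 * m" using that bracket_le_2[of y] by (simp add: abs_mult)
    then have "(bracket y)\<^sup>2 \<le> (3 * m)\<^sup>2" using bracket_nonneg by (intro power_mono) auto
    then show ?thesis using that by (simp add: power_mult_distrib)
  qed
  from resonance[OF assms(1-3)] show ?thesis
  proof (elim disjE)
    assume *: "2 * \<bar>x1 * x2\<bar> \<le> 3 * m"
    have "freq_ratio x1 x2 \<le> bracket x1 * bracket x2" by (rule freq_ratio_bounds)
    also have "\<dots> \<le> (2 * \<bar>x1\<bar>) * (2 * \<bar>x2\<bar>)"
      using x bracket_le_2 bracket_nonneg by (intro mult_mono) auto
    also have "\<dots> \<le> 9 * (1 * m)" using * m by (simp add: abs_mult)
    also have "\<dots> \<le> 9 * (m * m)" using m by (intro mult_left_mono mult_right_mono) auto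
    finally show ?thesis by (simp add: power2_eq_square)
  qed (use aux freq_ratio_bounds x in auto)
qed

text \<open>The pieces of the kernel with a bounded square integral. In \<open>kernel_high\<close> the first point is the one that is
  fixed; it may be the output or one of the inputs, and in \<open>p - q\<close> only the sign depends on
  that, to which \<open>parab\<close> is insensitive. In \<open>kernel_low\<close> the input \<open>q\<close> is fixed.\<close>

definition kernel_high :: "real \<Rightarrow> real \<times> real \<Rightarrow> real \<times> real \<Rightarrow> real" where
  "kernel_high b p q = indicator {x. 1 \<le> \<bar>x\<bar>} (snd p) * (parab q powr (-b) * parab (p - q) powr (-b))"

definition kernel_low :: "real \<Rightarrow> real \<Rightarrow> real \<times> real \<Rightarrow> real \<times> real \<Rightarrow> real" where
  "kernel_low a b p q = indicator {-1..1} (snd p) *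
     (bracket (snd q) powr a * (parab p powr (-a) * parab (p - q) powr (-b)))"

definition bilinear_kernel :: "real \<Rightarrow> real \<Rightarrow> real \<Rightarrow> real \<times> real \<Rightarrow> real \<times> real \<Rightarrow> real" where
  "bilinear_kernel s a b p q = weight s (-a) p / (weight s b q * weight s b (p - q))"

lemma weight_pos: "0 < weight s b p"
  by (cases p) (simp add: weight_def bracket_pos less_imp_neq[OF bracket_pos, symmetric] order.strict_implies_not_eq)

lemma parab_powr_le_1: "0 \<le> e \<Longrightarrow> parab p powr (-e) \<le> 1"
  using parab_ge_1[of p] by (simp add: powr_minus ge_one_powr_ge_zero inverse_le_1_iff)

text \<open>The three regions of the proof: small output frequency; a small input frequency; and no small
  frequency, which is divided further according to the largest modulation.\<close>

lemma kernel_core_le: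
  assumes a: "0 < a" "a \<le> b"
  shows "freq_ratio (snd q) (snd (p - q)) powr (a/2) * (parab p powr (-a) * (parab q powr (-b) * parab (p - q) powr (-b)))
    \<le> 3 powr a * (kernel_high b p q + kernel_high b q p + kernel_high b (p - q) p + kernel_low a b p q)"
    (is "?R powr (a/2) * ?S \<le> _ * ?K")
proof -
  obtain t1 x1 where q: "q = (t1, x1)" by (cases q)
  obtain t2 x2 where r: "p - q = (t2, x2)" by (cases "p - q")
  have p: "p = (t1 + t2, x1 + x2)" using q r by (metis add.commute add_Pair diff_add_cancel)
  have R: "?R = freq_ratio x1 x2" unfolding r unfolding q by simp
  have R1: "1 \<le> ?R" unfolding R by (rule freq_ratio_bounds)
  have S0: "0 \<le> ?S" by simp
  have le1: "parab p powr (-a) \<le> 1" "parab q powr (-b) \<le> 1" "parab p powr (-b) \<le> 1" "parab (p - q) powr (-b) \<le> 1"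
    using a by (auto intro: parab_powr_le_1)
  have k0: "0 \<le> kernel_high b p q" "0 \<le> kernel_high b q p" "0 \<le> kernel_high b (p - q) p" "0 \<le> kernel_low a b p q"
    by (simp_all add: kernel_high_def kernel_low_def)
  have pw: "?R powr (a/2) \<le> y powr a" if "?R \<le> y\<^sup>2" "0 < y" for y
  proof -
    have "?R powr (a/2) \<le> (y\<^sup>2) powr (a/2)" using that a R1 by (intro powr_mono2) auto
    also have "y\<^sup>2 = y powr 2" using that by (simp add: powr_numeral)
    also have "(y powr 2) powr (a/2) = y powr a" by (simp add: powr_powr)
    finally show ?thesis .
  qed
  have fin: "?R powr (a/2) * ?S \<le> 3 powr a * ?K"
    if "?R powr (a/2) \<le> 3 powr a * y" "y * ?S \<le> k" "0 \<le> y" "k \<le> ?K" for y k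
  proof -
    have "?R powr (a/2) * ?S \<le> (3 powr a * y) * ?S" using that S0 by (intro mult_right_mono)
    also have "\<dots> = 3 powr a * (y * ?S)" by simp
    also have "\<dots> \<le> 3 powr a * ?K" using that by (intro mult_left_mono) auto
    finally show ?thesis .
  qed
  consider "\<bar>x1 + x2\<bar> < 1" | "\<bar>x1 + x2\<bar> \<ge> 1" "\<bar>x1\<bar> < 1 \<or> \<bar>x2\<bar> < 1" | "\<bar>x1 + x2\<bar> \<ge> 1" "\<bar>x1\<bar> \<ge> 1" "\<bar>x2\<bar> \<ge> 1"
    by linarith
  then show ?thesis
  proof cases
    case 1
    have "?R powr (a/2) \<le> bracket x1 powr a"
      by (rule pw) (simp_all only: R freq_ratio_bounds bracket_pos)
    also have "\<dots> \<le> 3 powr a * bracket x1 powr a"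
      using a ge_one_powr_ge_zero[of 3 a] by (simp add: mult_le_cancel_right1)
    finally have "?R powr (a/2) \<le> 3 powr a * bracket x1 powr a" .
    moreover have "bracket x1 powr a * ?S \<le> kernel_low a b p q"
    proof -
      have "?S \<le> parab p powr (-a) * (1 * parab (p - q) powr (-b))"
        using le1 by (intro mult_left_mono mult_right_mono) auto
      then show ?thesis using 1 by (auto simp: kernel_low_def p q indicator_def intro!: mult_left_mono)
    qed
    ultimately show ?thesis by (rule fin) (use k0 in auto)
  next
    case 2
    have "?R powr (a/2) \<le> 2 powr a"
    proof (rule pw)
      have "(bracket x1)\<^sup>2 \<le> 2\<^sup>2 \<or> (bracket x2)\<^sup>2 \<le> 2\<^sup>2"
        using 2(2)
      proof
        assume "\<bar>x1\<bar> < 1"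
        then have "(bracket x1)\<^sup>2 \<le> 2\<^sup>2" using bracket_nonneg[of x1] by (intro power_mono) (auto simp: bracket_def)
        then show ?thesis ..
      next
        assume "\<bar>x2\<bar> < 1"
        then have "(bracket x2)\<^sup>2 \<le> 2\<^sup>2" using bracket_nonneg[of x2] by (intro power_mono) (auto simp: bracket_def)
        then show ?thesis ..
      qed
      then show "?R \<le> 2\<^sup>2" unfolding R using freq_ratio_bounds[of x1 x2] by linarith
    qed simp
    also have "\<dots> \<le> 3 powr a * 1" using a by (simp add: powr_mono2)
    finally have "?R powr (a/2) \<le> 3 powr a * 1" .
    moreover have "1 * ?S \<le> kernel_high b p q"
      using 2 le1 by (simp add: kernel_high_def p q mult_left_le_one_le)
    ultimately show ?thesis by (rule fin) (use k0 in auto)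
  next
    case 3
    define m where "m = max (parab p) (max (parab q) (parab (p - q)))"
    have m1: "1 \<le> m" using parab_ge_1[of p] by (simp add: m_def)
    have "parab p \<le> m" "parab q \<le> m" "parab (p - q) \<le> m" by (simp_all add: m_def)
    then have "parab (t1 + t2, x1 + x2) \<le> m" "parab (t1, x1) \<le> m" "parab (t2, x2) \<le> m"
      unfolding r unfolding p q by simp_all
    then have "freq_ratio x1 x2 \<le> 9 * m\<^sup>2"
      using 3 by (rule freq_ratio_le_modulation)
    then have "?R powr (a/2) \<le> (3 * m) powr a"
      using m1 unfolding R[symmetric] by (intro pw) (simp_all only: power_mult_distrib, simp_all)
    then have Rm: "?R powr (a/2) \<le> 3 powr a * m powr a" using m1 by (simp add: powr_mult)
    \<comment> \<open>The larger modulation y gives up its power b and takes over the power a of p.\<close>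
    have swap: "y powr a * (parab p powr (-a) * (y powr (-b) * z)) \<le> parab p powr (-b) * z"
      if "parab p \<le> y" "0 \<le> z" for y z
    proof -
      have py: "0 < y" using that parab_pos[of p] by linarith
      have "y powr (-(b-a)) \<le> parab p powr (-(b-a))" using that a parab_pos[of p] by (intro powr_mono2') auto
      then have "parab p powr (-a) * (y powr (-(b-a))) * z \<le> parab p powr (-a) * (parab p powr (-(b-a))) * z"
        using that by (intro mult_left_mono mult_right_mono) auto
      also have "y powr (-(b-a)) = y powr a * y powr (-b)" by (simp flip: powr_add)
      also have "parab p powr (-a) * (parab p powr (-(b-a))) = parab p powr (-b)" by (simp flip: powr_add)
      finally show ?thesis by (simp add: mult_ac)
    qed
    consider "m = parab p" | "m = parab q" | "m = parab (p - q)" unfolding m_def by linarith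
    then show ?thesis
    proof cases
      case 1
      have "m powr a * parab p powr (-a) = 1"
        using parab_pos[of p] unfolding 1 by (simp flip: powr_add)
      then have "m powr a * ?S = parab q powr (-b) * parab (p - q) powr (-b)"
        by (metis mult.assoc mult_1)
      also have "\<dots> = kernel_high b p q" using 3 by (simp add: kernel_high_def p)
      finally have "m powr a * ?S \<le> kernel_high b p q" by simp
      from Rm this show ?thesis by (rule fin) (use k0 in auto)
    next
      case 2
      have "parab p \<le> m" by (simp add: m_def)
      from swap[OF this, of "parab (p - q) powr (-b)"]
      have "m powr a * ?S \<le> parab p powr (-b) * parab (p - q) powr (-b)" unfolding 2 by simp
      also have "\<dots> = kernel_high b q p"
        using 3 parab_minus[of "p - q"] by (simp add: kernel_high_def q)
      finally have "m powr a * ?S \<le> kernel_high b q p" .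
      from Rm this show ?thesis by (rule fin) (use k0 in auto)
    next
      case c3: 3
      have "parab p \<le> m" by (simp add: m_def)
      from swap[OF this, of "parab q powr (-b)"]
      have "m powr a * ?S \<le> parab p powr (-b) * parab q powr (-b)" unfolding c3 by (simp add: mult_ac)
      also have "\<dots> = kernel_high b (p - q) p"
      proof -
        have "p - q - p = - q" by simp
        then have "parab (p - q - p) = parab q" using parab_minus[of q] by metis
        moreover have "snd (p - q) = x2" unfolding r by simp
        ultimately show ?thesis using 3 unfolding kernel_high_def by (simp only:) simp
      qed
      finally have "m powr a * ?S \<le> kernel_high b (p - q) p" .
      from Rm this show ?thesis by (rule fin) (use k0 in auto)
    qed
  qed
qed

text \<open>The ratio of the frequencies is at least 1, so its power \<open>-s\<close> is at most its power \<open>a/2\<close>, for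
  positive and negative \<open>s\<close> alike.\<close>

lemma bilinear_kernel_le:
  assumes a: "0 < a" "a \<le> b" and s: "-a/2 \<le> s"
  shows "bilinear_kernel s a b p q \<le> 2 powr (a + 2 * b) * 3 powr a *
    (kernel_high b p q + kernel_high b q p + kernel_high b (p - q) p + kernel_low a b p q)"
proof -
  obtain t1 x1 where q: "q = (t1, x1)" by (cases q)
  obtain t2 x2 where r: "p - q = (t2, x2)" by (cases "p - q")
  have p: "p = (t1 + t2, x1 + x2)" using q r by (metis add.commute add_Pair diff_add_cancel)
  let ?L = "\<lambda>t x. bracket (\<bar>t\<bar> - gam x)"
  have L: "?L t x powr (-e) \<le> 2 powr e * parab (t, x) powr (-e)" if "0 \<le> e" for t x e
  proof -
    have "(2 * ?L t x) powr (-e) \<le> parab (t, x) powr (-e)"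
      using that parab_le_bracket[of t x] parab_pos[of "(t, x)"] by (intro powr_mono2') auto
    then have "2 powr e * (2 * ?L t x) powr (-e) \<le> 2 powr e * parab (t, x) powr (-e)"
      by (intro mult_left_mono) auto
    moreover have "2 powr e * (2 * ?L t x) powr (-e) = ?L t x powr (-e)"
      by (simp add: powr_mult bracket_nonneg flip: powr_add mult.assoc)
    ultimately show ?thesis by simp
  qed
  have "bilinear_kernel s a b p q = freq_ratio x1 x2 powr (-s) *
      (?L (t1 + t2) (x1 + x2) powr (-a) * (?L t1 x1 powr (-b) * ?L t2 x2 powr (-b)))"
    using bracket_pos[of x1] bracket_pos[of x2] bracket_pos[of "x1 + x2"]
    unfolding bilinear_kernel_def weight_def r unfolding p q
    by (simp add: freq_ratio_def powr_divide powr_mult powr_minus field_simps)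
  also have "\<dots> \<le> freq_ratio x1 x2 powr (a/2) *
     ((2 powr a * parab p powr (-a)) * ((2 powr b * parab q powr (-b)) * (2 powr b * parab (p - q) powr (-b))))"
    unfolding r unfolding p q using freq_ratio_bounds(1)[of x1 x2] a s
    by (intro mult_mono L powr_mono mult_nonneg_nonneg) auto
  also have "\<dots> = 2 powr (a + 2 * b) * (freq_ratio (snd q) (snd (p - q)) powr (a/2) * (parab p powr (-a) * (parab q powr (-b) * parab (p - q) powr (-b))))"
    unfolding r unfolding q powr_add mult_2 by (simp add: mult_ac)
  also have "\<dots> \<le> 2 powr (a + 2 * b) * (3 powr a *
    (kernel_high b p q + kernel_high b q p + kernel_high b (p - q) p + kernel_low a b p q))"
    using kernel_core_le[OF a, of q p] by (intro mult_left_mono) auto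
  finally show ?thesis by simp
qed

section \<open>The bilinear estimate in the unweighted space\<close>

abbreviation sq_integral :: "('a::euclidean_space \<Rightarrow> ennreal) \<Rightarrow> ennreal" where
  "sq_integral f \<equiv> \<integral>\<^sup>+p. (f p)\<^sup>2 \<partial>lborel"

lemma nn_integral_reflect:
  fixes f :: "'a::euclidean_space \<Rightarrow> ennreal"
  assumes "f \<in> borel_measurable borel"
  shows "(\<integral>\<^sup>+q. f (p - q) \<partial>lborel) = (\<integral>\<^sup>+q. f q \<partial>lborel)"
proof -
  have "lborel = distr lborel borel (\<lambda>q::'a. p - q)"
    using lborel_affine[of "-1" p] by (simp add: density_1)
  then have "(\<integral>\<^sup>+q. f q \<partial>lborel) = (\<integral>\<^sup>+q. f q \<partial>distr lborel borel (\<lambda>q. p - q))" by simp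
  also have "\<dots> = (\<integral>\<^sup>+q. f (p - q) \<partial>lborel)"
    using assms by (intro nn_integral_distr) auto
  finally show ?thesis by simp
qed

lemma nn_integral_translate:
  fixes f :: "'a::euclidean_space \<Rightarrow> ennreal"
  assumes "f \<in> borel_measurable borel"
  shows "(\<integral>\<^sup>+p. f (p - q) \<partial>lborel) = (\<integral>\<^sup>+p. f p \<partial>lborel)"
proof -
  have "(\<integral>\<^sup>+p. f p \<partial>lborel) = (\<integral>\<^sup>+p. f p \<partial>distr lborel borel ((+) (-q)))"
    by (simp add: lborel_distr_plus)
  also have "\<dots> = (\<integral>\<^sup>+p. f (-q + p) \<partial>lborel)"
    using assms by (intro nn_integral_distr) auto
  finally show ?thesis by simp
qed

text \<open>The Cauchy-Schwarz inequality in the inner variable, which uses the bound on the kernel, and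
  then in the outer variable.\<close>

lemma schur_cauchy_schwarz:
  fixes u :: "'a \<Rightarrow> ennreal" and w k :: "'a \<Rightarrow> 'b \<Rightarrow> ennreal"
  assumes M2: "sigma_finite_measure M2"
    and [measurable]: "u \<in> borel_measurable M1"
      "case_prod w \<in> borel_measurable (M1 \<Otimes>\<^sub>M M2)" "case_prod k \<in> borel_measurable (M1 \<Otimes>\<^sub>M M2)"
    and C: "\<And>x. x \<in> space M1 \<Longrightarrow> (\<integral>\<^sup>+y. (k x y)\<^sup>2 \<partial>M2) \<le> C"
  shows "(\<integral>\<^sup>+x. u x * (\<integral>\<^sup>+y. w x y * k x y \<partial>M2) \<partial>M1)\<^sup>2
    \<le> C * (\<integral>\<^sup>+x. (u x)\<^sup>2 \<partial>M1) * (\<integral>\<^sup>+x. \<integral>\<^sup>+y. (w x y)\<^sup>2 \<partial>M2 \<partial>M1)"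
proof -
  interpret M2: sigma_finite_measure M2 by fact
  have "(\<integral>\<^sup>+x. u x * (\<integral>\<^sup>+y. w x y * k x y \<partial>M2) \<partial>M1)\<^sup>2 \<le>
     (\<integral>\<^sup>+x. (u x)\<^sup>2 \<partial>M1) * (\<integral>\<^sup>+x. (\<integral>\<^sup>+y. w x y * k x y \<partial>M2)\<^sup>2 \<partial>M1)"
    by (intro Cauchy_Schwarz_nn_integral) measurable
  also have "\<dots> \<le> (\<integral>\<^sup>+x. (u x)\<^sup>2 \<partial>M1) * (\<integral>\<^sup>+x. C * (\<integral>\<^sup>+y. (w x y)\<^sup>2 \<partial>M2) \<partial>M1)"
  proof (intro mult_left_mono nn_integral_mono)
    fix x assume x: "x \<in> space M1"
    have "(\<integral>\<^sup>+y. w x y * k x y \<partial>M2)\<^sup>2 \<le> (\<integral>\<^sup>+y. (w x y)\<^sup>2 \<partial>M2) * (\<integral>\<^sup>+y. (k x y)\<^sup>2 \<partial>M2)"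
      using x by (intro Cauchy_Schwarz_nn_integral) measurable
    also have "\<dots> \<le> (\<integral>\<^sup>+y. (w x y)\<^sup>2 \<partial>M2) * C" by (intro mult_left_mono C x) auto
    finally show "(\<integral>\<^sup>+y. w x y * k x y \<partial>M2)\<^sup>2 \<le> C * (\<integral>\<^sup>+y. (w x y)\<^sup>2 \<partial>M2)" by (simp add: mult.commute)
  qed auto
  also have "\<dots> = C * (\<integral>\<^sup>+x. (u x)\<^sup>2 \<partial>M1) * (\<integral>\<^sup>+x. \<integral>\<^sup>+y. (w x y)\<^sup>2 \<partial>M2 \<partial>M1)"
    by (subst nn_integral_cmult) (auto simp: mult_ac)
  finally show ?thesis .
qed

text \<open>Since T may have infinite norm, it is tested against its truncations h, for which
  \<open>h\<^sup>2 \<le> h T\<close>. Their norms are finite and can be cancelled; Fatou's lemma removes the truncation.\<close>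

lemma L2_bound_by_duality:
  fixes T :: "'a::euclidean_space \<Rightarrow> ennreal"
  assumes [measurable]: "T \<in> borel_measurable borel"
    and dual: "\<And>h. h \<in> borel_measurable borel \<Longrightarrow> (\<integral>\<^sup>+p. h p * T p \<partial>lborel)\<^sup>2 \<le> A * sq_integral h"
  shows "(\<integral>\<^sup>+p. (T p)\<^sup>2 \<partial>lborel) \<le> A"
proof -
  define h where "h n p = min (T p) (of_nat n) * indicator (cball 0 (real n)) p" for n :: nat and p
  have [measurable]: "cball (0::'a) (real n) \<in> sets borel" for n by simp
  have [measurable]: "h n \<in> borel_measurable borel" for n unfolding h_def by measurable
  have bound: "(\<integral>\<^sup>+p. (h n p)\<^sup>2 \<partial>lborel) \<le> A" for n
  proof -
    let ?I = "\<integral>\<^sup>+p. (h n p)\<^sup>2 \<partial>lborel"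
    have "?I \<le> (\<integral>\<^sup>+p. ennreal ((real n)\<^sup>2) * indicator (cball 0 (real n)) p \<partial>(lborel :: 'a measure))"
    proof (rule nn_integral_mono)
      fix p
      have "(min (T p) (of_nat n))\<^sup>2 \<le> (of_nat n :: ennreal)\<^sup>2" by (intro power_mono) auto
      then show "(h n p)\<^sup>2 \<le> ennreal ((real n)\<^sup>2) * indicator (cball 0 (real n)) p"
        by (auto simp: h_def indicator_def ennreal_power[symmetric] ennreal_of_nat_eq_real_of_nat)
    qed
    also have "\<dots> = ennreal ((real n)\<^sup>2) * emeasure lborel (cball (0::'a) (real n))"
      by (subst nn_integral_cmult) auto
    also have "\<dots> < \<infinity>" using emeasure_lborel_cball_finite[of "0::'a" "real n"] by (simp add: ennreal_mult_less_top)
    finally have fin: "?I < \<infinity>" .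
    have "?I \<le> (\<integral>\<^sup>+p. h n p * T p \<partial>lborel)"
      by (intro nn_integral_mono) (auto simp: h_def power2_eq_square indicator_def intro!: mult_left_mono)
    then have "?I\<^sup>2 \<le> (\<integral>\<^sup>+p. h n p * T p \<partial>lborel)\<^sup>2" by (intro power_mono) auto
    also have "\<dots> \<le> A * ?I" by (rule dual) measurable
    finally have "?I * ?I \<le> ?I * A" by (simp only: power2_eq_square mult.commute[of A])
    then show ?thesis
      using fin ennreal_mult_le_mult_iff[of ?I ?I A] by (cases "?I = 0") (auto simp: less_top)
  qed
  have lim: "(T p)\<^sup>2 \<le> liminf (\<lambda>n. (h n p)\<^sup>2)" for p
  proof (cases "T p")
    case (real r)
    have "\<forall>\<^sub>F n in sequentially. (T p)\<^sup>2 \<le> (h n p)\<^sup>2"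
      using eventually_ge_at_top[of "nat \<lceil>max r (norm p)\<rceil>"]
      by eventually_elim
         (use real in \<open>auto simp: h_def indicator_def nat_le_iff ceiling_le_iff ennreal_of_nat_eq_real_of_nat min_def ennreal_le_iff2 split: if_splits\<close>)
    then show ?thesis by (rule Liminf_bounded)
  next
    case top
    have "\<forall>\<^sub>F n in sequentially. (of_nat n :: ennreal) \<le> (h n p)\<^sup>2"
      using eventually_ge_at_top[of "nat \<lceil>norm p\<rceil>"]
    proof eventually_elim
      case (elim n)
      have "n \<le> n\<^sup>2" by (simp add: power2_eq_square)
      then have "(of_nat n :: ennreal) \<le> of_nat (n\<^sup>2)" by (simp only: of_nat_le_iff)
      then show ?case using elim top by (simp add: h_def indicator_def nat_le_iff ceiling_le_iff)
    qed
    then have "liminf (\<lambda>n. of_nat n :: ennreal) \<le> liminf (\<lambda>n. (h n p)\<^sup>2)" by (rule Liminf_mono)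
    moreover have "liminf (\<lambda>n. of_nat n :: ennreal) = top"
      by (rule lim_imp_Liminf[OF _ of_nat_tendsto_top_ennreal]) simp
    ultimately show ?thesis by (simp add: top_unique)
  qed
  have "(\<integral>\<^sup>+p. (T p)\<^sup>2 \<partial>lborel) \<le> (\<integral>\<^sup>+p. liminf (\<lambda>n. (h n p)\<^sup>2) \<partial>lborel)"
    by (intro nn_integral_mono lim)
  also have "\<dots> \<le> liminf (\<lambda>n. \<integral>\<^sup>+p. (h n p)\<^sup>2 \<partial>lborel)"
    by (intro nn_integral_liminf) measurable
  also have "\<dots> \<le> A" using bound by (intro Liminf_le) auto
  finally show ?thesis .
qed

declare snd_borel_measurable [measurable]

lemma borel_measurable_parab_compose [measurable (raw)]:
  "f \<in> borel_measurable M \<Longrightarrow> (\<lambda>x. parab (f x)) \<in> borel_measurable M"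
  by (rule measurable_compose[OF _ borel_measurable_parab])

lemma borel_measurable_snd_compose [measurable (raw)]:
  fixes f :: "'a \<Rightarrow> real \<times> real"
  shows "f \<in> borel_measurable M \<Longrightarrow> (\<lambda>x. snd (f x)) \<in> borel_measurable M"
  by (rule measurable_compose[OF _ snd_borel_measurable])

lemma borel_measurable_kernel_high:
  assumes [measurable]: "f \<in> borel_measurable M" "g \<in> borel_measurable M"
  shows "(\<lambda>x. kernel_high b (f x) (g x)) \<in> borel_measurable M"
proof -
  have [measurable]: "(\<lambda>x. indicator {x. 1 \<le> \<bar>x\<bar>} (snd (f x)) :: real) \<in> borel_measurable M"
    by (rule measurable_compose[OF borel_measurable_snd_compose[OF assms(1)]]) (simp add: closed_Collect_le borel_closed)
  show ?thesis unfolding kernel_high_def by measurable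
qed

lemma borel_measurable_kernel_low:
  assumes [measurable]: "f \<in> borel_measurable M" "g \<in> borel_measurable M"
  shows "(\<lambda>x. kernel_low a b (f x) (g x)) \<in> borel_measurable M"
proof -
  have [measurable]: "(\<lambda>x. indicator {-1..1} (snd (f x)) :: real) \<in> borel_measurable M"
    by (rule measurable_compose[OF borel_measurable_snd_compose[OF assms(1)]]) simp
  show ?thesis unfolding kernel_low_def by measurable
qed

lemma powr_square: "(x powr e)\<^sup>2 = x powr (2 * e)" for x e :: real
  unfolding power2_eq_square mult_2 powr_add ..

lemma nn_integral_kernel_high:
  assumes "b > 1/2"
  shows "(\<integral>\<^sup>+q. (ennreal (kernel_high b p q))\<^sup>2 \<partial>lborel) \<le> 4 * (2 * ennreal (2 powr (2*b)) * bracket_mass (2*b))\<^sup>2"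
proof (cases "\<bar>snd p\<bar> \<ge> 1")
  case True
  have "(ennreal (kernel_high b p q))\<^sup>2 = ennreal (parab q powr (-(2*b)) * parab (p - q) powr (-(2*b)))" for q
    using True by (simp add: kernel_high_def ennreal_power power_mult_distrib powr_square)
  then show ?thesis using nn_integral_parab_conv[of "2*b" p] assms True by simp
qed (simp add: kernel_high_def)

lemma nn_integral_kernel_low:
  assumes "0 < a" "a < 1/2" "b > 1/2"
  shows "\<exists>C<\<infinity>. \<forall>q. (\<integral>\<^sup>+p. (ennreal (kernel_low a b p q))\<^sup>2 \<partial>lborel) \<le> C"
proof -
  have "(ennreal (kernel_low a b p q))\<^sup>2 =
      ennreal (bracket (snd q) powr (2*a) * (parab p powr (-(2*a)) * parab (p - q) powr (-(2*b))))
      * indicator {-1..1} (snd p)" for p q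
    by (cases "snd p \<in> {-1..1}")
       (simp_all add: kernel_low_def ennreal_power power_mult_distrib powr_square)
  then show ?thesis using nn_integral_parab_low[of "2*a" "2*b"] assms by simp
qed

lemma nn_integral_conv_squares:
  fixes f g :: "'a::euclidean_space \<Rightarrow> ennreal"
  assumes [measurable]: "f \<in> borel_measurable borel" "g \<in> borel_measurable borel"
  shows "(\<integral>\<^sup>+q. \<integral>\<^sup>+p. (f p * g (p - q))\<^sup>2 \<partial>lborel \<partial>lborel) = sq_integral f * sq_integral g"
    "(\<integral>\<^sup>+p. \<integral>\<^sup>+q. (f q * g (p - q))\<^sup>2 \<partial>lborel \<partial>lborel) = sq_integral f * sq_integral g"
proof -
  have "(\<integral>\<^sup>+q. \<integral>\<^sup>+p. (f p * g (p - q))\<^sup>2 \<partial>lborel \<partial>lborel) = (\<integral>\<^sup>+p. \<integral>\<^sup>+q. (f p)\<^sup>2 * (g (p - q))\<^sup>2 \<partial>lborel \<partial>lborel)"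
    unfolding power_mult_distrib by (rule lborel_pair.Fubini'[symmetric]) measurable
  also have "\<dots> = (\<integral>\<^sup>+p. (f p)\<^sup>2 * (\<integral>\<^sup>+q. (g q)\<^sup>2 \<partial>lborel) \<partial>lborel)"
    using nn_integral_reflect[of "\<lambda>q. (g q)\<^sup>2"] by (simp add: nn_integral_cmult)
  finally show "(\<integral>\<^sup>+q. \<integral>\<^sup>+p. (f p * g (p - q))\<^sup>2 \<partial>lborel \<partial>lborel) = sq_integral f * sq_integral g"
    by (simp add: nn_integral_multc)
  have "(\<integral>\<^sup>+p. \<integral>\<^sup>+q. (f q * g (p - q))\<^sup>2 \<partial>lborel \<partial>lborel) = (\<integral>\<^sup>+q. \<integral>\<^sup>+p. (f q)\<^sup>2 * (g (p - q))\<^sup>2 \<partial>lborel \<partial>lborel)"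
    unfolding power_mult_distrib by (rule lborel_pair.Fubini'[symmetric]) measurable
  also have "\<dots> = (\<integral>\<^sup>+q. (f q)\<^sup>2 * sq_integral g \<partial>lborel)"
    using nn_integral_translate[of "\<lambda>q. (g q)\<^sup>2"] by (simp add: nn_integral_cmult)
  finally show "(\<integral>\<^sup>+p. \<integral>\<^sup>+q. (f q * g (p - q))\<^sup>2 \<partial>lborel \<partial>lborel) = sq_integral f * sq_integral g"
    by (simp add: nn_integral_multc)
qed

text \<open>In this form the output variable is fixed first; in the next one it is the input variable q.\<close>

lemma trilinear_outer:
  fixes f g h :: "'a::euclidean_space \<Rightarrow> ennreal" and k :: "'a \<Rightarrow> 'a \<Rightarrow> ennreal"
  assumes [measurable]: "f \<in> borel_measurable borel" "g \<in> borel_measurable borel" "h \<in> borel_measurable borel"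
    "case_prod k \<in> borel_measurable (lborel \<Otimes>\<^sub>M lborel)"
    and C: "\<And>p. (\<integral>\<^sup>+q. (k p q)\<^sup>2 \<partial>lborel) \<le> C"
  shows "(\<integral>\<^sup>+p. h p * (\<integral>\<^sup>+q. f q * g (p - q) * k p q \<partial>lborel) \<partial>lborel)\<^sup>2
    \<le> C * sq_integral h * (sq_integral f * sq_integral g)"
  unfolding nn_integral_conv_squares(2)[OF assms(1,2), symmetric]
  by (rule schur_cauchy_schwarz[OF sigma_finite_lborel]) (use C in measurable)

lemma trilinear_inner:
  fixes f g h :: "'a::euclidean_space \<Rightarrow> ennreal" and k :: "'a \<Rightarrow> 'a \<Rightarrow> ennreal"
  assumes [measurable]: "f \<in> borel_measurable borel" "g \<in> borel_measurable borel" "h \<in> borel_measurable borel"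
    "case_prod k \<in> borel_measurable (lborel \<Otimes>\<^sub>M lborel)"
    and C: "\<And>q. (\<integral>\<^sup>+p. (k q p)\<^sup>2 \<partial>lborel) \<le> C"
  shows "(\<integral>\<^sup>+p. h p * (\<integral>\<^sup>+q. f q * g (p - q) * k q p \<partial>lborel) \<partial>lborel)\<^sup>2
    \<le> C * sq_integral f * (sq_integral h * sq_integral g)"
proof -
  have "(\<integral>\<^sup>+p. h p * (\<integral>\<^sup>+q. f q * g (p - q) * k q p \<partial>lborel) \<partial>lborel) =
    (\<integral>\<^sup>+p. \<integral>\<^sup>+q. f q * (h p * g (p - q) * k q p) \<partial>lborel \<partial>lborel)"
    by (subst nn_integral_cmult[symmetric]) (auto simp: mult_ac)
  also have "\<dots> = (\<integral>\<^sup>+q. \<integral>\<^sup>+p. f q * (h p * g (p - q) * k q p) \<partial>lborel \<partial>lborel)"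
    by (rule lborel_pair.Fubini') measurable
  also have "\<dots> = (\<integral>\<^sup>+q. f q * (\<integral>\<^sup>+p. h p * g (p - q) * k q p \<partial>lborel) \<partial>lborel)"
    by (simp add: nn_integral_cmult)
  finally have eq: "(\<integral>\<^sup>+p. h p * (\<integral>\<^sup>+q. f q * g (p - q) * k q p \<partial>lborel) \<partial>lborel) = \<dots>" .
  show ?thesis
    unfolding eq nn_integral_conv_squares(1)[OF assms(3,2), symmetric]
    by (rule schur_cauchy_schwarz[OF sigma_finite_lborel]) (use C in measurable)
qed

lemma continuous_on_weight: "continuous_on UNIV (weight s b)"
  unfolding weight_def split_beta
  by (intro continuous_intros) (auto simp: bracket_def)

lemma borel_measurable_weight [measurable]: "weight s b \<in> borel_measurable borel"
  by (rule borel_measurable_continuous_onI[OF continuous_on_weight])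

text \<open>The four pieces of the kernel fix the points p, q, p - q and q respectively. The third one is reduced to the
  second by the substitution of p - q for q, which exchanges f and g.\<close>

lemma bilinear_estimate:
  assumes a: "0 < a" "a < 1/2" and b: "b > 1/2" and s: "-a/2 \<le> s"
  shows "\<exists>C<\<infinity>. \<forall>f\<in>borel_measurable borel. \<forall>g\<in>borel_measurable borel.
    (\<integral>\<^sup>+p. (\<integral>\<^sup>+q. ennreal (bilinear_kernel s a b p q) * (f q * g (p - q)) \<partial>lborel)\<^sup>2 \<partial>lborel)
      \<le> C * (sq_integral f * sq_integral g)"
proof -
  obtain C2 where C2: "C2 < \<infinity>" "\<And>q. (\<integral>\<^sup>+p. (ennreal (kernel_low a b p q))\<^sup>2 \<partial>lborel) \<le> C2"
    using nn_integral_kernel_low[OF a b] by blast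
  define C1 where "C1 = 4 * (2 * ennreal (2 powr (2*b)) * bracket_mass (2*b))\<^sup>2"
  have C1: "C1 < \<infinity>" "\<And>p. (\<integral>\<^sup>+q. (ennreal (kernel_high b p q))\<^sup>2 \<partial>lborel) \<le> C1"
    using nn_integral_kernel_high[OF b] bracket_mass_finite[of "2*b"] b
    by (auto simp: C1_def ennreal_mult_less_top power2_eq_square)
  define D where "D = max C1 C2"
  have D: "D < \<infinity>" "\<And>p. (\<integral>\<^sup>+q. (ennreal (kernel_high b p q))\<^sup>2 \<partial>lborel) \<le> D"
      "\<And>q. (\<integral>\<^sup>+p. (ennreal (kernel_low a b p q))\<^sup>2 \<partial>lborel) \<le> D"
    using C1(1) C2(1) order_trans[OF C1(2) max.cobounded1] order_trans[OF C2(2) max.cobounded2]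
    by (auto simp: D_def)
  define c where "c = 2 powr (a + 2 * b) * 3 powr a"
  let ?H = "\<lambda>p q. ennreal (kernel_high b p q)" and ?L = "\<lambda>q p. ennreal (kernel_low a b p q)"
  have [measurable]: "case_prod ?H \<in> borel_measurable (lborel \<Otimes>\<^sub>M lborel)" "case_prod ?L \<in> borel_measurable (lborel \<Otimes>\<^sub>M lborel)"
    unfolding split_beta
    by (intro measurable_compose[OF _ measurable_ennreal] borel_measurable_kernel_high borel_measurable_kernel_low; measurable)+
  show ?thesis
  proof (intro exI conjI ballI)
    show "(ennreal c)\<^sup>2 * (16 * D) < \<infinity>" using D(1) by (simp add: ennreal_mult_less_top power2_eq_square)
  next
    fix f g :: "real \<times> real \<Rightarrow> ennreal" assume [measurable]: "f \<in> borel_measurable borel" "g \<in> borel_measurable borel"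
    let ?T = "\<lambda>p. \<integral>\<^sup>+q. ennreal (bilinear_kernel s a b p q) * (f q * g (p - q)) \<partial>lborel"
    let ?f = "sq_integral f" and ?g = "sq_integral g"
    have [measurable]: "case_prod (\<lambda>p q. ennreal (bilinear_kernel s a b p q)) \<in> borel_measurable (lborel \<Otimes>\<^sub>M lborel)"
      unfolding bilinear_kernel_def by measurable
    show "(\<integral>\<^sup>+p. (?T p)\<^sup>2 \<partial>lborel)
      \<le> (ennreal c)\<^sup>2 * (16 * D) * (?f * ?g)"
    proof (rule L2_bound_by_duality)
      show "(\<lambda>p. ?T p) \<in> borel_measurable borel"
        by measurable
    next
      fix h :: "real \<times> real \<Rightarrow> ennreal" assume [measurable]: "h \<in> borel_measurable borel"
      let ?h = "sq_integral h"
      define J where "J k = (\<integral>\<^sup>+p. h p * (\<integral>\<^sup>+q. f q * g (p - q) * k p q \<partial>lborel) \<partial>lborel)"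
        for k :: "real \<times> real \<Rightarrow> real \<times> real \<Rightarrow> ennreal"
      let ?J = "J ?H + J (\<lambda>p q. ?H q p) + J (\<lambda>p q. ?H (p - q) p) + J (\<lambda>p q. ?L q p)"
      have J1: "(J ?H)\<^sup>2 \<le> D * (?f * ?g * ?h)"
        using trilinear_outer[of f g h ?H D] D(2) unfolding J_def by (simp add: mult_ac)
      have J2: "(J (\<lambda>p q. ?H q p))\<^sup>2 \<le> D * (?f * ?g * ?h)"
        using trilinear_inner[of f g h ?H D] D(2) unfolding J_def by (simp add: mult_ac)
      have J4: "(J (\<lambda>p q. ?L q p))\<^sup>2 \<le> D * (?f * ?g * ?h)"
        using trilinear_inner[of f g h ?L D] D(3) unfolding J_def by (simp add: mult_ac)
      have J3: "(J (\<lambda>p q. ?H (p - q) p))\<^sup>2 \<le> D * (?f * ?g * ?h)"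
      proof -
        have "(\<integral>\<^sup>+q. f q * g (p - q) * ?H (p - q) p \<partial>lborel) = (\<integral>\<^sup>+q. g q * f (p - q) * ?H q p \<partial>lborel)" for p
        proof -
          have "(\<lambda>q. ?H q p) \<in> borel_measurable borel"
            by (intro measurable_compose[OF _ measurable_ennreal] borel_measurable_kernel_high) auto
          then have "(\<integral>\<^sup>+q. g (p - q) * f (p - (p - q)) * ?H (p - q) p \<partial>lborel) = (\<integral>\<^sup>+q. g q * f (p - q) * ?H q p \<partial>lborel)"
            by (intro nn_integral_reflect[where f="\<lambda>q. g q * f (p - q) * ?H q p"]) measurable
          then show ?thesis by (simp add: mult_ac)
        qed
        then show ?thesis
          using trilinear_inner[of g f h ?H D] D(2) unfolding J_def by (simp add: mult_ac)
      qed
      have Jsum: "(w + x + y + z)\<^sup>2 \<le> 16 * A" if "w\<^sup>2 \<le> A" "x\<^sup>2 \<le> A" "y\<^sup>2 \<le> A" "z\<^sup>2 \<le> A" for w x y z A :: ennreal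
      proof -
        define m where "m = max (max w x) (max y z)"
        have "m\<^sup>2 \<le> A" using that by (auto simp: m_def max_def)
        have "w + x + y + z \<le> m + m + m + m" by (intro add_mono) (auto simp: m_def le_max_iff_disj)
        also have "\<dots> = 4 * m"
        proof -
          have "(2 + 2) * m = (m + m) + (m + m)" unfolding distrib_right mult_2 ..
          then show ?thesis by (simp add: add_ac)
        qed
        finally have "(w + x + y + z)\<^sup>2 \<le> (4 * m)\<^sup>2" by (intro power_mono) auto
        also have "\<dots> = 16 * m\<^sup>2" by (simp add: power_mult_distrib)
        also have "\<dots> \<le> 16 * A" using \<open>m\<^sup>2 \<le> A\<close> by (intro mult_left_mono) auto
        finally show ?thesis .
      qed
      have meas: "(\<lambda>(p, q). ?H (p - q) p) \<in> borel_measurable (lborel \<Otimes>\<^sub>M lborel)"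
        "(\<lambda>(p, q). ?H q p) \<in> borel_measurable (lborel \<Otimes>\<^sub>M lborel)"
        "(\<lambda>(p, q). ?L q p) \<in> borel_measurable (lborel \<Otimes>\<^sub>M lborel)"
        unfolding split_beta
        by (intro measurable_compose[OF _ measurable_ennreal] borel_measurable_kernel_high borel_measurable_kernel_low; measurable)+
      note [measurable] = meas
      let ?S = "\<lambda>p q. f q * g (p - q) * ?H p q + f q * g (p - q) * ?H q p + f q * g (p - q) * ?H (p - q) p + f q * g (p - q) * ?L q p"
      have "(\<integral>\<^sup>+p. h p * ?T p \<partial>lborel) \<le>
        (\<integral>\<^sup>+p. h p * (\<integral>\<^sup>+q. ennreal c * (?S p q) \<partial>lborel) \<partial>lborel)"
      proof (intro nn_integral_mono mult_left_mono)
        fix p q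
        have "ennreal (bilinear_kernel s a b p q) \<le> ennreal (c * (kernel_high b p q + kernel_high b q p + kernel_high b (p - q) p + kernel_low a b p q))"
          unfolding c_def using a b s by (intro ennreal_leI bilinear_kernel_le) auto
        also have "\<dots> = ennreal c * (?H p q + ?H q p + ?H (p - q) p + ?L q p)"
          by (simp add: c_def ennreal_mult ennreal_plus kernel_high_def kernel_low_def)
        finally have "ennreal (bilinear_kernel s a b p q) * (f q * g (p - q)) \<le> ennreal c * (?H p q + ?H q p + ?H (p - q) p + ?L q p) * (f q * g (p - q))"
          by (intro mult_right_mono) auto
        also have "\<dots> = ennreal c * (?S p q)"
          by (simp add: distrib_left distrib_right mult_ac)
        finally show "ennreal (bilinear_kernel s a b p q) * (f q * g (p - q)) \<le> \<dots>" .
      qed auto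
      also have "\<dots> = ennreal c * (?J)"
        unfolding J_def
        by (simp add: nn_integral_add nn_integral_cmult distrib_left mult.left_commute[of _ "ennreal c"])
      finally have "(\<integral>\<^sup>+p. h p * ?T p \<partial>lborel)\<^sup>2 \<le>
        (ennreal c * (?J))\<^sup>2"
        by (intro power_mono) auto
      also have "\<dots> \<le> (ennreal c)\<^sup>2 * (16 * (D * (?f * ?g * ?h)))"
        unfolding power_mult_distrib by (intro mult_left_mono Jsum J1 J2 J3 J4) auto
      finally show "(\<integral>\<^sup>+p. h p * ?T p \<partial>lborel)\<^sup>2
        \<le> (ennreal c)\<^sup>2 * (16 * D) * (?f * ?g) * ?h" by (simp add: mult_ac)
    qed
  qed
qed

section \<open>Fourier transforms of Schwartz functions\<close>

lemma has_vector_derivative_partial_t: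
  assumes "F differentiable (at (t, x))"
  shows "((\<lambda>r. F (r, x)) has_vector_derivative partial_t F (t, x)) (at t)"
proof -
  have "(\<lambda>r::real. (r, x)) differentiable (at t)"
    by (intro differentiableI[where f'="\<lambda>r. (r, 0)"] derivative_eq_intros) auto
  with assms have "(F \<circ> (\<lambda>r. (r, x))) differentiable (at t)"
    by (intro differentiable_chain_at) auto
  then show ?thesis unfolding partial_t_def o_def by (simp add: vector_derivative_works)
qed

lemma has_vector_derivative_partial_x:
  assumes "F differentiable (at (t, x))"
  shows "((\<lambda>r. F (t, r)) has_vector_derivative partial_x F (t, x)) (at x)"
proof -
  have "(\<lambda>r::real. (t, r)) differentiable (at x)"
    by (intro differentiableI[where f'="\<lambda>r. (0, r)"] derivative_eq_intros) auto
  with assms have "(F \<circ> (\<lambda>r. (t, r))) differentiable (at x)"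
    by (intro differentiable_chain_at) auto
  then show ?thesis unfolding partial_x_def o_def by (simp add: vector_derivative_works)
qed

lemma partial_t_eqI:
  "(\<And>t x. ((\<lambda>r. F (r, x)) has_vector_derivative G (t, x)) (at t)) \<Longrightarrow> partial_t F = G"
  unfolding partial_t_def by (auto simp: fun_eq_iff vector_derivative_at)

lemma partial_x_eqI:
  "(\<And>t x. ((\<lambda>r. F (t, r)) has_vector_derivative G (t, x)) (at x)) \<Longrightarrow> partial_x F = G"
  unfolding partial_x_def by (auto simp: fun_eq_iff vector_derivative_at)

lemma partials_simps:
  "partials 0 0 F = F" "partials 0 (Suc n) F = partial_x (partials 0 n F)"
  "partials (Suc m) n F = partial_t (partials m n F)"
  by (simp_all add: partials_def)

lemma has_vector_derivative_lincomb:
  fixes f g :: "real \<Rightarrow> complex"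
  assumes "(f has_vector_derivative f') F" "(g has_vector_derivative g') F"
  shows "((\<lambda>x. c * f x + d * g x) has_vector_derivative c * f' + d * g') F"
  by (intro has_vector_derivative_add has_vector_derivative_mult_right assms)

lemma partials_lincomb:
  assumes F: "\<And>m n p. partials m n F differentiable (at p)" and G: "\<And>m n p. partials m n G differentiable (at p)"
  shows "partials m n (\<lambda>p. c * F p + d * G p) = (\<lambda>p. c * partials m n F p + d * partials m n G p)"
proof (induction m)
  case 0
  show ?case
  proof (induction n)
    case (Suc n)
    show ?case unfolding partials_simps Suc
      by (intro partial_x_eqI has_vector_derivative_lincomb has_vector_derivative_partial_x F G)
  qed (simp add: partials_simps)
next
  case (Suc m)
  show ?case unfolding partials_simps Suc
    by (intro partial_t_eqI has_vector_derivative_lincomb has_vector_derivative_partial_t F G)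
qed

lemma schwartz_iff:
  "schwartz F \<longleftrightarrow> (\<forall>m n p. partials m n F differentiable (at p)) \<and>
     (\<forall>j k m n. \<exists>M. \<forall>t x. \<bar>t\<bar> ^ j * \<bar>x\<bar> ^ k * norm (partials m n F (t, x)) \<le> M)"
proof -
  have "bounded (range (\<lambda>(t, x). t ^ j * x ^ k * norm (partials m n F (t, x)))) \<longleftrightarrow>
    (\<exists>M. \<forall>t x. \<bar>t\<bar> ^ j * \<bar>x\<bar> ^ k * norm (partials m n F (t, x)) \<le> M)" for j k m n
    unfolding bounded_iff by (auto simp: abs_mult power_abs)
  then show ?thesis unfolding schwartz_def by simp
qed

lemma schwartz_bound:
  assumes "schwartz F"
  obtains M where "\<And>t x. \<bar>t\<bar> ^ j * \<bar>x\<bar> ^ k * norm (partials m n F (t, x)) \<le> M"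
  using assms unfolding schwartz_iff by blast

lemma schwartz_differentiable: "schwartz F \<Longrightarrow> partials m n F differentiable (at p)"
  unfolding schwartz_def by blast

lemma schwartz_lincomb:
  assumes F: "schwartz F" and G: "schwartz G"
  shows "schwartz (\<lambda>p. c * F p + d * G p)"
proof -
  note eq = partials_lincomb[OF schwartz_differentiable[OF F] schwartz_differentiable[OF G]]
  show ?thesis unfolding schwartz_iff eq
  proof (intro conjI allI)
    fix m n p
    show "(\<lambda>p. c * partials m n F p + d * partials m n G p) differentiable at p"
      by (intro differentiable_add differentiable_mult differentiable_const schwartz_differentiable F G)
  next
    fix j k m n
    obtain M N where M: "\<And>t x. \<bar>t\<bar> ^ j * \<bar>x\<bar> ^ k * norm (partials m n F (t, x)) \<le> M"
      and N: "\<And>t x. \<bar>t\<bar> ^ j * \<bar>x\<bar> ^ k * norm (partials m n G (t, x)) \<le> N"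
      using schwartz_bound F G by metis
    show "\<exists>M. \<forall>t x. \<bar>t\<bar> ^ j * \<bar>x\<bar> ^ k * norm (c * partials m n F (t, x) + d * partials m n G (t, x)) \<le> M"
    proof (intro exI allI)
      fix t x :: real
      let ?w = "\<bar>t\<bar> ^ j * \<bar>x\<bar> ^ k"
      have "?w * norm (c * partials m n F (t, x) + d * partials m n G (t, x)) \<le>
        ?w * (norm c * norm (partials m n F (t, x)) + norm d * norm (partials m n G (t, x)))"
        by (intro mult_left_mono order_trans[OF norm_triangle_ineq]) (auto simp: norm_mult)
      also have "\<dots> = norm c * (?w * norm (partials m n F (t, x))) + norm d * (?w * norm (partials m n G (t, x)))"
        by (simp add: algebra_simps)
      also have "\<dots> \<le> norm c * M + norm d * N"
        by (intro add_mono mult_left_mono M N) auto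
      finally show "?w * norm (c * partials m n F (t, x) + d * partials m n G (t, x)) \<le> norm c * M + norm d * N" .
    qed
  qed
qed

definition plane_decay :: "real \<times> real \<Rightarrow> real" where
  "plane_decay = (\<lambda>(t, x). bracket t powr (-2) * bracket x powr (-2))"

lemma integrable_bracket: "B > 1 \<Longrightarrow> integrable lborel (\<lambda>x. bracket x powr (-B))"
  using bracket_mass_finite[of B] by (intro integrableI_nonneg) (auto simp: bracket_mass_def)

lemma plane_decay_nonneg: "0 \<le> plane_decay p"
  by (simp add: plane_decay_def split_beta)

lemma borel_measurable_plane_decay [measurable]: "plane_decay \<in> borel_measurable borel"
proof -
  have "continuous_on UNIV plane_decay"
    unfolding plane_decay_def split_beta by (intro continuous_intros) (auto simp: bracket_def)
  then show ?thesis by (rule borel_measurable_continuous_onI)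
qed

lemma integrable_plane_decay: "integrable lborel plane_decay"
proof (rule integrableI_nonneg)
  have "(\<integral>\<^sup>+p. ennreal (plane_decay p) \<partial>lborel) = (\<integral>\<^sup>+x. \<integral>\<^sup>+t. ennreal (plane_decay (t, x)) \<partial>lborel \<partial>lborel)"
    by (rule nn_integral_plane) measurable
  also have "\<dots> = bracket_mass 2 * bracket_mass 2"
    by (simp add: plane_decay_def ennreal_mult nn_integral_multc nn_integral_cmult bracket_mass_def)
  finally show "(\<integral>\<^sup>+p. ennreal (plane_decay p) \<partial>lborel) < \<infinity>"
    using bracket_mass_finite[of 2] by (simp add: ennreal_mult_less_top)
qed (auto simp: plane_decay_nonneg)

lemma bracket_powr_m2: "bracket x powr (-2) = 1 / (bracket x)\<^sup>2"
  using bracket_pos[of x] by (simp add: powr_minus powr_numeral divide_inverse)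

lemma schwartz_partials_decay:
  assumes "schwartz F"
  obtains M where "\<And>p. norm (partials m n F p) \<le> M * plane_decay p"
proof -
  let ?P = "\<lambda>t x. norm (partials m n F (t, x))"
  have "\<exists>M. \<forall>t x. \<bar>t\<bar> ^ j * \<bar>x\<bar> ^ k * ?P t x \<le> M" for j k
    using assms unfolding schwartz_iff by blast
  then obtain M where M: "\<And>j k t x. \<bar>t\<bar> ^ j * \<bar>x\<bar> ^ k * ?P t x \<le> M j k"
    by metis
  have "norm (partials m n F p) \<le> (4 * (M 0 0 + M 0 2 + M 2 0 + M 2 2)) * plane_decay p" for p
  proof -
    obtain t x where p: "p = (t, x)" by (cases p)
    have sq: "(bracket y)\<^sup>2 \<le> 2 * (1 + \<bar>y\<bar>\<^sup>2)" for y
    proof -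
      have "(1 - \<bar>y\<bar>)\<^sup>2 \<ge> 0" by simp
      then show ?thesis by (simp add: bracket_def power2_eq_square algebra_simps)
    qed
    have "(bracket t)\<^sup>2 * (bracket x)\<^sup>2 * ?P t x \<le> (2 * (1 + \<bar>t\<bar>\<^sup>2)) * (2 * (1 + \<bar>x\<bar>\<^sup>2)) * ?P t x"
      by (intro mult_right_mono mult_mono sq) auto
    also have "\<dots> = 4 * (\<bar>t\<bar>^0 * \<bar>x\<bar>^0 * ?P t x + \<bar>t\<bar>^0 * \<bar>x\<bar>^2 * ?P t x + \<bar>t\<bar>^2 * \<bar>x\<bar>^0 * ?P t x + \<bar>t\<bar>^2 * \<bar>x\<bar>^2 * ?P t x)"
      by (simp add: algebra_simps)
    also have "\<dots> \<le> 4 * (M 0 0 + M 0 2 + M 2 0 + M 2 2)"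
      by (intro mult_left_mono add_mono M) auto
    finally show ?thesis
      using bracket_pos[of t] bracket_pos[of x]
      by (simp add: p plane_decay_def bracket_powr_m2 field_simps)
  qed
  then show ?thesis by (rule that)
qed

lemma continuous_on_partials: "schwartz F \<Longrightarrow> continuous_on UNIV (partials m n F)"
  by (intro continuous_at_imp_continuous_on ballI differentiable_imp_continuous_within schwartz_differentiable)

lemma integrable_partials:
  assumes F: "schwartz F" and [measurable]: "g \<in> borel_measurable borel" and g: "\<And>p. norm (g p) \<le> 1"
  shows "integrable lborel (\<lambda>p. g p * partials m n F p :: complex)"
proof -
  obtain M where M: "\<And>p. norm (partials m n F p) \<le> M * plane_decay p"
    using schwartz_partials_decay[OF F] by metis
  have [measurable]: "partials m n F \<in> borel_measurable borel"
    by (rule borel_measurable_continuous_onI[OF continuous_on_partials[OF F]])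
  show ?thesis
  proof (rule Bochner_Integration.integrable_bound)
    show "integrable lborel (\<lambda>p. M * plane_decay p)" using integrable_plane_decay by simp
    show "AE p in lborel. norm (g p * partials m n F p) \<le> norm (M * plane_decay p)"
    proof (intro AE_I2)
      fix p
      have "norm (g p * partials m n F p) \<le> 1 * norm (partials m n F p)"
        unfolding norm_mult using g by (intro mult_right_mono) auto
      then show "norm (g p * partials m n F p) \<le> norm (M * plane_decay p)" using M[of p] by simp
    qed
  qed measurable
qed

lemma integral_derivative_eq_0:
  fixes \<phi> :: "real \<Rightarrow> complex"
  assumes deriv: "\<And>t. (\<phi> has_vector_derivative \<phi>' t) (at t)" and cont: "continuous_on UNIV \<phi>'"
    and b: "\<And>t. norm (\<phi> t) \<le> M * bracket t powr (-2)" "\<And>t. norm (\<phi>' t) \<le> M * bracket t powr (-2)"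
  shows "integrable lborel \<phi>'" "(LINT t|lborel. \<phi>' t) = 0"
proof -
  have [measurable]: "\<phi>' \<in> borel_measurable borel" using cont by (rule borel_measurable_continuous_onI)
  show int: "integrable lborel \<phi>'"
    by (rule Bochner_Integration.integrable_bound[of _ "\<lambda>t. M * bracket t powr (-2)"])
       (use order_trans[OF b(2) abs_ge_self] integrable_bracket[of 2] in \<open>auto intro!: AE_I2\<close>)
  have lim: "((\<lambda>t. M * bracket t powr (-2)) \<longlongrightarrow> 0) at_top" "((\<lambda>t. M * bracket t powr (-2)) \<longlongrightarrow> 0) at_bot"
    unfolding bracket_powr_m2 bracket_def by real_asymp+
  have "(\<phi> \<longlongrightarrow> 0) at_top" by (rule Lim_null_comparison[OF _ lim(1)]) (use b in auto)
  moreover have "(\<phi> \<longlongrightarrow> 0) at_bot" by (rule Lim_null_comparison[OF _ lim(2)]) (use b in auto)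
  ultimately have "(LBINT t=-\<infinity>..\<infinity>. \<phi>' t) = 0 - 0"
    using int cont deriv
    by (intro interval_integral_FTC_integrable[where F=\<phi>])
       (auto simp: ereal_tendsto_simps set_integrable_def einterval_eq_UNIV continuous_on_eq_continuous_at)
  then show "(LINT t|lborel. \<phi>' t) = 0"
    by (simp add: interval_lebesgue_integral_def einterval_eq_UNIV set_lebesgue_integral_def)
qed

definition phase :: "real \<times> real \<Rightarrow> real \<times> real \<Rightarrow> complex" where
  "phase p q = exp (- \<i> * complex_of_real (fst q * fst p + snd q * snd p))"

lemma norm_phase: "norm (phase p q) = 1"
  by (simp add: phase_def)

lemma borel_measurable_phase: "(\<lambda>(p, q). phase p q) \<in> borel_measurable (borel \<Otimes>\<^sub>M borel)"
  unfolding borel_prod split_beta phase_def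
  by (intro borel_measurable_continuous_onI continuous_intros)

lemma borel_measurable_phase1 [measurable]: "phase p \<in> borel_measurable borel"
  unfolding phase_def[abs_def] by (intro borel_measurable_continuous_onI continuous_intros)

lemma fourier_eq: "fourier F p = (LINT q|lborel. phase p q * F q)"
  by (cases p) (simp add: fourier_def phase_def split_beta')

lemma integrable_phase_partials:
  "schwartz F \<Longrightarrow> integrable lborel (\<lambda>q. phase p q * partials m n F q)"
  by (rule integrable_partials) (auto simp: norm_phase)

lemma schwartz_partials_slice_decay:
  assumes "schwartz F"
  obtains M where "0 \<le> M" "\<And>t x. norm (partials m n F (t, x)) \<le> M * bracket t powr (-2)"
    "\<And>t x. norm (partials m n F (t, x)) \<le> M * bracket x powr (-2)"
proof -
  obtain M where M: "\<And>p. norm (partials m n F p) \<le> M * plane_decay p"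
    using schwartz_partials_decay[OF assms] by metis
  have pd: "plane_decay (t, x) \<le> bracket t powr (-2)" "plane_decay (t, x) \<le> bracket x powr (-2)" for t x
    using mult_left_mono[OF bracket_powr_le_1[of 2 x], of "bracket t powr (-2)"]
      mult_right_mono[OF bracket_powr_le_1[of 2 t], of "bracket x powr (-2)"]
    by (auto simp: plane_decay_def)
  show ?thesis
  proof (rule that[of "\<bar>M\<bar>"])
    fix t x :: real
    have *: "norm (partials m n F (t, x)) \<le> \<bar>M\<bar> * plane_decay (t, x)"
      using M[of "(t, x)"] mult_right_mono[OF abs_ge_self plane_decay_nonneg[of "(t, x)"], of M] by linarith
    then show "norm (partials m n F (t, x)) \<le> \<bar>M\<bar> * bracket t powr (-2)"
      "norm (partials m n F (t, x)) \<le> \<bar>M\<bar> * bracket x powr (-2)"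
      using mult_left_mono[OF pd(1)[of t x], of "\<bar>M\<bar>"] mult_left_mono[OF pd(2)[of t x], of "\<bar>M\<bar>"] by linarith+
  qed auto
qed

text \<open>Integration by parts: the integrand is the derivative of \<open>exp (- i (t w + c)) h(t)\<close>.\<close>

lemma integral_phase_derivative:
  fixes h :: "real \<Rightarrow> complex"
  assumes h: "\<And>t. (h has_vector_derivative h' t) (at t)" and cont: "continuous_on UNIV h" "continuous_on UNIV h'"
    and b: "\<And>t. norm (h t) \<le> M * bracket t powr (-2)" "\<And>t. norm (h' t) \<le> N * bracket t powr (-2)"
  shows "(LINT t|lborel. exp (- \<i> * complex_of_real (t * w + c)) * (h' t - \<i> * complex_of_real w * h t)) = 0"
proof -
  let ?e = "\<lambda>t. exp (- \<i> * complex_of_real (t * w + c))"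
  let ?M = "M + (N + \<bar>w\<bar> * M)"
  have M0: "0 \<le> M" "0 \<le> N"
    using order_trans[OF norm_ge_zero b(1)[of 0]] order_trans[OF norm_ge_zero b(2)[of 0]] by (simp_all add: bracket_def)
  show ?thesis
  proof (rule integral_derivative_eq_0(2)[where M="?M" and \<phi>="\<lambda>t. ?e t * h t"])
    fix t
    have "((\<lambda>t. ?e t) has_vector_derivative (- \<i> * complex_of_real w) * ?e t) (at t)"
    proof -
      have "((\<lambda>z. exp (- \<i> * (z * complex_of_real w + complex_of_real c))) has_field_derivative
          exp (- \<i> * (complex_of_real t * complex_of_real w + complex_of_real c)) * (- \<i> * complex_of_real w)) (at (complex_of_real t))"
        by (auto intro!: derivative_eq_intros)
      from has_vector_derivative_real_field[OF this] show ?thesis by (simp add: mult.commute)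
    qed
    from has_vector_derivative_mult[OF this h]
    show "((\<lambda>t. ?e t * h t) has_vector_derivative ?e t * (h' t - \<i> * complex_of_real w * h t)) (at t)"
      by (simp add: algebra_simps)
    have "norm (?e t * h t) = norm (h t)" by (simp add: norm_mult)
    also have "\<dots> \<le> M * bracket t powr (-2)" by (rule b)
    also have "\<dots> \<le> ?M * bracket t powr (-2)" using M0 by (intro mult_right_mono) auto
    finally show "norm (?e t * h t) \<le> ?M * bracket t powr (-2)" .
    have "norm (?e t * (h' t - \<i> * complex_of_real w * h t)) = norm (h' t - \<i> * complex_of_real w * h t)" by (simp add: norm_mult)
    also have "\<dots> \<le> norm (h' t) + \<bar>w\<bar> * norm (h t)"
      using norm_triangle_ineq4[of "h' t" "\<i> * complex_of_real w * h t"] by (simp add: norm_mult)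
    also have "\<dots> \<le> N * bracket t powr (-2) + \<bar>w\<bar> * (M * bracket t powr (-2))"
      by (intro add_mono mult_left_mono b) auto
    also have "\<dots> = (N + \<bar>w\<bar> * M) * bracket t powr (-2)" by (simp add: algebra_simps)
    also have "\<dots> \<le> ?M * bracket t powr (-2)" using M0 by (intro mult_right_mono) auto
    finally show "norm (?e t * (h' t - \<i> * complex_of_real w * h t)) \<le> ?M * bracket t powr (-2)" .
  next
    show "continuous_on UNIV (\<lambda>t. ?e t * (h' t - \<i> * complex_of_real w * h t))"
      by (intro continuous_intros cont)
  qed
qed

lemma fourier_partial_t:
  assumes F: "schwartz F"
  shows "fourier (partials (Suc m) n F) p = \<i> * complex_of_real (fst p) * fourier (partials m n F) p"
proof -
  let ?H = "partials m n F" and ?H' = "partials (Suc m) n F"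
  let ?G = "\<lambda>q. phase p q * (?H' q - \<i> * complex_of_real (fst p) * ?H q)"
  have G: "?G q = phase p q * ?H' q - \<i> * complex_of_real (fst p) * (phase p q * ?H q)" for q
    by (simp add: algebra_simps)
  have int: "integrable lborel ?G"
    unfolding G using integrable_phase_partials[OF F, of p] by (intro Bochner_Integration.integrable_diff) auto
  obtain M where M: "\<And>t x. norm (?H (t, x)) \<le> M * bracket t powr (-2)"
    using schwartz_partials_slice_decay[OF F] by metis
  obtain N where N: "\<And>t x. norm (?H' (t, x)) \<le> N * bracket t powr (-2)"
    using schwartz_partials_slice_decay[OF F] by metis
  have cont: "continuous_on UNIV (\<lambda>t. partials m' n' F (t, x))" for m' n' x
    by (rule continuous_on_compose2[OF continuous_on_partials[OF F]]) (auto intro!: continuous_intros)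
  have inner: "(LINT t|lborel. ?G (t, x)) = 0" for x
  proof -
    have "(LINT t|lborel. exp (- \<i> * complex_of_real (t * fst p + x * snd p)) *
      (?H' (t, x) - \<i> * complex_of_real (fst p) * ?H (t, x))) = 0"
    proof (rule integral_phase_derivative)
      show "((\<lambda>t. ?H (t, x)) has_vector_derivative ?H' (t, x)) (at t)" for t
        unfolding partials_simps by (intro has_vector_derivative_partial_t schwartz_differentiable F)
    qed (rule cont M N)+
    then show ?thesis by (simp add: phase_def add.commute)
  qed
  have "(LINT x|lborel. LINT t|lborel. ?G (t, x)) = (LINT q|lborel. ?G q)"
    using lborel_pair.integral_snd[of "\<lambda>t x. ?G (t, x)"] int by (simp add: lborel_prod split_beta')
  then have "(LINT q|lborel. ?G q) = 0" unfolding inner by simp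
  then show ?thesis
    unfolding G fourier_eq using integrable_phase_partials[OF F, of p]
    by (subst (asm) Bochner_Integration.integral_diff) auto
qed

lemma fourier_partial_x:
  assumes F: "schwartz F"
  shows "fourier (partials 0 (Suc n) F) p = \<i> * complex_of_real (snd p) * fourier (partials 0 n F) p"
proof -
  let ?H = "partials 0 n F" and ?H' = "partials 0 (Suc n) F"
  let ?G = "\<lambda>q. phase p q * (?H' q - \<i> * complex_of_real (snd p) * ?H q)"
  have G: "?G q = phase p q * ?H' q - \<i> * complex_of_real (snd p) * (phase p q * ?H q)" for q
    by (simp add: algebra_simps)
  have int: "integrable lborel ?G"
    unfolding G using integrable_phase_partials[OF F, of p] by (intro Bochner_Integration.integrable_diff) auto
  obtain M where M: "\<And>t x. norm (?H (t, x)) \<le> M * bracket x powr (-2)"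
    using schwartz_partials_slice_decay[OF F] by metis
  obtain N where N: "\<And>t x. norm (?H' (t, x)) \<le> N * bracket x powr (-2)"
    using schwartz_partials_slice_decay[OF F] by metis
  have cont: "continuous_on UNIV (\<lambda>x. partials m' n' F (t, x))" for m' n' t
    by (rule continuous_on_compose2[OF continuous_on_partials[OF F]]) (auto intro!: continuous_intros)
  have inner: "(LINT x|lborel. ?G (t, x)) = 0" for t
  proof -
    have "(LINT x|lborel. exp (- \<i> * complex_of_real (x * snd p + t * fst p)) *
      (?H' (t, x) - \<i> * complex_of_real (snd p) * ?H (t, x))) = 0"
    proof (rule integral_phase_derivative)
      show "((\<lambda>x. ?H (t, x)) has_vector_derivative ?H' (t, x)) (at x)" for x
        unfolding partials_simps by (intro has_vector_derivative_partial_x schwartz_differentiable F)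
    qed (rule cont M N)+
    then show ?thesis by (simp add: phase_def add.commute)
  qed
  have "(LINT t|lborel. LINT x|lborel. ?G (t, x)) = (LINT q|lborel. ?G q)"
    using lborel_pair.integral_fst'[of ?G] int by (simp add: lborel_prod)
  then have "(LINT q|lborel. ?G q) = 0" unfolding inner by simp
  then show ?thesis
    unfolding G fourier_eq using integrable_phase_partials[OF F, of p]
    by (subst (asm) Bochner_Integration.integral_diff) auto
qed

text \<open>The derivatives in x are taken first in \<open>partials m n F\<close>, so those in t are removed first.\<close>

lemma fourier_partials:
  assumes F: "schwartz F"
  shows "fourier (partials m n F) p = (\<i> * complex_of_real (fst p)) ^ m * (\<i> * complex_of_real (snd p)) ^ n * fourier F p"
proof (induction m)
  case 0
  show ?case
    by (induction n) (simp_all add: partials_simps(1) fourier_partial_x[OF F])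
qed (simp add: fourier_partial_t[OF F])

lemma fourier_decay:
  assumes F: "schwartz F"
  obtains C where "\<And>p. bracket (fst p) ^ m * bracket (snd p) ^ n * norm (fourier F p) \<le> C"
proof -
  define c where "c m n = (LINT q|lborel. norm (1 * partials m n F q))" for m n
  have c: "\<bar>fst p\<bar> ^ m * \<bar>snd p\<bar> ^ n * norm (fourier F p) \<le> c m n" for m n p
  proof -
    have "\<bar>fst p\<bar> ^ m * \<bar>snd p\<bar> ^ n * norm (fourier F p) = norm (fourier (partials m n F) p)"
      by (simp add: fourier_partials[OF F] norm_mult norm_power)
    also have "\<dots> \<le> (LINT q|lborel. norm (phase p q * partials m n F q))"
      unfolding fourier_eq by (rule integral_norm_bound)
    finally show ?thesis by (simp add: c_def norm_mult norm_phase)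
  qed
  have br: "bracket y ^ k \<le> 2 ^ k * (1 + \<bar>y\<bar> ^ k)" for y k
  proof (cases "\<bar>y\<bar> \<le> 1")
    case True
    have "bracket y ^ k \<le> 2 ^ k" using True bracket_nonneg[of y] by (intro power_mono) (auto simp: bracket_def)
    then show ?thesis by (rule order_trans) simp
  next
    case False
    have "bracket y ^ k \<le> (2 * \<bar>y\<bar>) ^ k" using False bracket_nonneg[of y] by (intro power_mono) (auto simp: bracket_def)
    then show ?thesis by (rule order_trans) (simp add: power_mult_distrib)
  qed
  have "bracket (fst p) ^ m * bracket (snd p) ^ n * norm (fourier F p) \<le> 2 ^ m * 2 ^ n * (c 0 0 + c 0 n + c m 0 + c m n)" for p
  proof -
    let ?N = "norm (fourier F p)" and ?a = "\<bar>fst p\<bar>" and ?b = "\<bar>snd p\<bar>"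
    have "bracket (fst p) ^ m * bracket (snd p) ^ n * ?N \<le> (2 ^ m * (1 + ?a ^ m)) * (2 ^ n * (1 + ?b ^ n)) * ?N"
      using bracket_nonneg by (intro mult_right_mono mult_mono br) auto
    also have "\<dots> = 2 ^ m * 2 ^ n * (?a ^ 0 * ?b ^ 0 * ?N + ?a ^ 0 * ?b ^ n * ?N + ?a ^ m * ?b ^ 0 * ?N + ?a ^ m * ?b ^ n * ?N)"
      by (simp add: algebra_simps)
    also have "\<dots> \<le> 2 ^ m * 2 ^ n * (c 0 0 + c 0 n + c m 0 + c m n)"
      by (intro mult_left_mono add_mono c) auto
    finally show ?thesis .
  qed
  then show ?thesis by (rule that)
qed

lemma weight_le:
  "weight s b p \<le> bracket (fst p) powr \<bar>b\<bar> * bracket (snd p) powr (2 * \<bar>b\<bar> + \<bar>s\<bar>)"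
proof -
  obtain t x where p: "p = (t, x)" by (cases p)
  have mono: "bracket y powr e \<le> bracket y powr \<bar>e\<bar>" for y e
    using bracket_ge_1[of y] by (intro powr_mono) auto
  have g: "bracket (gam x) \<le> (bracket x)\<^sup>2"
  proof -
    have "x\<^sup>2 + x ^ 4 \<le> (\<bar>x\<bar> + x\<^sup>2)\<^sup>2"
      using mult_nonneg_nonneg[OF abs_ge_zero[of x] zero_le_power2[of x]] by (simp add: power2_sum power_even_abs)
    then have "gam x \<le> \<bar>x\<bar> + x\<^sup>2" unfolding gam_def by (intro real_le_lsqrt) auto
    moreover have "0 \<le> gam x" by (simp add: gam_def)
    ultimately show ?thesis by (simp add: bracket_def power2_eq_square algebra_simps)
  qed
  have "bracket (\<bar>t\<bar> - gam x) \<le> bracket t * (bracket x)\<^sup>2"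
  proof -
    have "bracket (\<bar>t\<bar> - gam x) \<le> bracket \<bar>t\<bar> * bracket (gam x)" by (rule bracket_diff_le)
    also have "\<dots> \<le> bracket t * (bracket x)\<^sup>2"
      using g bracket_nonneg[of t] by (auto simp: bracket_def[of "\<bar>t\<bar>"] bracket_def[of t] intro!: mult_left_mono)
    finally show ?thesis .
  qed
  then have "bracket (\<bar>t\<bar> - gam x) powr \<bar>b\<bar> \<le> (bracket t * (bracket x)\<^sup>2) powr \<bar>b\<bar>"
    using bracket_nonneg by (intro powr_mono2) auto
  also have "\<dots> = bracket t powr \<bar>b\<bar> * bracket x powr (2 * \<bar>b\<bar>)"
    using bracket_pos[of t] bracket_pos[of x] by (simp add: powr_mult powr_powr flip: powr_numeral)
  finally have "bracket (\<bar>t\<bar> - gam x) powr b \<le> bracket t powr \<bar>b\<bar> * bracket x powr (2 * \<bar>b\<bar>)"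
    using mono[of "\<bar>t\<bar> - gam x" b] by linarith
  then have "weight s b p \<le> (bracket t powr \<bar>b\<bar> * bracket x powr (2 * \<bar>b\<bar>)) * bracket x powr \<bar>s\<bar>"
    unfolding weight_def p by (auto intro!: mult_mono mono)
  then show ?thesis by (simp add: p powr_add mult.assoc)
qed

lemma borel_measurable_fourier:
  assumes F: "schwartz F" shows "fourier F \<in> borel_measurable borel"
proof -
  have [measurable]: "F \<in> borel_measurable borel"
    using borel_measurable_continuous_onI[OF continuous_on_partials[OF F, of 0 0]] by (simp add: partials_simps)
  have "(\<lambda>p. LINT q|lborel. phase p q * F q) \<in> borel_measurable borel"
    using borel_measurable_phase by (intro lborel.borel_measurable_lebesgue_integral) (measurable; simp add: split_beta')
  then show ?thesis by (simp add: fourier_eq[abs_def])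
qed

text \<open>The weight grows at most polynomially. Polynomial decay of one order more in each variable leaves a
  factor \<open>1 / \<langle>\<tau>\<rangle>\<langle>\<xi>\<rangle>\<close>, which is square integrable.\<close>

lemma fourier_in_weighted_L2:
  assumes F: "schwartz F" shows "fourier F \<in> weighted_L2 s b"
proof -
  note [measurable] = borel_measurable_fourier[OF F]
  obtain m n :: nat where m: "\<bar>b\<bar> + 1 \<le> real m" and n: "2 * \<bar>b\<bar> + \<bar>s\<bar> + 1 \<le> real n"
    using real_arch_simple by metis
  obtain C where C: "\<And>p. bracket (fst p) ^ m * bracket (snd p) ^ n * norm (fourier F p) \<le> C"
    using fourier_decay[OF F] by metis
  have pw: "bracket y powr e \<le> bracket y ^ k * bracket y powr (-1)" if "e + 1 \<le> real k" for y e k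
  proof -
    have "bracket y powr e \<le> bracket y powr (real k + (-1))" using that bracket_ge_1[of y] by (intro powr_mono) auto
    then show ?thesis using bracket_pos[of y] unfolding powr_add by (simp add: powr_realpow)
  qed
  have bound: "(weight s b p * norm (fourier F p))\<^sup>2 \<le> C\<^sup>2 * plane_decay p" for p
  proof -
    let ?y = "bracket (fst p)" and ?z = "bracket (snd p)" and ?N = "norm (fourier F p)"
    have "weight s b p * ?N \<le> ((?y ^ m * ?y powr (-1)) * (?z ^ n * ?z powr (-1))) * ?N"
    proof (intro mult_right_mono)
      show "weight s b p \<le> (?y ^ m * ?y powr (-1)) * (?z ^ n * ?z powr (-1))"
        using bracket_nonneg by (intro order_trans[OF weight_le] mult_mono pw m n) auto
    qed simp
    also have "\<dots> = (?y ^ m * ?z ^ n * ?N) * (?y powr (-1) * ?z powr (-1))" by (simp add: mult_ac)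
    also have "\<dots> \<le> C * (?y powr (-1) * ?z powr (-1))" by (intro mult_right_mono C) auto
    finally have "(weight s b p * ?N)\<^sup>2 \<le> (C * (?y powr (-1) * ?z powr (-1)))\<^sup>2"
      using weight_pos[of s b p] by (intro power_mono) auto
    also have "\<dots> = C\<^sup>2 * plane_decay p" unfolding power_mult_distrib powr_square plane_decay_def split_beta by simp
    finally show ?thesis .
  qed
  have "integrable lborel (\<lambda>p. (weight s b p * norm (fourier F p))\<^sup>2)"
    by (rule Bochner_Integration.integrable_bound[of _ "\<lambda>p. C\<^sup>2 * plane_decay p"])
       (use integrable_plane_decay bound order_trans[OF bound abs_ge_self] in \<open>auto intro!: AE_I2\<close>)
  then show ?thesis by (simp add: weighted_L2_def)
qed

lemma fourier_lincomb:
  assumes F: "schwartz F" and G: "schwartz G"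
  shows "fourier (\<lambda>p. c * F p + d * G p) p = c * fourier F p + d * fourier G p"
proof -
  have *: "phase p q * (c * F q + d * G q) = c * (phase p q * F q) + d * (phase p q * G q)" for q
    by (simp add: algebra_simps)
  show ?thesis unfolding fourier_eq *
    using integrable_phase_partials[OF F, of p 0 0] integrable_phase_partials[OF G, of p 0 0]
    by (subst Bochner_Integration.integral_add) (auto simp: partials_simps)
qed

lemma fourier_diff:
  "schwartz F \<Longrightarrow> schwartz G \<Longrightarrow> fourier (\<lambda>p. F p - G p) p = fourier F p - fourier G p"
  using fourier_lincomb[of F G 1 "-1" p] by simp

section \<open>The weighted spaces\<close>

lemma weighted_L2_iff:
  "G \<in> weighted_L2 s b \<longleftrightarrow> G \<in> borel_measurable borel \<and> (\<integral>\<^sup>+p. ennreal ((weight s b p * norm (G p))\<^sup>2) \<partial>lborel) < \<infinity>"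
proof (cases "G \<in> borel_measurable borel")
  case True
  then have [measurable]: "G \<in> borel_measurable borel" .
  show ?thesis by (simp add: weighted_L2_def integrable_iff_bounded True)
qed (simp add: weighted_L2_def)

lemma weighted_L2_measurable: "G \<in> weighted_L2 s b \<Longrightarrow> G \<in> borel_measurable borel"
  by (simp add: weighted_L2_iff)

lemma weighted_L2_integrable: "G \<in> weighted_L2 s b \<Longrightarrow> integrable lborel (\<lambda>p. (weight s b p * norm (G p))\<^sup>2)"
  by (simp add: weighted_L2_def)

lemma weighted_L2_norm_nonneg: "0 \<le> weighted_L2_norm s b G"
  by (simp add: weighted_L2_norm_def)

lemma weighted_L2_norm_nn:
  "G \<in> weighted_L2 s b \<Longrightarrow>
    (\<integral>\<^sup>+p. ennreal ((weight s b p * norm (G p))\<^sup>2) \<partial>lborel) = ennreal ((weighted_L2_norm s b G)\<^sup>2)"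
  by (simp add: weighted_L2_norm_def nn_integral_eq_integral weighted_L2_integrable)

lemma weighted_L2_norm_le:
  assumes "G \<in> borel_measurable borel" "0 \<le> c"
    "(\<integral>\<^sup>+p. ennreal ((weight s b p * norm (G p))\<^sup>2) \<partial>lborel) \<le> ennreal (c\<^sup>2)"
  shows "G \<in> weighted_L2 s b" "weighted_L2_norm s b G \<le> c"
proof -
  show G: "G \<in> weighted_L2 s b" using assms by (auto simp: weighted_L2_iff intro: le_less_trans)
  have "(weighted_L2_norm s b G)\<^sup>2 \<le> c\<^sup>2" using assms(3) by (simp add: weighted_L2_norm_nn[OF G])
  then show "weighted_L2_norm s b G \<le> c" using assms(2) by (rule power2_le_imp_le)
qed

lemma L2_Cauchy_Schwarz:
  fixes f g :: "'a \<Rightarrow> real"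
  assumes [measurable]: "f \<in> borel_measurable M" "g \<in> borel_measurable M"
    and nonneg: "\<And>x. 0 \<le> f x" "\<And>x. 0 \<le> g x"
    and int: "integrable M (\<lambda>x. (f x)\<^sup>2)" "integrable M (\<lambda>x. (g x)\<^sup>2)"
  shows "integrable M (\<lambda>x. f x * g x)"
    "(LINT x|M. f x * g x) \<le> sqrt (LINT x|M. (f x)\<^sup>2) * sqrt (LINT x|M. (g x)\<^sup>2)"
proof -
  have "f x * g x \<le> (f x)\<^sup>2 + (g x)\<^sup>2" for x
  proof -
    have "2 * (f x * g x) \<le> (f x)\<^sup>2 + (g x)\<^sup>2" using sum_squares_bound[of "f x" "g x"] by (simp only: mult.assoc)
    then show ?thesis using mult_nonneg_nonneg[OF nonneg, of x x] by linarith
  qed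
  then show int2: "integrable M (\<lambda>x. f x * g x)"
    by (intro Bochner_Integration.integrable_bound[OF Bochner_Integration.integrable_add[OF int]])
       (use nonneg in auto)
  have "(\<integral>\<^sup>+x. ennreal (f x) * ennreal (g x) \<partial>M)\<^sup>2 \<le> (\<integral>\<^sup>+x. (ennreal (f x))\<^sup>2 \<partial>M) * (\<integral>\<^sup>+x. (ennreal (g x))\<^sup>2 \<partial>M)"
    by (intro Cauchy_Schwarz_nn_integral) measurable
  then have "ennreal ((LINT x|M. f x * g x)\<^sup>2) \<le> ennreal ((LINT x|M. (f x)\<^sup>2) * (LINT x|M. (g x)\<^sup>2))"
    using int int2 nonneg
    by (simp add: ennreal_power ennreal_mult'[symmetric] nn_integral_eq_integral integral_nonneg_AE)
  then have "(LINT x|M. f x * g x)\<^sup>2 \<le> (LINT x|M. (f x)\<^sup>2) * (LINT x|M. (g x)\<^sup>2)"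
    by (subst (asm) ennreal_le_iff) auto
  then show "(LINT x|M. f x * g x) \<le> sqrt (LINT x|M. (f x)\<^sup>2) * sqrt (LINT x|M. (g x)\<^sup>2)"
    unfolding real_sqrt_mult[symmetric] by (rule real_le_rsqrt)
qed

lemma L2_Minkowski:
  fixes f g :: "'a \<Rightarrow> real"
  assumes [measurable]: "f \<in> borel_measurable M" "g \<in> borel_measurable M"
    and nonneg: "\<And>x. 0 \<le> f x" "\<And>x. 0 \<le> g x"
    and int: "integrable M (\<lambda>x. (f x)\<^sup>2)" "integrable M (\<lambda>x. (g x)\<^sup>2)"
  shows "integrable M (\<lambda>x. (f x + g x)\<^sup>2)"
    "sqrt (LINT x|M. (f x + g x)\<^sup>2) \<le> sqrt (LINT x|M. (f x)\<^sup>2) + sqrt (LINT x|M. (g x)\<^sup>2)"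
proof -
  note cs = L2_Cauchy_Schwarz[OF assms]
  have eq: "(f x + g x)\<^sup>2 = (f x)\<^sup>2 + (g x)\<^sup>2 + 2 * (f x * g x)" for x by (simp add: power2_sum)
  show "integrable M (\<lambda>x. (f x + g x)\<^sup>2)" unfolding eq using int cs(1) by simp
  let ?a = "LINT x|M. (f x)\<^sup>2" and ?b = "LINT x|M. (g x)\<^sup>2"
  have "(LINT x|M. (f x + g x)\<^sup>2) = ?a + ?b + 2 * (LINT x|M. f x * g x)"
    unfolding eq using int cs(1) by simp
  also have "\<dots> \<le> (sqrt ?a)\<^sup>2 + (sqrt ?b)\<^sup>2 + 2 * (sqrt ?a * sqrt ?b)"
    using cs(2) by simp
  also have "\<dots> = (sqrt ?a + sqrt ?b)\<^sup>2" by (simp only: power2_sum mult.assoc)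
  finally show "sqrt (LINT x|M. (f x + g x)\<^sup>2) \<le> sqrt ?a + sqrt ?b"
    by (intro real_le_lsqrt) auto
qed

lemma weighted_L2_mono:
  assumes "G \<in> weighted_L2 s b" "F \<in> borel_measurable borel" "\<And>p. norm (F p) \<le> norm (G p)"
  shows "F \<in> weighted_L2 s b"
proof -
  have "(\<integral>\<^sup>+p. ennreal ((weight s b p * norm (F p))\<^sup>2) \<partial>lborel) \<le> (\<integral>\<^sup>+p. ennreal ((weight s b p * norm (G p))\<^sup>2) \<partial>lborel)"
    using assms(3) weight_pos[of s b]
    by (intro nn_integral_mono ennreal_leI power_mono mult_left_mono) (auto simp: less_imp_le)
  then show ?thesis using assms(1,2) by (auto simp: weighted_L2_iff intro: le_less_trans)
qed

lemma weighted_L2_scale: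
  assumes "F \<in> weighted_L2 s b"
  shows "(\<lambda>p. c * F p) \<in> weighted_L2 s b" "weighted_L2_norm s b (\<lambda>p. c * F p) = norm c * weighted_L2_norm s b F"
proof -
  have [measurable]: "F \<in> borel_measurable borel" by (rule weighted_L2_measurable[OF assms])
  have eq: "(weight s b p * norm (c * F p))\<^sup>2 = (norm c)\<^sup>2 * (weight s b p * norm (F p))\<^sup>2" for p
    by (simp add: norm_mult power_mult_distrib)
  show "(\<lambda>p. c * F p) \<in> weighted_L2 s b"
    using weighted_L2_integrable[OF assms] by (simp add: weighted_L2_def eq)
  show "weighted_L2_norm s b (\<lambda>p. c * F p) = norm c * weighted_L2_norm s b F"
    unfolding weighted_L2_norm_def eq by (simp add: real_sqrt_mult)
qed

lemma weighted_L2_add: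
  assumes F: "F \<in> weighted_L2 s b" and G: "G \<in> weighted_L2 s b"
  shows "(\<lambda>p. F p + G p) \<in> weighted_L2 s b"
    "weighted_L2_norm s b (\<lambda>p. F p + G p) \<le> weighted_L2_norm s b F + weighted_L2_norm s b G"
proof -
  note [measurable] = weighted_L2_measurable[OF F] weighted_L2_measurable[OF G]
  let ?w = "weight s b"
  have w: "0 \<le> ?w p" for p using weight_pos[of s b p] by simp
  note M = L2_Minkowski[of "\<lambda>p. ?w p * norm (F p)" lborel "\<lambda>p. ?w p * norm (G p)"]
  have M1: "integrable lborel (\<lambda>p. (?w p * norm (F p) + ?w p * norm (G p))\<^sup>2)"
    by (rule M) (use weighted_L2_integrable[OF F] weighted_L2_integrable[OF G] w in auto)
  have le: "(?w p * norm (F p + G p))\<^sup>2 \<le> (?w p * norm (F p) + ?w p * norm (G p))\<^sup>2" for p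
    using w by (intro power_mono) (auto simp: norm_triangle_ineq mult_left_mono simp flip: distrib_left)
  have int: "integrable lborel (\<lambda>p. (?w p * norm (F p + G p))\<^sup>2)"
    by (rule Bochner_Integration.integrable_bound[OF M1]) (use le in auto)
  then show "(\<lambda>p. F p + G p) \<in> weighted_L2 s b" by (simp add: weighted_L2_def)
  have "weighted_L2_norm s b (\<lambda>p. F p + G p) \<le> sqrt (LINT p|lborel. (?w p * norm (F p) + ?w p * norm (G p))\<^sup>2)"
    unfolding weighted_L2_norm_def using int M1 le by (intro real_sqrt_le_mono integral_mono) auto
  also have "\<dots> \<le> weighted_L2_norm s b F + weighted_L2_norm s b G"
    unfolding weighted_L2_norm_def
    by (rule M) (use weighted_L2_integrable[OF F] weighted_L2_integrable[OF G] w in auto)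
  finally show "weighted_L2_norm s b (\<lambda>p. F p + G p) \<le> weighted_L2_norm s b F + weighted_L2_norm s b G" .
qed

lemma weighted_L2_diff:
  assumes F: "F \<in> weighted_L2 s b" and G: "G \<in> weighted_L2 s b"
  shows "(\<lambda>p. F p - G p) \<in> weighted_L2 s b"
  using weighted_L2_add(1)[OF F weighted_L2_scale(1)[OF G, of "-1"]] by simp

lemma weighted_L2_norm_minus_commute:
  "weighted_L2_norm s b (\<lambda>p. F p - G p) = weighted_L2_norm s b (\<lambda>p. G p - F p)"
  by (simp add: weighted_L2_norm_def norm_minus_commute)

lemma weighted_L2_triangle:
  assumes F: "F \<in> weighted_L2 s b" and G: "G \<in> weighted_L2 s b" and H: "H \<in> weighted_L2 s b"
  shows "weighted_L2_norm s b (\<lambda>p. F p - H p) \<le> weighted_L2_norm s b (\<lambda>p. F p - G p) + weighted_L2_norm s b (\<lambda>p. G p - H p)"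
  using weighted_L2_add(2)[OF weighted_L2_diff[OF F G] weighted_L2_diff[OF G H]] by simp

lemma weighted_L2_reverse_triangle:
  assumes F: "F \<in> weighted_L2 s b" and G: "G \<in> weighted_L2 s b"
  shows "\<bar>weighted_L2_norm s b F - weighted_L2_norm s b G\<bar> \<le> weighted_L2_norm s b (\<lambda>p. F p - G p)"
  using weighted_L2_add(2)[OF weighted_L2_diff[OF F G] G] weighted_L2_add(2)[OF weighted_L2_diff[OF G F] F]
    weighted_L2_norm_minus_commute[of s b F G]
  by simp

lemma weighted_L2_dominated:
  assumes G: "\<And>n. G n \<in> borel_measurable borel" and lim: "\<And>p. (\<lambda>n. G n p) \<longlonglongrightarrow> W p"
    and D: "D \<in> weighted_L2 s b" "\<And>n p. norm (G n p) \<le> norm (D p)"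
  shows "W \<in> weighted_L2 s b" "(\<lambda>n. weighted_L2_norm s b (\<lambda>p. G n p - W p)) \<longlonglongrightarrow> 0"
proof -
  note [measurable] = G weighted_L2_measurable[OF D(1)]
  have [measurable]: "W \<in> borel_measurable borel" by (rule borel_measurable_LIMSEQ_metric[OF G lim])
  have W: "norm (W p) \<le> norm (D p)" for p
    by (rule LIMSEQ_le_const2[OF tendsto_norm[OF lim]]) (use D(2) in auto)
  show "W \<in> weighted_L2 s b" by (rule weighted_L2_mono[OF D(1) _ W]) measurable
  have "(\<lambda>n. LINT p|lborel. (weight s b p * norm (G n p - W p))\<^sup>2) \<longlonglongrightarrow> (LINT p|(lborel :: (real \<times> real) measure). 0)"
  proof (rule integral_dominated_convergence)
    show "integrable lborel (\<lambda>p. 4 * (weight s b p * norm (D p))\<^sup>2)" using weighted_L2_integrable[OF D(1)] by simp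
    show "AE p in lborel. (\<lambda>n. (weight s b p * norm (G n p - W p))\<^sup>2) \<longlonglongrightarrow> 0"
    proof (intro AE_I2)
      fix p
      have "(\<lambda>n. (weight s b p * norm (G n p - W p))\<^sup>2) \<longlonglongrightarrow> (weight s b p * norm (W p - W p))\<^sup>2"
        by (intro tendsto_intros lim)
      then show "(\<lambda>n. (weight s b p * norm (G n p - W p))\<^sup>2) \<longlonglongrightarrow> 0" by simp
    qed
    show "AE p in lborel. norm ((weight s b p * norm (G n p - W p))\<^sup>2) \<le> 4 * (weight s b p * norm (D p))\<^sup>2" for n
    proof (intro AE_I2)
      fix p
      have "norm (G n p - W p) \<le> 2 * norm (D p)"
        using norm_triangle_ineq4[of "G n p" "W p"] D(2)[of n p] W[of p] by linarith
      then have "(weight s b p * norm (G n p - W p))\<^sup>2 \<le> (weight s b p * (2 * norm (D p)))\<^sup>2"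
        using weight_pos[of s b p] by (intro power_mono mult_left_mono) auto
      then show "norm ((weight s b p * norm (G n p - W p))\<^sup>2) \<le> 4 * (weight s b p * norm (D p))\<^sup>2"
        by (simp add: power_mult_distrib)
    qed
  qed measurable
  from tendsto_real_sqrt[OF this] show "(\<lambda>n. weighted_L2_norm s b (\<lambda>p. G n p - W p)) \<longlonglongrightarrow> 0"
    by (simp add: weighted_L2_norm_def)
qed

text \<open>Multiplication by the weight and by a fixed positive square integrable function \<open>\<phi>\<close> maps the space continuously
  into \<open>L\<^sup>1\<close>, so a subsequence is pointwise Cauchy almost everywhere. By Fatou's lemma its limit is also the
  limit in norm.\<close>

lemma weighted_L2_complete:
  assumes G: "\<And>n. G n \<in> weighted_L2 s b"
    and cauchy: "\<And>e. e > 0 \<Longrightarrow> \<exists>N. \<forall>m\<ge>N. \<forall>n\<ge>N. weighted_L2_norm s b (\<lambda>p. G m p - G n p) < e"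
  obtains W where "W \<in> weighted_L2 s b" "(\<lambda>n. weighted_L2_norm s b (\<lambda>p. G n p - W p)) \<longlonglongrightarrow> 0"
proof -
  note [measurable] = weighted_L2_measurable[OF G]
  let ?w = "weight s b"
  define \<phi> where "\<phi> p = sqrt (plane_decay p)" for p
  have [measurable]: "\<phi> \<in> borel_measurable borel" unfolding \<phi>_def by measurable
  have \<phi>: "0 < \<phi> p" for p
    using bracket_pos[of "fst p"] bracket_pos[of "snd p"] by (simp add: \<phi>_def plane_decay_def split_beta)
  have \<phi>2: "(\<phi> p)\<^sup>2 = plane_decay p" for p by (simp add: \<phi>_def plane_decay_nonneg)
  define K where "K = sqrt (LINT p|lborel. plane_decay p)"
  define S where "S n p = complex_of_real (\<phi> p * ?w p) * G n p" for n p
  have normS: "norm (complex_of_real (\<phi> p * ?w p) * z) = \<phi> p * (?w p * norm z)" for p z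
    using \<phi>[of p] weight_pos[of s b p] by (simp add: norm_mult)
  have L1: "integrable lborel (\<lambda>p. complex_of_real (\<phi> p * ?w p) * V p)"
    "(LINT p|lborel. norm (complex_of_real (\<phi> p * ?w p) * V p)) \<le> K * weighted_L2_norm s b V"
    if V: "V \<in> weighted_L2 s b" for V
  proof -
    have [measurable]: "V \<in> borel_measurable borel" by (rule weighted_L2_measurable[OF V])
    note cs = L2_Cauchy_Schwarz[of \<phi> lborel "\<lambda>p. ?w p * norm (V p)"]
    have "integrable lborel (\<lambda>p. \<phi> p * (?w p * norm (V p)))"
      by (rule cs) (use \<phi> weight_pos[of s b] weighted_L2_integrable[OF V] integrable_plane_decay in \<open>auto simp: \<phi>2 less_imp_le\<close>)
    then have "integrable lborel (\<lambda>p. norm (complex_of_real (\<phi> p * ?w p) * V p))"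
      unfolding normS .
    then show "integrable lborel (\<lambda>p. complex_of_real (\<phi> p * ?w p) * V p)"
      by (subst (asm) integrable_norm_iff) measurable
    show "(LINT p|lborel. norm (complex_of_real (\<phi> p * ?w p) * V p)) \<le> K * weighted_L2_norm s b V"
      unfolding normS K_def weighted_L2_norm_def \<phi>2[symmetric]
      by (rule cs) (use \<phi> weight_pos[of s b] weighted_L2_integrable[OF V] integrable_plane_decay in \<open>auto simp: \<phi>2 less_imp_le\<close>)
  qed
  have K: "0 \<le> K" by (simp add: K_def integral_nonneg_AE plane_decay_nonneg)
  have S_cauchy: "\<exists>N. \<forall>i\<ge>N. \<forall>j\<ge>N. LINT p|lborel. norm (S i p - S j p) < e" if "e > 0" for e
  proof -
    have "0 < e / (K + 1)" using that K by simp
    from cauchy[OF this] obtain N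
      where N: "\<And>m n. m \<ge> N \<Longrightarrow> n \<ge> N \<Longrightarrow> weighted_L2_norm s b (\<lambda>p. G m p - G n p) < e / (K + 1)"
      by blast
    have "(LINT p|lborel. norm (S i p - S j p)) < e" if "i \<ge> N" "j \<ge> N" for i j
    proof -
      have "(LINT p|lborel. norm (S i p - S j p)) \<le> K * weighted_L2_norm s b (\<lambda>p. G i p - G j p)"
        using L1(2)[OF weighted_L2_diff[OF G G], of i j] unfolding S_def by (simp only: right_diff_distrib)
      also have "\<dots> \<le> K * (e / (K + 1))" using N[OF that] K by (intro mult_left_mono) auto
      also have "\<dots> < e" using K \<open>e > 0\<close> by (simp add: field_simps)
      finally show ?thesis .
    qed
    then show ?thesis by blast
  qed
  have S_int: "integrable lborel (S n)" for n
    using L1(1)[OF G] by (simp add: S_def[abs_def])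
  obtain r where r: "strict_mono r" "AE p in lborel. Cauchy (\<lambda>i. S (r i) p)"
    by (rule cauchy_L1_AE_cauchy_subseq[OF S_int S_cauchy])
  define W where "W p = lim (\<lambda>i. G (r i) p)" for p
  have [measurable]: "W \<in> borel_measurable borel" unfolding W_def by (rule borel_measurable_lim_metric) measurable
  have limW: "AE p in lborel. (\<lambda>i. G (r i) p) \<longlonglongrightarrow> W p"
    using r(2)
  proof eventually_elim
    case (elim p)
    have "complex_of_real (\<phi> p * ?w p) \<noteq> 0" using \<phi>[of p] weight_pos[of s b p] by simp
    then have "(\<lambda>i. S (r i) p / complex_of_real (\<phi> p * ?w p)) = (\<lambda>i. G (r i) p)" by (simp add: S_def)
    moreover from elim obtain L where "(\<lambda>i. S (r i) p) \<longlonglongrightarrow> L"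
      by (auto simp: Cauchy_convergent_iff convergent_def)
    then have "convergent (\<lambda>i. S (r i) p / complex_of_real (\<phi> p * ?w p))"
      using tendsto_divide[OF _ tendsto_const] \<open>complex_of_real (\<phi> p * ?w p) \<noteq> 0\<close>
      by (intro convergentI)
    ultimately show ?case unfolding W_def by (simp add: convergent_LIMSEQ_iff)
  qed
  have close: "\<exists>N. \<forall>n\<ge>N. (\<lambda>p. G n p - W p) \<in> weighted_L2 s b \<and> weighted_L2_norm s b (\<lambda>p. G n p - W p) \<le> e" if e: "e > 0" for e
  proof -
    obtain N where N: "\<And>m n. m \<ge> N \<Longrightarrow> n \<ge> N \<Longrightarrow> weighted_L2_norm s b (\<lambda>p. G m p - G n p) < e"
      using cauchy[OF e] by blast
    have "(\<lambda>p. G n p - W p) \<in> weighted_L2 s b \<and> weighted_L2_norm s b (\<lambda>p. G n p - W p) \<le> e" if n: "n \<ge> N" for n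
    proof -
      have "(\<integral>\<^sup>+p. ennreal ((?w p * norm (G n p - W p))\<^sup>2) \<partial>lborel) =
        (\<integral>\<^sup>+p. liminf (\<lambda>i. ennreal ((?w p * norm (G n p - G (r i) p))\<^sup>2)) \<partial>lborel)"
        using limW
      proof (intro nn_integral_cong_AE, eventually_elim)
        case (elim p)
        have "(\<lambda>i. ennreal ((?w p * norm (G n p - G (r i) p))\<^sup>2)) \<longlonglongrightarrow> ennreal ((?w p * norm (G n p - W p))\<^sup>2)"
          by (intro tendsto_intros elim)
        from lim_imp_Liminf[OF _ this] show ?case by simp
      qed
      also have "\<dots> \<le> liminf (\<lambda>i. \<integral>\<^sup>+p. ennreal ((?w p * norm (G n p - G (r i) p))\<^sup>2) \<partial>lborel)"
        by (rule nn_integral_liminf) measurable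
      also have "\<dots> \<le> ennreal (e\<^sup>2)"
      proof (rule Liminf_le)
        show "\<forall>\<^sub>F i in sequentially. (\<integral>\<^sup>+p. ennreal ((?w p * norm (G n p - G (r i) p))\<^sup>2) \<partial>lborel) \<le> ennreal (e\<^sup>2)"
          using eventually_ge_at_top[of N]
        proof eventually_elim
          case (elim i)
          then have "N \<le> r i" using seq_suble[OF r(1), of i] by linarith
          from N[OF n this] have "(weighted_L2_norm s b (\<lambda>p. G n p - G (r i) p))\<^sup>2 \<le> e\<^sup>2"
            using weighted_L2_norm_nonneg by (intro power_mono) auto
          then show ?case by (simp add: weighted_L2_norm_nn[OF weighted_L2_diff[OF G G]] ennreal_leI)
        qed
      qed simp
      finally show ?thesis using weighted_L2_norm_le[of "\<lambda>p. G n p - W p" e s b] e by simp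
    qed
    then show ?thesis by blast
  qed
  show ?thesis
  proof (rule that)
    obtain n where "(\<lambda>p. G n p - W p) \<in> weighted_L2 s b" using close[of 1] by auto
    from weighted_L2_diff[OF G[of n] this] show "W \<in> weighted_L2 s b" by simp
    show "(\<lambda>n. weighted_L2_norm s b (\<lambda>p. G n p - W p)) \<longlonglongrightarrow> 0"
    proof (rule LIMSEQ_I)
      fix e :: real assume e: "e > 0"
      obtain N where N: "\<And>n. n \<ge> N \<Longrightarrow> weighted_L2_norm s b (\<lambda>p. G n p - W p) \<le> e/2" using close[of "e/2"] e by auto
      have "norm (weighted_L2_norm s b (\<lambda>p. G n p - W p) - 0) < e" if "n \<ge> N" for n
        using N[OF that] e weighted_L2_norm_nonneg[of s b "\<lambda>p. G n p - W p"] by simp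
      then show "\<exists>N. \<forall>n\<ge>N. norm (weighted_L2_norm s b (\<lambda>p. G n p - W p) - 0) < e" by blast
    qed
  qed
qed

section \<open>Gaussians\<close>

text \<open>Polynomials times a modulated Gaussian form a class closed under differentiation, so all
  derivatives of such functions are explicit.\<close>

definition poly_gauss :: "complex poly \<Rightarrow> real \<Rightarrow> real \<Rightarrow> real \<Rightarrow> complex" where
  "poly_gauss P w l t = poly P (complex_of_real t) * exp (\<i> * complex_of_real (w * t) - complex_of_real (l * t\<^sup>2))"

definition poly_gauss_deriv :: "real \<Rightarrow> real \<Rightarrow> complex poly \<Rightarrow> complex poly" where
  "poly_gauss_deriv w l P = pderiv P + [:\<i> * complex_of_real w, - complex_of_real (2 * l):] * P"

lemma has_vector_derivative_poly_gauss:
  "(poly_gauss P w l has_vector_derivative poly_gauss (poly_gauss_deriv w l P) w l t) (at t)"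
proof -
  let ?e = "\<lambda>z. exp (\<i> * (complex_of_real w * z) - complex_of_real l * z\<^sup>2)"
  have "((\<lambda>z. poly P z * ?e z) has_field_derivative poly (poly_gauss_deriv w l P) (complex_of_real t) * ?e (complex_of_real t)) (at (complex_of_real t))"
    by (auto intro!: derivative_eq_intros simp: poly_gauss_deriv_def algebra_simps)
  from has_vector_derivative_real_field[OF this] show ?thesis
    by (simp add: poly_gauss_def[abs_def])
qed

text \<open>From \<open>exp u \<ge> (u/k)\<^sup>k\<close> for \<open>u = l t\<^sup>2\<close>. Taking \<open>k = j + 1\<close> keeps the division by k meaningful
  for \<open>j = 0\<close>.\<close>

lemma gauss_decay:
  assumes "l > 0"
  shows "\<exists>M. \<forall>t::real. \<bar>t\<bar> ^ j * exp (- (l * t\<^sup>2)) \<le> M"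
proof -
  define k where "k = Suc j"
  have "\<bar>t\<bar> ^ j * exp (- (l * t\<^sup>2)) \<le> 1 + (real k / l) ^ k" for t
  proof -
    have e: "exp (- (l * t\<^sup>2)) \<le> 1" using assms by simp
    have "(l * t\<^sup>2 / real k) ^ k \<le> (1 + l * t\<^sup>2 / real k) ^ k" using assms by (intro power_mono) auto
    also have "\<dots> \<le> exp (l * t\<^sup>2)"
      by (rule exp_ge_one_plus_x_over_n_power_n) (use assms in \<open>auto simp: k_def intro: order_trans[of _ 0]\<close>)
    finally have "(l / real k) ^ k * (t\<^sup>2) ^ k \<le> exp (l * t\<^sup>2)"
      by (simp add: power_mult_distrib[symmetric])
    then have "(t\<^sup>2) ^ k * exp (- (l * t\<^sup>2)) \<le> (real k / l) ^ k"
      using assms by (simp add: exp_minus power_divide field_simps k_def del: power_Suc)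
    moreover have "\<bar>t\<bar> ^ j * exp (- (l * t\<^sup>2)) \<le> exp (- (l * t\<^sup>2)) + (t\<^sup>2) ^ k * exp (- (l * t\<^sup>2))"
    proof -
      have "\<bar>t\<bar> ^ j \<le> 1 + (t\<^sup>2) ^ k"
      proof (cases "\<bar>t\<bar> \<le> 1")
        case True
        then show ?thesis by (intro order_trans[OF power_le_one]) auto
      next
        case False
        have "\<bar>t\<bar> ^ j \<le> \<bar>t\<bar> ^ (2 * k)" using False by (intro power_increasing) (auto simp: k_def)
        then show ?thesis by (simp add: power_mult)
      qed
      then have "\<bar>t\<bar> ^ j * exp (- (l * t\<^sup>2)) \<le> (1 + (t\<^sup>2) ^ k) * exp (- (l * t\<^sup>2))" by (intro mult_right_mono) auto
      then show ?thesis by (simp add: distrib_right)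
    qed
    ultimately show ?thesis using e by linarith
  qed
  then show ?thesis by blast
qed

lemma poly_gauss_decay:
  assumes "l > 0"
  shows "\<exists>M. \<forall>t. \<bar>t\<bar> ^ j * norm (poly_gauss P w l t) \<le> M"
proof (induction P arbitrary: j)
  case 0
  then show ?case by (auto simp: poly_gauss_def)
next
  case (pCons a P)
  obtain M where M: "\<And>t. \<bar>t\<bar> ^ Suc j * norm (poly_gauss P w l t) \<le> M" using pCons by blast
  obtain N where N: "\<And>t. \<bar>t\<bar> ^ j * exp (- (l * t\<^sup>2)) \<le> N" using gauss_decay[OF assms] by blast
  have "\<bar>t\<bar> ^ j * norm (poly_gauss (pCons a P) w l t) \<le> norm a * N + M" for t
  proof -
    let ?E = "exp (\<i> * complex_of_real (w * t) - complex_of_real (l * t\<^sup>2))"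
    have "norm ?E = exp (- (l * t\<^sup>2))" by simp
    then have "norm (a * ?E) = norm a * exp (- (l * t\<^sup>2))" by (simp only: norm_mult)
    moreover have "poly_gauss (pCons a P) w l t = a * ?E + complex_of_real t * poly_gauss P w l t"
      by (simp add: poly_gauss_def distrib_right mult.assoc)
    ultimately have "norm (poly_gauss (pCons a P) w l t) \<le> norm a * exp (- (l * t\<^sup>2)) + \<bar>t\<bar> * norm (poly_gauss P w l t)"
      using norm_triangle_ineq[of "a * ?E" "complex_of_real t * poly_gauss P w l t"]
      by (simp only: norm_mult norm_of_real)
    then have "\<bar>t\<bar> ^ j * norm (poly_gauss (pCons a P) w l t) \<le> \<bar>t\<bar> ^ j * (norm a * exp (- (l * t\<^sup>2)) + \<bar>t\<bar> * norm (poly_gauss P w l t))"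
      by (intro mult_left_mono) auto
    also have "\<dots> = norm a * (\<bar>t\<bar> ^ j * exp (- (l * t\<^sup>2))) + \<bar>t\<bar> ^ Suc j * norm (poly_gauss P w l t)"
      by (simp add: algebra_simps)
    also have "\<dots> \<le> norm a * N + M" by (intro add_mono mult_left_mono M N) auto
    finally show ?thesis .
  qed
  then show ?case by blast
qed

definition tensor_gauss :: "complex poly \<Rightarrow> complex poly \<Rightarrow> real \<Rightarrow> real \<Rightarrow> real \<Rightarrow> real \<Rightarrow> real \<times> real \<Rightarrow> complex" where
  "tensor_gauss P Q w l w' l' = (\<lambda>(t, x). poly_gauss P w l t * poly_gauss Q w' l' x)"

lemma partials_tensor_gauss:
  "partials m n (tensor_gauss P Q w l w' l') =
     tensor_gauss ((poly_gauss_deriv w l ^^ m) P) ((poly_gauss_deriv w' l' ^^ n) Q) w l w' l'"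
proof (induction m)
  case 0
  show ?case
  proof (induction n)
    case (Suc n)
    show ?case unfolding partials_simps Suc
      by (rule partial_x_eqI)
         (auto simp: tensor_gauss_def intro!: has_vector_derivative_mult_right has_vector_derivative_poly_gauss)
  qed (simp add: partials_simps)
next
  case (Suc m)
  show ?case unfolding partials_simps Suc
    by (rule partial_t_eqI)
       (auto simp: tensor_gauss_def intro!: has_vector_derivative_mult_left has_vector_derivative_poly_gauss)
qed

lemma differentiable_poly_gauss: "poly_gauss P w l differentiable (at t)"
  using has_vector_derivative_poly_gauss by (rule differentiableI_vector)

lemma schwartz_tensor_gauss:
  assumes "l > 0" "l' > 0"
  shows "schwartz (tensor_gauss P Q w l w' l')"
  unfolding schwartz_iff partials_tensor_gauss
proof (intro conjI allI)
  fix m n and p :: "real \<times> real"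
  have "(\<lambda>q. poly_gauss R w l (fst q)) differentiable (at p)" for R w l
    using differentiable_chain_at[OF _ differentiable_poly_gauss, of fst p R w l]
    by (simp add: o_def linear_imp_differentiable linear_fst)
  moreover have "(\<lambda>q. poly_gauss R w l (snd q)) differentiable (at p)" for R w l
    using differentiable_chain_at[OF _ differentiable_poly_gauss, of snd p R w l]
    by (simp add: o_def linear_imp_differentiable linear_snd)
  ultimately show "tensor_gauss ((poly_gauss_deriv w l ^^ m) P) ((poly_gauss_deriv w' l' ^^ n) Q) w l w' l' differentiable at p"
    unfolding tensor_gauss_def split_beta' by (intro differentiable_mult)
next
  fix j k m n
  let ?f = "poly_gauss ((poly_gauss_deriv w l ^^ m) P) w l" and ?g = "poly_gauss ((poly_gauss_deriv w' l' ^^ n) Q) w' l'"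
  obtain M where M: "\<And>t. \<bar>t\<bar> ^ j * norm (?f t) \<le> M" using poly_gauss_decay[OF assms(1)] by blast
  obtain N where N: "\<And>t. \<bar>t\<bar> ^ k * norm (?g t) \<le> N" using poly_gauss_decay[OF assms(2)] by blast
  have "(\<bar>t\<bar> ^ j * norm (?f t)) * (\<bar>x\<bar> ^ k * norm (?g x)) \<le> M * N" for t x
    using M[of t] by (intro mult_mono M N order_trans[OF _ M[of t]]) auto
  then show "\<exists>M. \<forall>t x. \<bar>t\<bar> ^ j * \<bar>x\<bar> ^ k * norm (tensor_gauss ((poly_gauss_deriv w l ^^ m) P) ((poly_gauss_deriv w' l' ^^ n) Q) w l w' l' (t, x)) \<le> M"
    by (auto simp: tensor_gauss_def norm_mult mult_ac)
qed

text \<open>The characteristic function of the normal distribution, rescaled by \<open>t = x / sqrt (2 l)\<close>.\<close>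

lemma integral_gauss:
  assumes l: "l > 0"
  shows "(LINT t|lborel. exp (\<i> * complex_of_real (v * t)) * complex_of_real (exp (- (l * t\<^sup>2)))) =
    complex_of_real (sqrt (pi / l) * exp (- (v\<^sup>2 / (4 * l))))"
proof -
  define r where "r = 1 / sqrt (2 * l)"
  have r: "r > 0" "r\<^sup>2 = 1 / (2 * l)" using l by (auto simp: r_def power_divide)
  have "complex_of_real (exp (- ((v * r)\<^sup>2) / 2)) = char std_normal_distribution (v * r)"
    by (simp add: char_std_normal_distribution)
  also have "\<dots> = (LINT x|lborel. std_normal_density x *\<^sub>R iexp ((v * r) * x))"
    unfolding char_def by (subst integral_density) auto
  also have "\<dots> = (LINT x|lborel. complex_of_real (1 / sqrt (2 * pi)) * (exp (\<i> * complex_of_real (v * (r * x))) * complex_of_real (exp (- (l * (r * x)\<^sup>2)))))"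
  proof -
    have "l * (r * x)\<^sup>2 = x\<^sup>2 / 2" for x using l r(2) by (simp add: power_mult_distrib)
    then show ?thesis
      by (intro Bochner_Integration.integral_cong refl) (simp add: std_normal_density_def scaleR_conv_of_real mult_ac)
  qed
  also have "\<dots> = complex_of_real (1 / sqrt (2 * pi)) * (LINT x|lborel. exp (\<i> * complex_of_real (v * (r * x))) * complex_of_real (exp (- (l * (r * x)\<^sup>2))))"
    by (rule integral_mult_right_zero)
  also have "(LINT x|lborel. exp (\<i> * complex_of_real (v * (r * x))) * complex_of_real (exp (- (l * (r * x)\<^sup>2)))) =
     (1 / r) *\<^sub>R (LINT t|lborel. exp (\<i> * complex_of_real (v * t)) * complex_of_real (exp (- (l * t\<^sup>2))))"
    using lborel_integral_real_affine[of r "\<lambda>t. exp (\<i> * complex_of_real (v * t)) * complex_of_real (exp (- (l * t\<^sup>2)))" 0] r(1)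
    by simp
  finally have "(LINT t|lborel. exp (\<i> * complex_of_real (v * t)) * complex_of_real (exp (- (l * t\<^sup>2)))) =
     complex_of_real (sqrt (2 * pi) * r * exp (- ((v * r)\<^sup>2) / 2))"
    using r(1) by (simp add: scaleR_conv_of_real field_simps)
  also have "sqrt (2 * pi) * r = sqrt (pi / l)" using l by (simp add: r_def real_sqrt_mult real_sqrt_divide)
  also have "- ((v * r)\<^sup>2) / 2 = - (v\<^sup>2 / (4 * l))" using r(2) by (simp add: power_mult_distrib)
  finally show ?thesis .
qed

definition gauss :: "real \<Rightarrow> real \<Rightarrow> real \<Rightarrow> real" where
  "gauss k m \<tau> = exp (- (k * (\<tau> - m)\<^sup>2))"

lemma fourier_tensor_gauss:
  assumes "l > 0" "l' > 0"
  shows "fourier (tensor_gauss 1 1 w l w' l') (\<tau>, \<xi>) =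
    complex_of_real (sqrt (pi / l) * sqrt (pi / l')) * complex_of_real (gauss (1 / (4 * l)) w \<tau> * gauss (1 / (4 * l')) w' \<xi>)"
proof -
  let ?f = "\<lambda>w l \<tau> t. exp (\<i> * complex_of_real ((w - \<tau>) * t)) * complex_of_real (exp (- (l * t\<^sup>2)))"
  have eq: "phase (\<tau>, \<xi>) (t, x) * tensor_gauss 1 1 w l w' l' (t, x) = ?f w l \<tau> t * ?f w' l' \<xi> x" for t x
    by (simp add: phase_def tensor_gauss_def poly_gauss_def exp_of_real[symmetric] mult_exp_exp algebra_simps)
  have "integrable lborel (\<lambda>q. phase (\<tau>, \<xi>) q * tensor_gauss 1 1 w l w' l' q)"
    using integrable_phase_partials[OF schwartz_tensor_gauss[OF assms], of _ 0 0] by (simp add: partials_simps)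
  then have "fourier (tensor_gauss 1 1 w l w' l') (\<tau>, \<xi>) = (LINT x|lborel. LINT t|lborel. ?f w l \<tau> t * ?f w' l' \<xi> x)"
    unfolding fourier_eq eq[symmetric]
    by (subst lborel_pair.integral_snd) (simp_all add: lborel_prod split_beta')
  also have "\<dots> = (LINT t|lborel. ?f w l \<tau> t) * (LINT x|lborel. ?f w' l' \<xi> x)"
    by (simp only: integral_mult_left_zero integral_mult_right_zero)
  finally show ?thesis
    unfolding integral_gauss[OF assms(1)] integral_gauss[OF assms(2)]
    by (simp add: gauss_def power2_commute[of w] power2_commute[of w'])
qed

section \<open>Density of the transforms of Schwartz functions\<close>

text \<open>The closure of the transforms of Schwartz functions in the weighted space.\<close>

definition fourier_approximable :: "real \<Rightarrow> real \<Rightarrow> (real \<times> real \<Rightarrow> complex) \<Rightarrow> bool" where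
  "fourier_approximable s b W \<longleftrightarrow> W \<in> weighted_L2 s b \<and>
     (\<forall>e>0. \<exists>F. schwartz F \<and> weighted_L2_norm s b (\<lambda>p. fourier F p - W p) < e)"

lemma fourier_approximable_closed:
  assumes W: "W \<in> weighted_L2 s b"
    and approx: "\<And>e. e > 0 \<Longrightarrow> \<exists>V. fourier_approximable s b V \<and> weighted_L2_norm s b (\<lambda>p. V p - W p) < e"
  shows "fourier_approximable s b W"
  unfolding fourier_approximable_def
proof (intro conjI allI impI W)
  fix e :: real assume "e > 0"
  then obtain V where V: "fourier_approximable s b V" "weighted_L2_norm s b (\<lambda>p. V p - W p) < e / 2"
    using approx[of "e/2"] by auto
  moreover obtain F where F: "schwartz F" "weighted_L2_norm s b (\<lambda>p. fourier F p - V p) < e / 2"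
    using V(1) \<open>e > 0\<close> unfolding fourier_approximable_def by (meson half_gt_zero)
  moreover have "V \<in> weighted_L2 s b" using V(1) by (simp add: fourier_approximable_def)
  ultimately show "\<exists>F. schwartz F \<and> weighted_L2_norm s b (\<lambda>p. fourier F p - W p) < e"
    using weighted_L2_triangle[OF fourier_in_weighted_L2[OF F(1)] _ W, of V]
    by (intro exI[of _ F]) auto
qed

lemma fourier_approximable_LIMSEQ:
  assumes "\<And>n. fourier_approximable s b (G n)" "W \<in> weighted_L2 s b"
    and lim: "(\<lambda>n. weighted_L2_norm s b (\<lambda>p. G n p - W p)) \<longlonglongrightarrow> 0"
  shows "fourier_approximable s b W"
proof (rule fourier_approximable_closed[OF assms(2)])
  fix e :: real assume "e > 0"
  then have "\<forall>\<^sub>F n in sequentially. weighted_L2_norm s b (\<lambda>p. G n p - W p) < e"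
    using lim by (rule order_tendstoD(2)[rotated])
  then show "\<exists>V. fourier_approximable s b V \<and> weighted_L2_norm s b (\<lambda>p. V p - W p) < e"
    using assms(1) unfolding eventually_sequentially by blast
qed

lemma fourier_approximable_dominated:
  assumes G: "\<And>n. fourier_approximable s b (G n)" and lim: "\<And>p. (\<lambda>n. G n p) \<longlonglongrightarrow> W p"
    and D: "D \<in> weighted_L2 s b" "\<And>n p. norm (G n p) \<le> norm (D p)"
  shows "fourier_approximable s b W"
proof -
  have meas: "G n \<in> borel_measurable borel" for n
    using G[of n] by (auto simp: fourier_approximable_def intro: weighted_L2_measurable)
  show ?thesis
    using weighted_L2_dominated[OF meas lim D] by (intro fourier_approximable_LIMSEQ[OF G])
qed

lemma fourier_approximable_fourier: "schwartz F \<Longrightarrow> fourier_approximable s b (fourier F)"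
  unfolding fourier_approximable_def
  by (auto simp: fourier_in_weighted_L2 weighted_L2_norm_def intro!: exI[of _ F])

lemma fourier_approximable_lincomb:
  assumes V: "fourier_approximable s b V" and W: "fourier_approximable s b W"
  shows "fourier_approximable s b (\<lambda>p. c * V p + d * W p)"
  unfolding fourier_approximable_def
proof (intro conjI allI impI)
  have L2: "V \<in> weighted_L2 s b" "W \<in> weighted_L2 s b" using V W by (auto simp: fourier_approximable_def)
  then show "(\<lambda>p. c * V p + d * W p) \<in> weighted_L2 s b"
    by (intro weighted_L2_add weighted_L2_scale)
  fix e :: real assume e: "e > 0"
  define k where "k = 1 + norm c + norm d"
  have k: "k \<ge> 1" by (simp add: k_def)
  have ek: "e / k > 0" using e k by simp
  obtain F where F: "schwartz F" "weighted_L2_norm s b (\<lambda>p. fourier F p - V p) < e / k"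
    using V ek unfolding fourier_approximable_def by meson
  obtain G where G: "schwartz G" "weighted_L2_norm s b (\<lambda>p. fourier G p - W p) < e / k"
    using W ek unfolding fourier_approximable_def by meson
  have *: "fourier (\<lambda>p. c * F p + d * G p) p - (c * V p + d * W p) = c * (fourier F p - V p) + d * (fourier G p - W p)" for p
    by (simp add: fourier_lincomb[OF F(1) G(1)] algebra_simps)
  have FV: "(\<lambda>p. fourier F p - V p) \<in> weighted_L2 s b" and GW: "(\<lambda>p. fourier G p - W p) \<in> weighted_L2 s b"
    using L2 F(1) G(1) by (auto intro: weighted_L2_diff fourier_in_weighted_L2)
  have "weighted_L2_norm s b (\<lambda>p. fourier (\<lambda>p. c * F p + d * G p) p - (c * V p + d * W p)) \<le>
    norm c * weighted_L2_norm s b (\<lambda>p. fourier F p - V p) + norm d * weighted_L2_norm s b (\<lambda>p. fourier G p - W p)"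
    unfolding * using weighted_L2_add(2)[OF weighted_L2_scale(1)[OF FV, of c] weighted_L2_scale(1)[OF GW, of d]]
    by (simp add: weighted_L2_scale(2)[OF FV] weighted_L2_scale(2)[OF GW])
  also have "\<dots> \<le> norm c * (e / k) + norm d * (e / k)"
    using F(2) G(2) by (intro add_mono mult_left_mono) auto
  also have "\<dots> = (norm c + norm d) * (e / k)" by (rule distrib_right[symmetric])
  also have "\<dots> = (e / k) * (k - 1)" by (simp add: k_def mult.commute)
  also have "\<dots> < (e / k) * k" using ek by (intro mult_strict_left_mono) auto
  also have "\<dots> = e" using k by simp
  finally show "\<exists>F. schwartz F \<and> weighted_L2_norm s b (\<lambda>p. fourier F p - (c * V p + d * W p)) < e"
    using schwartz_lincomb[OF F(1) G(1)] by blast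
qed

lemma fourier_approximable_0: "fourier_approximable s b (\<lambda>p. 0)"
proof -
  let ?F = "tensor_gauss 1 1 0 1 0 1"
  have "fourier_approximable s b (fourier ?F)" by (intro fourier_approximable_fourier schwartz_tensor_gauss) auto
  from fourier_approximable_lincomb[OF this this, of 0 0] show ?thesis by simp
qed

lemma fourier_approximable_sum:
  assumes "\<And>i. i \<in> A \<Longrightarrow> fourier_approximable s b (f i)"
  shows "fourier_approximable s b (\<lambda>p. \<Sum>i\<in>A. c i * f i p)"
  using assms
proof (induction A rule: infinite_finite_induct)
  case (insert i A)
  have "fourier_approximable s b (\<lambda>p. c i * f i p + 1 * (\<Sum>i\<in>A. c i * f i p))"
    using insert by (intro fourier_approximable_lincomb) auto
  then show ?case using insert by simp
qed (simp_all add: fourier_approximable_0)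

lemma fourier_approximable_gauss:
  assumes "k > 0" "k' > 0"
  shows "fourier_approximable s b (\<lambda>p. complex_of_real (gauss k m (fst p) * gauss k' m' (snd p)))"
proof -
  define l l' where "l = 1 / (4 * k)" and "l' = 1 / (4 * k')"
  have l: "l > 0" "l' > 0" "1 / (4 * l) = k" "1 / (4 * l') = k'" using assms by (simp_all add: l_def l'_def)
  let ?F = "tensor_gauss 1 1 m l m' l'" and ?c = "complex_of_real (sqrt (pi / l) * sqrt (pi / l'))"
  have c: "?c \<noteq> 0" using l by simp
  have "fourier ?F p = ?c * complex_of_real (gauss k m (fst p) * gauss k' m' (snd p))" for p
    using fourier_tensor_gauss[OF l(1,2), of m m' "fst p" "snd p"] by (simp add: l)
  then have "complex_of_real (gauss k m (fst p) * gauss k' m' (snd p)) = (1 / ?c) * fourier ?F p + 0 * fourier ?F p" for p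
    using c by simp
  moreover have "fourier_approximable s b (fourier ?F)" using l by (intro fourier_approximable_fourier schwartz_tensor_gauss)
  ultimately show ?thesis using fourier_approximable_lincomb[of s b "fourier ?F" "fourier ?F" "1 / ?c" 0] by presburger
qed

text \<open>As a polynomial in \<open>h\<close> this has no constant term, so for a Gaussian \<open>h\<close> it is a linear
  combination of Gaussians. It is close to \<open>1 - exp (- n (2 h)\<^sup>n)\<close>, and the exponent tends to 0 for
  \<open>h < 1/2\<close> and to infinity for \<open>h \<ge> 1/2\<close>; the factor n in \<open>n 2\<^sup>n\<close> decides the case \<open>h = 1/2\<close>.\<close>

definition bump :: "nat \<Rightarrow> real \<Rightarrow> real" where
  "bump n h = 1 - (1 - h ^ n) ^ (n * 2 ^ n)"

text \<open>The last bound, uniform in n, provides a Gaussian majorant for dominated convergence. It follows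
  from the third one for \<open>h < 1/4\<close> and from the second one otherwise.\<close>

lemma bump_bounds:
  assumes "0 \<le> h" "h \<le> 1"
  shows "0 \<le> bump n h" "bump n h \<le> 1" "bump n h \<le> real n * (2 * h) ^ n" "bump n h \<le> 4 * h"
proof -
  have h: "0 \<le> 1 - h ^ n" "1 - h ^ n \<le> 1" using assms by (auto simp: power_le_one)
  then show "0 \<le> bump n h" "bump n h \<le> 1" by (auto simp: bump_def power_le_one)
  have "1 + real (n * 2 ^ n) * (- (h ^ n)) \<le> (1 + - (h ^ n)) ^ (n * 2 ^ n)"
    using h by (intro Bernoulli_inequality) auto
  then show le: "bump n h \<le> real n * (2 * h) ^ n" by (simp add: bump_def power_mult_distrib algebra_simps)
  show "bump n h \<le> 4 * h"
  proof (cases "h \<ge> 1/4")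
    case True
    then show ?thesis using \<open>bump n h \<le> 1\<close> by simp
  next
    case False
    show ?thesis
    proof (cases n)
      case 0
      then show ?thesis using assms by (simp add: bump_def)
    next
      case (Suc k)
      have "real n * (2 * h) ^ n = (real n * (2 * h) ^ k) * (2 * h)" by (simp add: Suc)
      also have "\<dots> \<le> (2 ^ k * (1/2) ^ k) * (2 * h)"
      proof (intro mult_right_mono mult_mono)
        have "Suc k \<le> 2 ^ k" by (simp add: Suc_leI)
        then show "real n \<le> 2 ^ k" unfolding Suc by (metis of_nat_le_iff of_nat_numeral of_nat_power)
        show "(2 * h) ^ k \<le> (1/2) ^ k" using False assms by (intro power_mono) auto
      qed (use assms in auto)
      also have "\<dots> = 2 * h" by (simp flip: power_mult_distrib)
      finally show ?thesis using le assms by linarith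
    qed
  qed
qed

lemma bump_LIMSEQ:
  assumes "0 \<le> h" "h \<le> 1"
  shows "(\<lambda>n. bump n h) \<longlonglongrightarrow> (if h \<ge> 1/2 then 1 else 0)"
proof (cases "h \<ge> 1/2")
  case True
  have le: "(1 - h ^ n) ^ (n * 2 ^ n) \<le> exp (- real n)" for n
  proof -
    have "(1 - h ^ n) ^ (n * 2 ^ n) \<le> exp (- (h ^ n)) ^ (n * 2 ^ n)"
      using assms exp_ge_add_one_self[of "- (h ^ n)"] by (intro power_mono) (auto simp: power_le_one)
    also have "\<dots> = exp (real (n * 2 ^ n) * (- (h ^ n)))" by (rule exp_of_nat_mult[symmetric])
    also have "real (n * 2 ^ n) * (- (h ^ n)) = - (real n * (2 * h) ^ n)" by (simp add: power_mult_distrib)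
    also have "exp (- (real n * (2 * h) ^ n)) \<le> exp (- real n)"
    proof -
      have "1 \<le> (2 * h) ^ n" using True by (intro one_le_power) auto
      then have "real n * 1 \<le> real n * (2 * h) ^ n" by (intro mult_left_mono) auto
      then show ?thesis by simp
    qed
    finally show ?thesis .
  qed
  have "(\<lambda>n. exp (- real n)) \<longlonglongrightarrow> 0" by real_asymp
  then have "(\<lambda>n. (1 - h ^ n) ^ (n * 2 ^ n)) \<longlonglongrightarrow> 0"
  proof (rule Lim_null_comparison[rotated], intro always_eventually allI)
    fix n
    have "0 \<le> (1 - h ^ n) ^ (n * 2 ^ n)" using power_le_one[OF assms, of n] by (intro zero_le_power) simp
    then show "norm ((1 - h ^ n) ^ (n * 2 ^ n)) \<le> exp (- real n)" using le[of n] by (simp only: real_norm_def abs_of_nonneg)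
  qed
  then have "(\<lambda>n. bump n h) \<longlonglongrightarrow> 1 - 0" unfolding bump_def by (intro tendsto_intros)
  then show ?thesis using True by simp
next
  case False
  have "(\<lambda>n. real n * (2 * h) ^ n) \<longlonglongrightarrow> 0"
    using False assms by (intro powser_times_n_limit_0) auto
  then have "(\<lambda>n. bump n h) \<longlonglongrightarrow> 0"
  proof (rule Lim_null_comparison[rotated], intro always_eventually allI)
    show "norm (bump n h) \<le> real n * (2 * h) ^ n" for n
      using bump_bounds(1,3)[OF assms, of n] by (simp only: real_norm_def abs_of_nonneg)
  qed
  then show ?thesis using False by simp
qed

lemma gauss_power: "gauss k m x ^ n = gauss (real n * k) m x"
  by (simp add: gauss_def exp_of_nat_mult[symmetric])

lemma gauss_bounds: "k > 0 \<Longrightarrow> 0 \<le> gauss k m x" "k > 0 \<Longrightarrow> gauss k m x \<le> 1"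
  by (simp_all add: gauss_def)

text \<open>The term of index 0 in the binomial expansion is 1 and cancels.\<close>

lemma bump_gauss_expand:
  "bump n (gauss k m x) = (\<Sum>j\<in>{1..n * 2 ^ n}. - (real ((n * 2 ^ n) choose j) * (-1) ^ j) * gauss (real (n * j) * k) m x)"
proof -
  let ?N = "n * 2 ^ n"
  have "(1 - gauss k m x ^ n) ^ ?N = (\<Sum>j\<le>?N. real (?N choose j) * (- (gauss k m x ^ n)) ^ j)"
    using binomial_ring[of "- (gauss k m x ^ n)" 1 ?N] by simp
  also have "\<dots> = (\<Sum>j\<le>?N. (real (?N choose j) * (-1) ^ j) * gauss (real (n * j) * k) m x)"
  proof (intro sum.cong refl)
    fix j
    have "(- (gauss k m x ^ n)) ^ j = (-1) ^ j * (gauss k m x ^ n) ^ j" by (rule power_minus)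
    also have "(gauss k m x ^ n) ^ j = gauss (real (n * j) * k) m x" by (simp add: gauss_power mult_ac)
    finally show "real (?N choose j) * (- (gauss k m x ^ n)) ^ j = (real (?N choose j) * (-1) ^ j) * gauss (real (n * j) * k) m x"
      by simp
  qed
  also have "{..?N} = insert 0 {1..?N}" by auto
  also have "(\<Sum>j\<in>insert 0 {1..?N}. (real (?N choose j) * (-1) ^ j) * gauss (real (n * j) * k) m x) =
     1 + (\<Sum>j\<in>{1..?N}. (real (?N choose j) * (-1) ^ j) * gauss (real (n * j) * k) m x)"
    by (subst sum.insert) (auto simp: gauss_def)
  finally show ?thesis by (simp add: bump_def sum_negf)
qed

lemma fourier_approximable_bump:
  assumes "k > 0" "k' > 0"
  shows "fourier_approximable s b (\<lambda>p. complex_of_real (bump n (gauss k m (fst p)) * bump n (gauss k' m' (snd p))))"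
proof (cases "n = 0")
  case True
  then show ?thesis using fourier_approximable_0 by (simp add: bump_def)
next
  case False
  let ?N = "n * 2 ^ n"
  let ?c = "\<lambda>j. - (real (?N choose j) * (-1) ^ j)"
  let ?g = "\<lambda>i p. complex_of_real (gauss (real (n * fst i) * k) m (fst p) * gauss (real (n * snd i) * k') m' (snd p))"
  have "complex_of_real (bump n (gauss k m (fst p)) * bump n (gauss k' m' (snd p))) =
    (\<Sum>i\<in>{1..?N} \<times> {1..?N}. complex_of_real (?c (fst i) * ?c (snd i)) * ?g i p)" for p
    unfolding bump_gauss_expand sum_product sum.cartesian_product
    by (simp add: split_beta' mult_ac)
  moreover have "fourier_approximable s b (\<lambda>p. \<Sum>i\<in>{1..?N} \<times> {1..?N}. complex_of_real (?c (fst i) * ?c (snd i)) * ?g i p)"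
    using False assms by (intro fourier_approximable_sum fourier_approximable_gauss) auto
  ultimately show ?thesis by presburger
qed

text \<open>A Gaussian whose value is \<open>1/2\<close> exactly at distance r from its centre turns the bump into an
  approximate indicator of an interval. In two variables take products.\<close>

lemma fourier_approximable_closed_box:
  assumes "r > 0" "r' > 0"
  shows "fourier_approximable s b (\<lambda>p. of_bool (\<bar>fst p - m\<bar> \<le> r \<and> \<bar>snd p - m'\<bar> \<le> r'))"
proof -
  define k k' where "k = ln 2 / r\<^sup>2" and "k' = ln 2 / r'\<^sup>2"
  have k: "k > 0" "k' > 0" using assms by (auto simp: k_def k'_def)
  have half: "gauss (ln 2 / \<rho>\<^sup>2) y x \<ge> 1/2 \<longleftrightarrow> \<bar>x - y\<bar> \<le> \<rho>" if "\<rho> > 0" for \<rho> x y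
  proof -
    have "gauss (ln 2 / \<rho>\<^sup>2) y x \<ge> 1/2 \<longleftrightarrow> - ln 2 \<le> - (ln 2 / \<rho>\<^sup>2 * (x - y)\<^sup>2)"
    proof -
      have "(1/2 :: real) = exp (- ln 2)" by (simp add: exp_minus)
      then show ?thesis unfolding gauss_def by (simp only: exp_le_cancel_iff)
    qed
    also have "\<dots> \<longleftrightarrow> (x - y)\<^sup>2 \<le> \<rho>\<^sup>2" using that by (simp add: field_simps)
    also have "\<dots> \<longleftrightarrow> \<bar>x - y\<bar> \<le> \<rho>" using that abs_le_square_iff[of "x - y" \<rho>] by simp
    finally show ?thesis .
  qed
  let ?f = "\<lambda>p. gauss k m (fst p)" and ?g = "\<lambda>p. gauss k' m' (snd p)"
  show ?thesis
  proof (rule fourier_approximable_dominated)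
    show "fourier_approximable s b (\<lambda>p. complex_of_real (bump n (?f p) * bump n (?g p)))" for n
      by (rule fourier_approximable_bump[OF k])
    show "(\<lambda>n. complex_of_real (bump n (?f p) * bump n (?g p))) \<longlonglongrightarrow> of_bool (\<bar>fst p - m\<bar> \<le> r \<and> \<bar>snd p - m'\<bar> \<le> r')" for p
    proof -
      have "(\<lambda>n. complex_of_real (bump n (?f p) * bump n (?g p))) \<longlonglongrightarrow>
        complex_of_real ((if ?f p \<ge> 1/2 then 1 else 0) * (if ?g p \<ge> 1/2 then 1 else 0))"
        using k by (intro tendsto_of_real tendsto_mult bump_LIMSEQ gauss_bounds)
      then show ?thesis unfolding k_def k'_def half[OF assms(1)] half[OF assms(2)] by (simp split: if_splits)
    qed
    show "(\<lambda>p. 16 * complex_of_real (?f p * ?g p)) \<in> weighted_L2 s b"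
      using fourier_approximable_gauss[OF k, of s b m m'] by (intro weighted_L2_scale) (simp add: fourier_approximable_def)
    show "norm (complex_of_real (bump n (?f p) * bump n (?g p))) \<le> norm (16 * complex_of_real (?f p * ?g p))" for n p
    proof -
      have "bump n (?f p) * bump n (?g p) \<le> (4 * ?f p) * (4 * ?g p)"
        using k by (intro mult_mono bump_bounds gauss_bounds) (auto simp: gauss_bounds)
      then show ?thesis
        using k bump_bounds(1)[of "?f p" n] bump_bounds(1)[of "?g p" n] gauss_bounds
        by (simp add: norm_mult abs_mult)
    qed
  qed
qed

text \<open>Open boxes generate the Borel sets and are closed under intersection. They are exhausted by closed ones, scaled by
  \<open>q n\<close> about the centre.\<close>

lemma fourier_approximable_open_box:
  "fourier_approximable s b (indicator (box x y))"
proof (cases "box x y = {}")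
  case True
  then show ?thesis using fourier_approximable_0 by (simp add: indicator_def[abs_def])
next
  case False
  obtain x1 x2 y1 y2 where x: "x = (x1, x2)" and y: "y = (y1, y2)" by (cases x, cases y)
  have lt: "x1 < y1" "x2 < y2" using False by (auto simp: x y box_eq_empty Basis_prod_def)
  define m m' r r' where "m = (x1 + y1) / 2" and "m' = (x2 + y2) / 2" and "r = (y1 - x1) / 2" and "r' = (y2 - x2) / 2"
  have r: "r > 0" "r' > 0" using lt by (auto simp: r_def r'_def)
  have mem: "p \<in> box x y \<longleftrightarrow> \<bar>fst p - m\<bar> < r \<and> \<bar>snd p - m'\<bar> < r'" for p
    by (cases p) (auto simp: x y m_def m'_def r_def r'_def mem_box Basis_prod_def abs_if field_simps)
  define q where "q n = 1 - 1 / (real n + 2)" for n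
  have q: "0 < q n" "q n < 1" for n by (auto simp: q_def field_simps)
  have qlim: "q \<longlonglongrightarrow> 1" unfolding q_def by real_asymp
  have ev: "\<forall>\<^sub>F n in sequentially. (\<bar>z\<bar> \<le> \<rho> * q n) = (\<bar>z\<bar> < \<rho>)" if "\<rho> > 0" for z \<rho> :: real
  proof (cases "\<bar>z\<bar> < \<rho>")
    case True
    then have "\<bar>z\<bar> / \<rho> < 1" using that by simp
    from order_tendstoD(1)[OF qlim this] show ?thesis
      by eventually_elim (use True that in \<open>simp add: field_simps\<close>)
  next
    case False
    have "\<rho> * q n < \<rho>" for n using q(2)[of n] that by simp
    then have "\<not> \<bar>z\<bar> \<le> \<rho> * q n" for n using False by (meson le_less_trans)
    then show ?thesis using False by simp
  qed
  show ?thesis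
  proof (rule fourier_approximable_dominated)
    show "fourier_approximable s b (\<lambda>p. of_bool (\<bar>fst p - m\<bar> \<le> r * q n \<and> \<bar>snd p - m'\<bar> \<le> r' * q n))" for n
      using r q[of n] by (intro fourier_approximable_closed_box) auto
    show "(\<lambda>n. of_bool (\<bar>fst p - m\<bar> \<le> r * q n \<and> \<bar>snd p - m'\<bar> \<le> r' * q n)) \<longlonglongrightarrow> indicator (box x y) p" for p
      using ev[OF r(1), of "fst p - m"] ev[OF r(2), of "snd p - m'"]
      by (intro tendsto_eventually, eventually_elim) (auto simp: indicator_def mem)
    show "(\<lambda>p. of_bool (\<bar>fst p - m\<bar> \<le> r \<and> \<bar>snd p - m'\<bar> \<le> r')) \<in> weighted_L2 s b"
      using fourier_approximable_closed_box[OF r, of s b m m'] by (simp add: fourier_approximable_def)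
    show "norm (of_bool (\<bar>fst p - m\<bar> \<le> r * q n \<and> \<bar>snd p - m'\<bar> \<le> r' * q n) :: complex) \<le>
        norm (of_bool (\<bar>fst p - m\<bar> \<le> r \<and> \<bar>snd p - m'\<bar> \<le> r') :: complex)" for n p
    proof -
      have "r * q n \<le> r" "r' * q n \<le> r'" using r q[of n] by (auto intro: mult_left_le)
      then show ?thesis by auto
    qed
  qed
qed

text \<open>Dynkin's argument. Intersecting with a fixed box keeps complements and countable unions inside
  the weighted space.\<close>

lemma fourier_approximable_bounded_set:
  assumes A: "A \<in> sets borel"
  shows "fourier_approximable s b (indicator (A \<inter> box x y))"
proof -
  let ?G = "range (\<lambda>(a, b). box a b :: (real \<times> real) set)"
  have "A \<in> sigma_sets UNIV ?G" using A by (simp add: borel_eq_box)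
  then show ?thesis
  proof (induction rule: sigma_sets_induct_disjoint[rotated 2, consumes 1])
    case (1 A)
    then obtain a c where "A = box a c" by auto
    then show ?case using fourier_approximable_open_box by (simp add: box_Int_box)
  next
    case 2
    then show ?case using fourier_approximable_0 by (simp add: indicator_def[abs_def])
  next
    case (3 A)
    have "indicator ((UNIV - A) \<inter> box x y) = (\<lambda>p. 1 * indicator (box x y) p + (- 1) * indicator (A \<inter> box x y) p :: complex)"
      by (auto simp: indicator_def fun_eq_iff)
    then show ?case using fourier_approximable_lincomb[OF fourier_approximable_open_box 3(2)] by metis
  next
    case (4 A)
    show ?case
    proof (rule fourier_approximable_dominated)
      show "fourier_approximable s b (\<lambda>p. \<Sum>i\<in>{..<n}. 1 * indicator (A i \<inter> box x y) p)" for n :: nat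
        by (rule fourier_approximable_sum) (rule 4)
      have eq: "(\<Sum>i<n. 1 * indicator (A i \<inter> box x y) p :: complex) = indicator (\<Union>i<n. A i) p * indicator (box x y) p" for n p
        using 4(1) by (subst indicator_UN_disjoint) (auto simp: disjoint_family_on_def indicator_inter_arith sum_distrib_right)
      show "(\<lambda>n. \<Sum>i<n. 1 * indicator (A i \<inter> box x y) p :: complex) \<longlonglongrightarrow> indicator ((\<Union>i. A i) \<inter> box x y) p" for p
        unfolding eq unfolding indicator_inter_arith by (intro tendsto_intros LIMSEQ_indicator_UN)
      show "indicator (box x y) \<in> weighted_L2 s b"
        using fourier_approximable_open_box[of s b x y] by (simp add: fourier_approximable_def)
      show "norm (\<Sum>i<n. 1 * indicator (A i \<inter> box x y) p :: complex) \<le> norm (indicator (box x y) p :: complex)" for n p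
        unfolding eq by (auto simp: indicator_def)
    qed
  qed (auto simp: Int_stable_def box_Int_box)
qed

lemma fourier_approximable_indicator:
  assumes A: "indicator A \<in> weighted_L2 s b" "A \<in> sets borel"
  shows "fourier_approximable s b (indicator A)"
proof (rule fourier_approximable_dominated)
  let ?B = "\<lambda>n::nat. box (- (real n, real n)) (real n, real n)"
  show "fourier_approximable s b (indicator (A \<inter> ?B n))" for n
    by (rule fourier_approximable_bounded_set[OF A(2)])
  show "(\<lambda>n. indicator (A \<inter> ?B n) p :: complex) \<longlonglongrightarrow> indicator A p" for p
  proof (intro tendsto_eventually)
    obtain N :: nat where N: "\<bar>fst p\<bar> + \<bar>snd p\<bar> < real N" using reals_Archimedean2 by blast
    show "\<forall>\<^sub>F n in sequentially. indicator (A \<inter> ?B n) p = (indicator A p :: complex)"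
      using eventually_ge_at_top[of N]
    proof eventually_elim
      case (elim n)
      then have "real N \<le> real n" by simp
      then have "p \<in> ?B n" using N by (cases p) (auto simp: mem_box Basis_prod_def)
      then show ?case by (auto simp: indicator_def)
    qed
  qed
  show "norm (indicator (A \<inter> ?B n) p :: complex) \<le> norm (indicator A p :: complex)" for n p
    by (auto simp: indicator_def)
qed (rule A)

lemma fourier_approximable_simple:
  assumes f: "simple_function borel f" "f \<in> weighted_L2 s b"
  shows "fourier_approximable s b f"
proof -
  have fin: "finite (range f)" using f(1) by (simp add: simple_function_def)
  have [measurable]: "f \<in> borel_measurable borel" using f(1) by (rule borel_measurable_simple_function)
  have eq: "f p = (\<Sum>y\<in>range f - {0}. y * indicator (f -` {y}) p)" for p
  proof -
    have "(\<Sum>y\<in>range f - {0}. y * indicator (f -` {y}) p) = (\<Sum>y\<in>range f. y * indicator (f -` {y}) p)"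
      using fin by (intro sum.mono_neutral_left) auto
    also have "\<dots> = (\<Sum>y\<in>range f. if y = f p then y else 0)"
      by (intro sum.cong) (auto simp: indicator_def)
    also have "\<dots> = f p" using fin by simp
    finally show ?thesis by simp
  qed
  have "fourier_approximable s b (\<lambda>p. \<Sum>y\<in>range f - {0}. y * indicator (f -` {y}) p)"
  proof (intro fourier_approximable_sum fourier_approximable_indicator)
    fix y assume y: "y \<in> range f - {0}"
    show S: "f -` {y} \<in> sets borel" using measurable_sets[of f borel borel "{y}"] by simp
    have "(\<lambda>p. (1 / y) * f p) \<in> weighted_L2 s b" using f(2) by (rule weighted_L2_scale)
    then show "indicator (f -` {y}) \<in> weighted_L2 s b"
    proof (rule weighted_L2_mono)
      show "norm (indicator (f -` {y}) p :: complex) \<le> norm ((1 / y) * f p)" for p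
        using y by (auto simp: indicator_def)
    qed (use S in measurable)
  qed
  then show ?thesis by (simp only: eq[symmetric])
qed

text \<open>Simple functions converging to W can be chosen with modulus at most \<open>2 |W|\<close>, so that the convergence is
  dominated.\<close>

theorem fourier_schwartz_dense:
  assumes W: "W \<in> weighted_L2 s b"
  shows "fourier_approximable s b W"
proof -
  have [measurable]: "W \<in> borel_measurable borel" by (rule weighted_L2_measurable[OF W])
  obtain f where f: "\<And>i. simple_function borel (f i)" "\<And>p. (\<lambda>i. f i p) \<longlonglongrightarrow> W p" "\<And>i p. dist (f i p) 0 \<le> 2 * dist (W p) 0"
    using borel_measurable_implies_sequence_metric[of W borel 0] by auto
  have D: "(\<lambda>p. 2 * W p) \<in> weighted_L2 s b" by (rule weighted_L2_scale[OF W])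
  have le: "norm (f i p) \<le> norm (2 * W p)" for i p using f(3)[of i p] by (simp add: norm_mult)
  show ?thesis
  proof (rule fourier_approximable_dominated[OF _ f(2) D le])
    show "fourier_approximable s b (f i)" for i
      by (intro fourier_approximable_simple f weighted_L2_mono[OF D _ le] borel_measurable_simple_function)
  qed
qed

section \<open>The completion on the Fourier side\<close>

lemma schwartz_norm_diff:
  "schwartz F \<Longrightarrow> schwartz G \<Longrightarrow>
    schwartz_norm s b (\<lambda>p. F p - G p) = weighted_L2_norm s b (\<lambda>p. fourier F p - fourier G p)"
  by (simp add: schwartz_norm_def fourier_diff weighted_L2_norm_def)

lemma X_Cauchy_schwartz: "F \<in> X_Cauchy s b \<Longrightarrow> schwartz (F n)"
  by (simp add: X_Cauchy_def)

lemma X_Cauchy_fourier_convergent: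
  assumes F: "F \<in> X_Cauchy s b"
  obtains W where "W \<in> weighted_L2 s b" "(\<lambda>n. weighted_L2_norm s b (\<lambda>p. fourier (F n) p - W p)) \<longlonglongrightarrow> 0"
proof (rule weighted_L2_complete)
  show "fourier (F n) \<in> weighted_L2 s b" for n
    by (rule fourier_in_weighted_L2[OF X_Cauchy_schwartz[OF F]])
  show "\<exists>N. \<forall>m\<ge>N. \<forall>n\<ge>N. weighted_L2_norm s b (\<lambda>p. fourier (F m) p - fourier (F n) p) < e" if "e > 0" for e
    using F that unfolding schwartz_norm_diff[OF X_Cauchy_schwartz[OF F] X_Cauchy_schwartz[OF F], symmetric]
    by (simp add: X_Cauchy_def)
qed

lemma X_rel_refl:
  assumes F: "F \<in> X_Cauchy s b" shows "(F, F) \<in> X_rel s b"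
proof -
  have "schwartz_norm s b (\<lambda>p. F n p - F n p) = 0" for n
    unfolding schwartz_norm_diff[OF X_Cauchy_schwartz[OF F] X_Cauchy_schwartz[OF F]]
    by (simp add: weighted_L2_norm_def)
  then have "(\<lambda>n. schwartz_norm s b (\<lambda>p. F n p - F n p)) \<longlonglongrightarrow> 0" by (simp only: tendsto_const)
  then show ?thesis unfolding X_rel_def using F by blast
qed

text \<open>Equivalent sequences have transforms at a distance tending to 0, so one representing sequence determines the
  transform of the class.\<close>

lemma has_X_fourier_class:
  assumes F: "F \<in> X_Cauchy s b" and W: "W \<in> weighted_L2 s b"
    and lim: "(\<lambda>n. weighted_L2_norm s b (\<lambda>p. fourier (F n) p - W p)) \<longlonglongrightarrow> 0"
  shows "has_X_fourier s b (X_rel s b `` {F}) W"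
  unfolding has_X_fourier_def
proof (intro conjI ballI W)
  show "X_rel s b `` {F} \<in> X s b" unfolding X_def using F by (rule quotientI)
  fix G assume "G \<in> X_rel s b `` {F}"
  then have G: "G \<in> X_Cauchy s b" and FG: "(\<lambda>n. schwartz_norm s b (\<lambda>p. F n p - G n p)) \<longlonglongrightarrow> 0"
    by (auto simp: X_rel_def)
  note sF = X_Cauchy_schwartz[OF F] and sG = X_Cauchy_schwartz[OF G]
  have "(\<lambda>n. weighted_L2_norm s b (\<lambda>p. fourier (G n) p - fourier (F n) p) + weighted_L2_norm s b (\<lambda>p. fourier (F n) p - W p)) \<longlonglongrightarrow> 0 + 0"
    using FG lim unfolding schwartz_norm_diff[OF sF sG] weighted_L2_norm_minus_commute[of s b "fourier (F n)" "fourier (G n)" for n]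
    by (intro tendsto_add)
  then have "(\<lambda>n. weighted_L2_norm s b (\<lambda>p. fourier (G n) p - fourier (F n) p) + weighted_L2_norm s b (\<lambda>p. fourier (F n) p - W p)) \<longlonglongrightarrow> 0"
    by simp
  then show "(\<lambda>n. weighted_L2_norm s b (\<lambda>p. fourier (G n) p - W p)) \<longlonglongrightarrow> 0"
  proof (rule Lim_null_comparison[rotated], intro always_eventually allI)
    fix n
    show "norm (weighted_L2_norm s b (\<lambda>p. fourier (G n) p - W p)) \<le>
      weighted_L2_norm s b (\<lambda>p. fourier (G n) p - fourier (F n) p) + weighted_L2_norm s b (\<lambda>p. fourier (F n) p - W p)"
      using weighted_L2_triangle[OF fourier_in_weighted_L2[OF sG] fourier_in_weighted_L2[OF sF] W] weighted_L2_norm_nonneg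
      by simp
  qed
qed

lemma has_X_fourier_X_fourier:
  assumes "u \<in> X s b" shows "has_X_fourier s b u (X_fourier s b u)"
proof -
  obtain F where F: "F \<in> X_Cauchy s b" and u: "u = X_rel s b `` {F}"
    using assms unfolding X_def by (rule quotientE)
  obtain W where "W \<in> weighted_L2 s b" "(\<lambda>n. weighted_L2_norm s b (\<lambda>p. fourier (F n) p - W p)) \<longlonglongrightarrow> 0"
    using X_Cauchy_fourier_convergent[OF F] by blast
  then have "has_X_fourier s b u W" unfolding u by (rule has_X_fourier_class[OF F])
  then show ?thesis unfolding X_fourier_def by (rule someI[where P="has_X_fourier s b u"])
qed

text \<open>By the reverse triangle inequality the norms along every representing sequence converge to the norm of the
  transform, so the description defining \<open>X_norm\<close> has exactly one solution.\<close>

lemma X_norm_eq: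
  assumes W: "has_X_fourier s b u W"
  shows "X_norm s b u = weighted_L2_norm s b W"
proof -
  have u: "u \<in> X s b" and W2: "W \<in> weighted_L2 s b"
    and lim: "\<And>F. F \<in> u \<Longrightarrow> (\<lambda>n. weighted_L2_norm s b (\<lambda>p. fourier (F n) p - W p)) \<longlonglongrightarrow> 0"
    using W by (auto simp: has_X_fourier_def)
  obtain F where F: "F \<in> X_Cauchy s b" and u': "u = X_rel s b `` {F}"
    using u unfolding X_def by (rule quotientE)
  have Fu: "F \<in> u" using X_rel_refl[OF F] by (simp add: u')
  have conv: "(\<lambda>n. schwartz_norm s b (G n)) \<longlonglongrightarrow> weighted_L2_norm s b W" if G: "G \<in> u" for G
  proof -
    have "schwartz (G n)" for n using G X_Cauchy_schwartz by (auto simp: u' X_rel_def)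
    then have "\<bar>schwartz_norm s b (G n) - weighted_L2_norm s b W\<bar> \<le> weighted_L2_norm s b (\<lambda>p. fourier (G n) p - W p)" for n
      unfolding schwartz_norm_def by (intro weighted_L2_reverse_triangle fourier_in_weighted_L2 W2)
    then have "(\<lambda>n. schwartz_norm s b (G n) - weighted_L2_norm s b W) \<longlonglongrightarrow> 0"
      by (intro Lim_null_comparison[OF _ lim[OF G]] always_eventually) simp
    then show ?thesis by (simp only: LIM_zero_iff)
  qed
  show ?thesis unfolding X_norm_def
  proof (rule the_equality)
    show "r = weighted_L2_norm s b W" if "\<forall>F\<in>u. (\<lambda>n. schwartz_norm s b (F n)) \<longlonglongrightarrow> r" for r
      using LIMSEQ_unique[OF bspec[OF that Fu] conv[OF Fu]] .
  qed (use conv in blast)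
qed

text \<open>A sequence of Schwartz functions whose transforms approximate W represents the required element.\<close>

lemma X_fourier_surj:
  assumes W: "W \<in> weighted_L2 s b"
  obtains w where "w \<in> X s b" "has_X_fourier s b w W"
proof -
  have "\<exists>F. schwartz F \<and> weighted_L2_norm s b (\<lambda>p. fourier F p - W p) < 1 / real (Suc n)" for n
    using fourier_schwartz_dense[OF W] unfolding fourier_approximable_def by simp
  then obtain F where F: "\<And>n. schwartz (F n)" and FW: "\<And>n. weighted_L2_norm s b (\<lambda>p. fourier (F n) p - W p) < 1 / real (Suc n)"
    by metis
  have lim: "(\<lambda>n. weighted_L2_norm s b (\<lambda>p. fourier (F n) p - W p)) \<longlonglongrightarrow> 0"
    using FW weighted_L2_norm_nonneg
    by (intro Lim_null_comparison[OF _ LIMSEQ_inverse_real_of_nat] always_eventually)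
       (simp add: less_imp_le inverse_eq_divide)
  have "F \<in> X_Cauchy s b"
    unfolding X_Cauchy_def
  proof (intro CollectI conjI allI impI F)
    fix e :: real assume "e > 0"
    then obtain N where N: "\<And>n. n \<ge> N \<Longrightarrow> weighted_L2_norm s b (\<lambda>p. fourier (F n) p - W p) < e / 2"
      using order_tendstoD(2)[OF lim, of "e/2"] by (auto simp: eventually_sequentially)
    have "schwartz_norm s b (\<lambda>p. F m p - F n p) < e" if "m \<ge> N" "n \<ge> N" for m n
      using weighted_L2_triangle[OF fourier_in_weighted_L2[OF F] W fourier_in_weighted_L2[OF F], of m n]
        N[OF that(1)] N[OF that(2)] weighted_L2_norm_minus_commute[of s b W "fourier (F n)"]
      by (simp add: schwartz_norm_diff[OF F F])
    then show "\<exists>N. \<forall>m\<ge>N. \<forall>n\<ge>N. schwartz_norm s b (\<lambda>p. F m p - F n p) < e" by blast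
  qed
  from has_X_fourier_class[OF this W lim] show ?thesis
    using that by (auto simp: has_X_fourier_def)
qed

section \<open>The estimate\<close>

text \<open>The transform of the function that is estimated, in terms of the transforms of the two factors.\<close>

definition quadratic_term :: "(real \<times> real \<Rightarrow> complex) \<Rightarrow> (real \<times> real \<Rightarrow> complex) \<Rightarrow> real \<times> real \<Rightarrow> complex" where
  "quadratic_term U V = (\<lambda>(\<tau>, \<xi>).
         complex_of_real (\<bar>\<xi>\<bar>\<^sup>2) * fourier_prod U V (\<tau>, \<xi>) / (2 * \<i> * complex_of_real (gam \<xi>)))"

text \<open>The multiplier is at most \<open>1/2\<close> because \<open>\<xi>\<^sup>2 \<le> \<gamma>(\<xi>)\<close>; at \<open>\<xi> = 0\<close> the
  quotient has the value 0.\<close>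

lemma norm_quadratic_term_le:
  "norm (quadratic_term U V p) \<le> norm (LINT q|lborel. U q * V (p - q))"
proof -
  obtain \<tau> \<xi> where p: "p = (\<tau>, \<xi>)" by (cases p)
  let ?I = "norm (LINT q|lborel. U q * V (p - q))"
  have g: "\<xi>\<^sup>2 \<le> gam \<xi>" unfolding gam_def by (rule real_le_rsqrt) simp
  then have g0: "0 \<le> gam \<xi>" by (rule order_trans[rotated]) simp
  have m: "\<xi>\<^sup>2 / (2 * gam \<xi>) \<le> 1"
    using g g0 by (cases "gam \<xi> = 0") (simp_all add: field_simps)
  have pi: "1 \<le> (2 * pi)\<^sup>2" using pi_ge_two by (intro one_le_power) linarith
  have "norm (quadratic_term U V p) = (\<xi>\<^sup>2 / (2 * gam \<xi>)) * (?I / (2 * pi)\<^sup>2)"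
    using g0 by (simp add: quadratic_term_def p fourier_prod_def norm_mult norm_divide norm_power)
  also have "\<dots> \<le> 1 * ?I"
  proof (intro mult_mono m)
    show "?I / (2 * pi)\<^sup>2 \<le> ?I" using divide_left_mono[OF pi, of ?I] pi by simp
  qed auto
  finally show ?thesis by simp
qed

lemma borel_measurable_quadratic_term:
  assumes [measurable]: "U \<in> borel_measurable borel" "V \<in> borel_measurable borel"
  shows "quadratic_term U V \<in> borel_measurable borel"
proof -
  have [measurable]: "fourier_prod U V \<in> borel_measurable borel"
    unfolding fourier_prod_def[abs_def] by measurable
  show ?thesis unfolding quadratic_term_def split_beta' prod.collapse by measurable
qed

text \<open>With \<open>f\<close> and \<open>g\<close> the weighted moduli of U and V, the operator with kernel \<open>bilinear_kernel\<close> gives the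
  output weight times the convolution N of \<open>|U|\<close> and \<open>|V|\<close>. Its square integral is finite, so N is
  finite almost everywhere, which is the integrability claimed, and N dominates the
  quadratic term.\<close>

lemma weighted_bilinear_estimate:
  assumes a: "0 < a" "a < 1/2" and b: "b > 1/2" and s: "-a/2 \<le> s"
  shows "\<exists>c>0. \<forall>U\<in>weighted_L2 s b. \<forall>V\<in>weighted_L2 s b.
    (AE p in lborel. conv_integrable U V p) \<and> quadratic_term U V \<in> weighted_L2 s (-a) \<and>
    weighted_L2_norm s (-a) (quadratic_term U V) \<le> c * weighted_L2_norm s b U * weighted_L2_norm s b V"
proof -
  obtain C where C: "C < \<infinity>" and est: "\<And>f g. f \<in> borel_measurable borel \<Longrightarrow> g \<in> borel_measurable borel \<Longrightarrow>
    (\<integral>\<^sup>+p. (\<integral>\<^sup>+q. ennreal (bilinear_kernel s a b p q) * (f q * g (p - q)) \<partial>lborel)\<^sup>2 \<partial>lborel)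
      \<le> C * (sq_integral f * sq_integral g)"
    using bilinear_estimate[OF a b s] by blast
  define c where "c = 1 + sqrt (enn2real C)"
  have c: "c > 0" by (simp add: c_def add_pos_nonneg)
  have Cc: "C \<le> ennreal (c\<^sup>2)"
  proof -
    have "enn2real C \<le> c\<^sup>2" by (simp add: c_def power2_sum)
    then show ?thesis using C by (metis ennreal_enn2real ennreal_leI infinity_ennreal_def)
  qed
  have "(AE p in lborel. conv_integrable U V p) \<and> quadratic_term U V \<in> weighted_L2 s (-a) \<and>
    weighted_L2_norm s (-a) (quadratic_term U V) \<le> c * weighted_L2_norm s b U * weighted_L2_norm s b V"
    if U: "U \<in> weighted_L2 s b" and V: "V \<in> weighted_L2 s b" for U V
  proof -
    note [measurable] = weighted_L2_measurable[OF U] weighted_L2_measurable[OF V]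
    let ?w = "weight s b" and ?o = "weight s (-a)"
    let ?u = "weighted_L2_norm s b U" and ?v = "weighted_L2_norm s b V"
    define N where "N p = (\<integral>\<^sup>+q. ennreal (norm (U q * V (p - q))) \<partial>lborel)" for p
    have [measurable]: "N \<in> borel_measurable borel" unfolding N_def by measurable
    have "(\<integral>\<^sup>+q. ennreal (bilinear_kernel s a b p q) * (ennreal (?w q * norm (U q)) * ennreal (?w (p - q) * norm (V (p - q)))) \<partial>lborel)
      = ennreal (?o p) * N p" for p
    proof -
      have "ennreal (bilinear_kernel s a b p q) * (ennreal (?w q * norm (U q)) * ennreal (?w (p - q) * norm (V (p - q)))) =
        ennreal (?o p) * ennreal (norm (U q * V (p - q)))" for q
      proof -
        have "bilinear_kernel s a b p q * ((?w q * norm (U q)) * (?w (p - q) * norm (V (p - q)))) = ?o p * norm (U q * V (p - q))"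
          using weight_pos[of s b q] weight_pos[of s b "p - q"]
          by (simp add: bilinear_kernel_def norm_mult field_simps)
        moreover have "0 \<le> bilinear_kernel s a b p q"
          by (simp add: bilinear_kernel_def less_imp_le[OF weight_pos])
        ultimately show ?thesis
          by (simp add: less_imp_le[OF weight_pos] flip: ennreal_mult)
      qed
      then show ?thesis unfolding N_def by (simp add: nn_integral_cmult)
    qed
    then have "(\<integral>\<^sup>+p. (ennreal (?o p) * N p)\<^sup>2 \<partial>lborel) \<le>
       C * ((\<integral>\<^sup>+p. (ennreal (?w p * norm (U p)))\<^sup>2 \<partial>lborel) * (\<integral>\<^sup>+p. (ennreal (?w p * norm (V p)))\<^sup>2 \<partial>lborel))"
      using est[of "\<lambda>p. ennreal (?w p * norm (U p))" "\<lambda>p. ennreal (?w p * norm (V p))"] by simp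
    also have "\<dots> \<le> ennreal (c\<^sup>2) * (ennreal (?u\<^sup>2) * ennreal (?v\<^sup>2))"
      using Cc by (simp add: ennreal_power weight_pos less_imp_le weighted_L2_norm_nn[OF U] weighted_L2_norm_nn[OF V] mult_right_mono)
    also have "\<dots> = ennreal ((c * ?u * ?v)\<^sup>2)"
      by (simp add: power_mult_distrib mult.assoc flip: ennreal_mult)
    finally have bound: "(\<integral>\<^sup>+p. (ennreal (?o p) * N p)\<^sup>2 \<partial>lborel) \<le> ennreal ((c * ?u * ?v)\<^sup>2)" .
    then have "(\<integral>\<^sup>+p. (ennreal (?o p) * N p)\<^sup>2 \<partial>lborel) < \<infinity>" by (rule le_less_trans) simp
    then have "AE p in lborel. (ennreal (?o p) * N p)\<^sup>2 \<noteq> \<infinity>"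
      by (intro nn_integral_PInf_AE) auto
    then have conv: "AE p in lborel. conv_integrable U V p"
    proof eventually_elim
      case (elim p)
      have "N p < \<infinity>"
      proof (rule ccontr)
        assume "\<not> N p < \<infinity>"
        then have "N p = top" by (auto simp: less_top[symmetric])
        then show False using elim weight_pos[of s "-a" p] by (simp add: ennreal_mult_top power2_eq_square)
      qed
      then show ?case unfolding conv_integrable_def N_def by (intro integrableI_bounded) measurable
    qed
    have le: "ennreal (norm (quadratic_term U V p)) \<le> N p" for p
    proof -
      have "ennreal (norm (LINT q|lborel. U q * V (p - q))) \<le> N p"
      proof (cases "integrable lborel (\<lambda>q. U q * V (p - q))")
        case True
        then show ?thesis unfolding N_def by (rule integral_norm_bound_ennreal)
      qed (simp add: not_integrable_integral_eq)
      then show ?thesis using ennreal_leI[OF norm_quadratic_term_le] by (rule order_trans[rotated])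
    qed
    have "(\<integral>\<^sup>+p. ennreal ((?o p * norm (quadratic_term U V p))\<^sup>2) \<partial>lborel) \<le> (\<integral>\<^sup>+p. (ennreal (?o p) * N p)\<^sup>2 \<partial>lborel)"
    proof (rule nn_integral_mono)
      fix p
      have "(ennreal (?o p) * ennreal (norm (quadratic_term U V p)))\<^sup>2 \<le> (ennreal (?o p) * N p)\<^sup>2"
        by (intro power_mono mult_left_mono le) auto
      then show "ennreal ((?o p * norm (quadratic_term U V p))\<^sup>2) \<le> (ennreal (?o p) * N p)\<^sup>2"
        using weight_pos[of s "-a" p] by (simp add: ennreal_mult ennreal_power[symmetric])
    qed
    then have "(\<integral>\<^sup>+p. ennreal ((?o p * norm (quadratic_term U V p))\<^sup>2) \<partial>lborel) \<le> ennreal ((c * ?u * ?v)\<^sup>2)"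
      using bound by (rule order_trans)
    from weighted_L2_norm_le[OF borel_measurable_quadratic_term _ this]
    show ?thesis using conv c by (simp add: weighted_L2_norm_nonneg)
  qed
  then show ?thesis using c by blast
qed

theorem theorem1p1:
  fixes s a b :: real
  assumes "s > -1/4"
    and "(s \<ge> 0 \<and> b > 1/2 \<and> 1/4 < a \<and> a < 1/2) \<or>
         (-1/4 < s \<and> s < 0 \<and> b > 1/2 \<and> 1/4 < a \<and> a < 1/2 \<and> \<bar>s\<bar> < a/2)"
  shows "\<exists>c>0. \<forall>u\<in>X s b. \<forall>v\<in>X s b.
    (AE p in lborel. conv_integrable (X_fourier s b u) (X_fourier s b v) p) \<and>
    (\<exists>w\<in>X s (-a).
       has_X_fourier s (-a) w (\<lambda>(\<tau>, \<xi>).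
         complex_of_real (\<bar>\<xi>\<bar>\<^sup>2) * fourier_prod (X_fourier s b u) (X_fourier s b v) (\<tau>, \<xi>)
           / (2 * \<i> * complex_of_real (gam \<xi>))) \<and>
       X_norm s (-a) w \<le> c * X_norm s b u * X_norm s b v)"
proof -
  have "0 < a" "a < 1/2" "b > 1/2" "-a/2 \<le> s" using assms(2) by (auto simp: abs_if)
  from weighted_bilinear_estimate[OF this] obtain c where c: "c > 0"
    and est: "\<And>U V. U \<in> weighted_L2 s b \<Longrightarrow> V \<in> weighted_L2 s b \<Longrightarrow>
      (AE p in lborel. conv_integrable U V p) \<and> quadratic_term U V \<in> weighted_L2 s (-a) \<and>
      weighted_L2_norm s (-a) (quadratic_term U V) \<le> c * weighted_L2_norm s b U * weighted_L2_norm s b V"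
    by blast
  show ?thesis unfolding quadratic_term_def[symmetric]
  proof (intro exI[of _ c] conjI c ballI)
    fix u v assume u: "u \<in> X s b" and v: "v \<in> X s b"
    let ?U = "X_fourier s b u" and ?V = "X_fourier s b v"
    have U: "has_X_fourier s b u ?U" and V: "has_X_fourier s b v ?V"
      using u v by (simp_all add: has_X_fourier_X_fourier)
    then have UV: "?U \<in> weighted_L2 s b" "?V \<in> weighted_L2 s b" by (simp_all add: has_X_fourier_def)
    show "AE p in lborel. conv_integrable ?U ?V p" using est[OF UV] by blast
    obtain w where w: "w \<in> X s (-a)" "has_X_fourier s (-a) w (quadratic_term ?U ?V)"
      using X_fourier_surj est[OF UV] by blast
    then show "\<exists>w\<in>X s (-a). has_X_fourier s (-a) w (quadratic_term ?U ?V) \<and> X_norm s (-a) w \<le> c * X_norm s b u * X_norm s b v"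
      using est[OF UV] by (auto simp: X_norm_eq[OF U] X_norm_eq[OF V] X_norm_eq[OF w(2)])
  qed
qed

end
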